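(* Let $D>1$ be squarefree, $u=A+B\sqrt{D}\in\mathcal{S}_D$, $C=C(u)$, $d=-27C^2D$, and let $[a,2b,c]$ be a primitive binary quadratic form with $a>0$ and $b^2-ac=d$. Let $x,y$ be integers and $f=f(x,y)=ax^2+2bxy+cy^2$. Suppose that $$\gcd(af(x,y),\,3N(u)Dy)=1.$$ Then $L=R$, where $$L=\left(\frac{9Ay+(B/C)(ax+by)(1+2\omega)}{f(x,y)}\right)_3,\qquad R=\left(\frac{9A-(B/C)\,b\,(1+2\omega)}{a}\right)_3 .$$
   Context: For squarefree $D>1$, let $\mathcal{O}$ be the ring of integers of $\mathbb{Q}(\sqrt{D})$. The set $\mathcal{S}_D$ consists of those $u=A+B\sqrt{D}$ with $A,B\in\mathbb{Z}$ such that the norm $N(u)=A^2-B^2D$ is the cube of an integer, $u$ is not a cube in $\mathcal{O}$, and $\gcd(A,B)$ is not divisible by the cube of any prime. For $u\in\mathcal{S}_D$, $C(u)$ is the product of the distinct odd primes that divide $\gcd(A,B)$ but do not divide $D$ (so $C\mid B$). Let $\omega=(-1+i\sqrt{3})/2$. For $\alpha\in\mathbb{Z}[\omega]$ and a prime $\pi$ of $\mathbb{Z}[\omega]$ not dividing $3$, $(\alpha/\pi)_3\in\{0,1,\omega,\omega^2\}$ is the cubic residue symbol, $(\alpha/\pi)_3\equiv \alpha^{(N\pi-1)/3}\pmod{\pi}$; for a positive rational integer $n$ coprime to $3$, $(\alpha/n)_3$ is defined multiplicatively via the factorization of $n$ into primes of $\mathbb{Z}[\omega]$. (Note $f(x,y)>0$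 since $a>0$ and $d<0$.) *)

theory Defs
  imports Complex_Main "HOL-Computational_Algebra.Computational_Algebra"
begin

section \<open>The ring of Eisenstein integers\<close>

text \<open>\<open>Eis p q\<close> stands for $p + q\omega$ with $\omega = (-1 + i\sqrt 3)/2$, so
  $\omega^2 = -1 - \omega$; see \<open>eis_to_complex\<close> below for the embedding into the
  complex numbers.\<close>

datatype eisenstein = Eis (eis_fst: int) (eis_snd: int)

lemma eis_eq_iff: "x = y \<longleftrightarrow> eis_fst x = eis_fst y \<and> eis_snd x = eis_snd y"
  by (cases x; cases y) auto

instantiation eisenstein :: comm_ring_1
begin

definition "0 = Eis 0 0"
definition "1 = Eis 1 0"
definition "x + y = Eis (eis_fst x + eis_fst y) (eis_snd x + eis_snd y)"
definition "x - y = Eis (eis_fst x - eis_fst y) (eis_snd x - eis_snd y)"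
definition "- x = Eis (- eis_fst x) (- eis_snd x)"
definition "x * y = Eis (eis_fst x * eis_fst y - eis_snd x * eis_snd y)
  (eis_fst x * eis_snd y + eis_snd x * eis_fst y - eis_snd x * eis_snd y)"

instance
  by standard
    (simp_all add: eis_eq_iff zero_eisenstein_def one_eisenstein_def plus_eisenstein_def
      minus_eisenstein_def uminus_eisenstein_def times_eisenstein_def algebra_simps)

end

lemmas eis_arith_defs = zero_eisenstein_def one_eisenstein_def plus_eisenstein_def
  minus_eisenstein_def uminus_eisenstein_def times_eisenstein_def

lemma eis_sel_simps [simp]:
  "eis_fst 0 = 0" "eis_snd 0 = 0" "eis_fst 1 = 1" "eis_snd 1 = 0"
  "eis_fst (x + y) = eis_fst x + eis_fst y" "eis_snd (x + y) = eis_snd x + eis_snd y"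
  "eis_fst (x - y) = eis_fst x - eis_fst y" "eis_snd (x - y) = eis_snd x - eis_snd y"
  "eis_fst (- x) = - eis_fst x" "eis_snd (- x) = - eis_snd x"
  "eis_fst (x * y) = eis_fst x * eis_fst y - eis_snd x * eis_snd y"
  "eis_snd (x * y) = eis_fst x * eis_snd y + eis_snd x * eis_fst y - eis_snd x * eis_snd y"
  by (simp_all add: eis_arith_defs)

lemma eis_of_nat [simp]: "eis_fst (of_nat n) = int n" "eis_snd (of_nat n) = 0"
  by (induction n) simp_all

lemma eis_of_int [simp]: "eis_fst (of_int k) = k" "eis_snd (of_int k) = 0"
  by (cases k; simp)+

definition eis_omega :: eisenstein where
  "eis_omega = Eis 0 1"

definition eis_cnj :: "eisenstein \<Rightarrow> eisenstein" where
  "eis_cnj x = Eis (eis_fst x - eis_snd x) (- eis_snd x)"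

definition eis_norm :: "eisenstein \<Rightarrow> int" where
  "eis_norm x = (eis_fst x)\<^sup>2 - eis_fst x * eis_snd x + (eis_snd x)\<^sup>2"

lemma eis_omega_sel [simp]: "eis_fst eis_omega = 0" "eis_snd eis_omega = 1"
  by (simp_all add: eis_omega_def)

lemma eis_cnj_sel [simp]:
  "eis_fst (eis_cnj x) = eis_fst x - eis_snd x" "eis_snd (eis_cnj x) = - eis_snd x"
  by (simp_all add: eis_cnj_def)

lemma eis_mult_cnj: "x * eis_cnj x = of_int (eis_norm x)"
  by (simp add: eis_eq_iff eis_norm_def power2_eq_square algebra_simps)

lemma eis_norm_mult: "eis_norm (x * y) = eis_norm x * eis_norm y"
  by (simp add: eis_norm_def power2_eq_square algebra_simps)

lemma eis_norm_cnj [simp]: "eis_norm (eis_cnj x) = eis_norm x"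
  by (simp add: eis_norm_def power2_eq_square algebra_simps)

lemma eis_norm_of_int [simp]: "eis_norm (of_int k) = k\<^sup>2"
  by (simp add: eis_norm_def)

lemma eis_norm_4: "4 * eis_norm x = (2 * eis_fst x - eis_snd x)\<^sup>2 + 3 * (eis_snd x)\<^sup>2"
  by (simp add: eis_norm_def power2_eq_square algebra_simps)

lemma eis_norm_nonneg [simp]: "eis_norm x \<ge> 0"
proof -
  have "0 \<le> 4 * eis_norm x" unfolding eis_norm_4 by simp
  then show ?thesis by simp
qed

lemma eis_norm_eq_0_iff [simp]: "eis_norm x = 0 \<longleftrightarrow> x = 0"
proof
  assume "eis_norm x = 0"
  then have *: "(2 * eis_fst x - eis_snd x)\<^sup>2 + 3 * (eis_snd x)\<^sup>2 = 0"
    using eis_norm_4[of x] by simp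
  have "3 * (eis_snd x)\<^sup>2 = 0" "(2 * eis_fst x - eis_snd x)\<^sup>2 = 0"
    using * zero_le_power2[of "eis_snd x"] zero_le_power2[of "2 * eis_fst x - eis_snd x"]
    by linarith+
  then show "x = 0" by (simp add: eis_eq_iff)
qed (simp add: eis_norm_def)

lemma eis_norm_0 [simp]: "eis_norm 0 = 0"
  by simp

lemma eis_norm_pos_iff [simp]: "eis_norm x > 0 \<longleftrightarrow> x \<noteq> 0"
  using eis_norm_nonneg[of x] eis_norm_eq_0_iff[of x] by linarith

instance eisenstein :: idom
proof
  fix x y :: eisenstein
  assume "x \<noteq> 0" "y \<noteq> 0"
  then have "eis_norm (x * y) \<noteq> 0" by (simp add: eis_norm_mult)
  then show "x * y \<noteq> 0" by auto
qed

definition eis_to_complex :: "eisenstein \<Rightarrow> complex" where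
  "eis_to_complex x =
     of_int (eis_fst x) + of_int (eis_snd x) * ((- 1 + \<i> * of_real (sqrt 3)) / 2)"

lemma Re_eis_to_complex: "Re (eis_to_complex x) = of_int (eis_fst x) - of_int (eis_snd x) / 2"
  and Im_eis_to_complex: "Im (eis_to_complex x) = of_int (eis_snd x) * sqrt 3 / 2"
  by (simp_all add: eis_to_complex_def)

lemma eis_to_complex_hom:
  "eis_to_complex 0 = 0" "eis_to_complex 1 = 1"
  "eis_to_complex (x + y) = eis_to_complex x + eis_to_complex y"
  "eis_to_complex (x * y) = eis_to_complex x * eis_to_complex y"
  by (simp_all add: complex_eq_iff Re_eis_to_complex Im_eis_to_complex field_simps)

lemma eis_to_complex_omega: "eis_to_complex eis_omega = (- 1 + \<i> * of_real (sqrt 3)) / 2"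
  by (simp add: eis_to_complex_def)

lemma inj_eis_to_complex: "inj eis_to_complex"
  by (rule injI) (auto simp: complex_eq_iff Re_eis_to_complex Im_eis_to_complex eis_eq_iff)

text \<open>Division with remainder: each coordinate of the exact quotient is rounded to a nearest
  integer.\<close>

definition round_div :: "int \<Rightarrow> int \<Rightarrow> int" where
  "round_div a n = (2 * a + n) div (2 * n)"

lemma round_div_mult: "n > 0 \<Longrightarrow> round_div (a * n) n = a"
  unfolding round_div_def
  by (rule int_div_pos_eq[where r = n]) (simp_all add: algebra_simps)

lemma round_div_rem:
  assumes "n > 0"
  shows "\<bar>2 * (a - round_div a n * n)\<bar> \<le> n"
proof -
  have "2 * a + n = 2 * n * round_div a n + (2 * a + n) mod (2 * n)"
    unfolding round_div_def by (rule mult_div_mod_eq[symmetric])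
  moreover have "0 \<le> (2 * a + n) mod (2 * n)" "(2 * a + n) mod (2 * n) < 2 * n"
    using assms by simp_all
  ultimately show ?thesis by (simp add: algebra_simps abs_le_iff)
qed

instantiation eisenstein :: normalization_euclidean_semiring
begin

definition divide_eisenstein :: "eisenstein \<Rightarrow> eisenstein \<Rightarrow> eisenstein" where
  "x div y = (let z = x * eis_cnj y; n = eis_norm y
     in Eis (round_div (eis_fst z) n) (round_div (eis_snd z) n))"

definition modulo_eisenstein :: "eisenstein \<Rightarrow> eisenstein \<Rightarrow> eisenstein" where
  "x mod y = x - x div y * (y :: eisenstein)"

definition euclidean_size_eisenstein :: "eisenstein \<Rightarrow> nat" where
  "euclidean_size x = nat (eis_norm x)"

text \<open>Up to units, a nonzero element is represented by its unique associate whose argument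
  lies in $[0, \pi/3)$, i.e.\ $p + q\omega$ with $0 \le q < p$.\<close>

definition unit_factor_eisenstein :: "eisenstein \<Rightarrow> eisenstein" where
  "unit_factor x = (let p = eis_fst x; q = eis_snd x in
     if x = 0 then 0
     else if 0 \<le> q \<and> q < p then 1
     else if 0 < p \<and> p \<le> q then 1 + eis_omega
     else if p \<le> 0 \<and> 0 < q then eis_omega
     else if q \<le> 0 \<and> p < q then - 1
     else if p < 0 \<and> q \<le> p then - 1 - eis_omega
     else - eis_omega)"

definition normalize_eisenstein :: "eisenstein \<Rightarrow> eisenstein" where
  "normalize x = eis_cnj (unit_factor x) * x"

lemma eis_unit_cases:
  assumes "u dvd (1 :: eisenstein)"
  shows "u \<in> {1, 1 + eis_omega, eis_omega, - 1, - 1 - eis_omega, - eis_omega}"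
proof -
  from assms obtain v where "1 = u * v" by (auto elim: dvdE)
  then have "eis_norm u * eis_norm v = 1"
    by (metis eis_norm_mult eis_norm_of_int of_int_1 one_power2)
  then have n: "eis_norm u = 1"
    using eis_norm_nonneg[of u] zmult_eq_1_iff by auto
  obtain p q where u: "u = Eis p q" by (cases u)
  have e1: "(2 * p - q)\<^sup>2 + 3 * q\<^sup>2 = 4" using eis_norm_4[of u] n u by simp
  have e2: "(2 * q - p)\<^sup>2 + 3 * p\<^sup>2 = 4" using e1 by (simp add: power2_eq_square algebra_simps)
  have "q\<^sup>2 < 2\<^sup>2" "p\<^sup>2 < 2\<^sup>2"
    using e1 e2 zero_le_power2[of "2 * p - q"] zero_le_power2[of "2 * q - p"]
    unfolding power2_eq_square[of "2 :: int"] by linarith+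
  then have "\<bar>q\<bar> < 2" "\<bar>p\<bar> < 2"
    using abs_le_square_iff[of 2 q] abs_le_square_iff[of 2 p] by linarith+
  then have "q \<in> {-1, 0, 1}" "p \<in> {-1, 0, 1}" by auto
  with e1 u show ?thesis by (auto simp: eis_eq_iff)
qed

lemma eis_unit_factor_cases:
  "x \<noteq> 0 \<Longrightarrow> unit_factor x \<in> {1, 1 + eis_omega, eis_omega, - 1, - 1 - eis_omega, - eis_omega}"
  by (simp add: unit_factor_eisenstein_def Let_def)

lemma eis_unit_mult_cnj:
  assumes "u \<in> {1, 1 + eis_omega, eis_omega, - 1, - 1 - eis_omega, - eis_omega}"
  shows "u * eis_cnj u = 1"
  using assms by (auto simp: eis_eq_iff)

lemma eis_unit_factor_rotate:
  "unit_factor ((1 + eis_omega) * x) = (1 + eis_omega) * unit_factor x"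
proof (cases "x = 0")
  case False
  obtain p q where x: "x = Eis p q" by (cases x)
  have r: "(1 + eis_omega) * Eis p q = Eis (p - q) p"
    by (simp add: eis_eq_iff)
  have "p \<noteq> 0 \<or> q \<noteq> 0" using False by (simp add: x eis_eq_iff)
  then consider "0 \<le> q" "q < p" | "0 < p" "p \<le> q" | "p \<le> 0" "0 < q"
    | "q \<le> 0" "p < q" | "p < 0" "q \<le> p" | "0 \<le> p" "q < 0"
    by linarith
  then show ?thesis
    unfolding x r
    by cases (simp_all add: unit_factor_eisenstein_def Let_def eis_eq_iff)
qed (simp add: unit_factor_eisenstein_def)

instance
proof
  fix x y :: eisenstein
  show "x div 0 = 0"
    by (simp add: divide_eisenstein_def Let_def eis_eq_iff round_div_def)
  show "x div y * y + x mod y = x"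
    by (simp add: modulo_eisenstein_def)
  show "euclidean_size (0 :: eisenstein) = 0"
    by (simp add: euclidean_size_eisenstein_def)
  show "unit_factor (0 :: eisenstein) = 0"
    by (simp add: unit_factor_eisenstein_def)
  show "normalize (0 :: eisenstein) = 0"
    by (simp add: normalize_eisenstein_def)
  show "unit_factor x * normalize x = x"
  proof (cases "x = 0")
    case False
    then have "unit_factor x * eis_cnj (unit_factor x) = 1"
      by (intro eis_unit_mult_cnj eis_unit_factor_cases)
    then show ?thesis by (simp add: normalize_eisenstein_def flip: mult.assoc)
  qed (simp add: normalize_eisenstein_def)
  show "unit_factor x = x" if "x dvd 1"
    using eis_unit_cases[OF that]
    by (elim insertE emptyE; hypsubst) (simp_all add: unit_factor_eisenstein_def Let_def eis_eq_iff)
  show "unit_factor x dvd 1" if "x \<noteq> 0"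
    using eis_unit_mult_cnj[OF eis_unit_factor_cases[OF that]] by (metis dvd_triv_left)
  show "unit_factor (x * y) = x * unit_factor y" if "x dvd 1"
  proof (cases "y = 0")
    case False
    let ?z = "1 + eis_omega"
    have z: "unit_factor (?z * w) = ?z * unit_factor w" for w
      by (rule eis_unit_factor_rotate)
    have "x \<in> {1, ?z, ?z * ?z, ?z * (?z * ?z), ?z * (?z * (?z * ?z)),
        ?z * (?z * (?z * (?z * ?z)))}"
      using eis_unit_cases[OF that] by (simp add: eis_eq_iff)
    then show ?thesis
      by (elim insertE emptyE) (simp_all only: z mult.assoc mult_1_left)
  qed (simp add: unit_factor_eisenstein_def)
  assume y: "y \<noteq> 0"
  then have n: "eis_norm y > 0" by simp
  have "x * y * eis_cnj y = x * of_int (eis_norm y)"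
    by (simp add: mult.assoc eis_mult_cnj)
  then show "x * y div y = x"
    using n by (simp add: divide_eisenstein_def Let_def round_div_mult eis_eq_iff del: eis_norm_pos_iff)
  have "1 \<le> eis_norm y" using n by linarith
  from mult_left_mono[OF this eis_norm_nonneg[of x]]
  show "euclidean_size x \<le> euclidean_size (x * y)"
    unfolding euclidean_size_eisenstein_def eis_norm_mult by (intro nat_mono) (simp only: mult_1_right)
  define z where "z = x * eis_cnj y"
  define r where "r = x mod y * eis_cnj y"
  have r: "r = z - x div y * of_int (eis_norm y)"
    by (simp add: r_def z_def modulo_eisenstein_def algebra_simps eis_mult_cnj)
  have rf: "\<bar>2 * eis_fst r\<bar> \<le> eis_norm y" and rs: "\<bar>2 * eis_snd r\<bar> \<le> eis_norm y"
    using round_div_rem[OF n, of "eis_fst z"] round_div_rem[OF n, of "eis_snd z"]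
    by (simp_all add: r divide_eisenstein_def Let_def z_def)
  have sq: "(2 * eis_fst r)\<^sup>2 \<le> (eis_norm y)\<^sup>2" "(2 * eis_snd r)\<^sup>2 \<le> (eis_norm y)\<^sup>2"
    using rf rs n by (simp_all only: abs_le_square_iff[symmetric] abs_of_pos)
  have "\<bar>2 * eis_fst r\<bar> * \<bar>2 * eis_snd r\<bar> \<le> eis_norm y * eis_norm y"
    using rf rs by (intro mult_mono) simp_all
  then have "\<bar>4 * (eis_fst r * eis_snd r)\<bar> \<le> (eis_norm y)\<^sup>2"
    by (simp add: abs_mult power2_eq_square)
  with sq have "4 * eis_norm r \<le> 3 * (eis_norm y)\<^sup>2"
    by (simp add: eis_norm_def power_mult_distrib)
  moreover have "0 < (eis_norm y)\<^sup>2" using n by (intro zero_less_power)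
  ultimately have "eis_norm r < eis_norm y * eis_norm y"
    by (simp add: power2_eq_square del: eis_norm_pos_iff)
  then have "eis_norm (x mod y) < eis_norm y"
    using n by (simp add: r_def eis_norm_mult del: eis_norm_pos_iff)
  then show "euclidean_size (x mod y) < euclidean_size y"
    using n by (simp add: euclidean_size_eisenstein_def)
qed

end

instance eisenstein :: idom_modulo ..


section \<open>The cubic residue symbol\<close>

text \<open>Intended for a prime \<open>\<pi>\<close> not dividing \<open>3\<close>; then exactly one of
  $0, 1, \omega, \omega^2$ satisfies the congruence.\<close>

definition cubic_residue :: "eisenstein \<Rightarrow> eisenstein \<Rightarrow> eisenstein" where
  "cubic_residue \<alpha> \<pi> =
     (THE s. s \<in> {0, 1, eis_omega, eis_omega\<^sup>2} \<and>
             \<pi> dvd \<alpha> ^ nat ((eis_norm \<pi> - 1) div 3) - s)"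

text \<open>Intended for \<open>n > 0\<close> coprime to \<open>3\<close>. The library's \<^const>\<open>prime_factorization\<close> is the
  multiset of normalized prime factors; as \<^const>\<open>cubic_residue\<close> depends only on the
  associate class of its second argument, the choice of normalization is immaterial.\<close>

definition cubic_symbol :: "eisenstein \<Rightarrow> int \<Rightarrow> eisenstein" where
  "cubic_symbol \<alpha> n = (\<Prod>\<pi>\<in>#prime_factorization (of_int n). cubic_residue \<alpha> \<pi>)"


section \<open>Real quadratic fields and the set of elements under consideration\<close>

definition quad_field :: "int \<Rightarrow> real set" where
  "quad_field D = {p + q * sqrt (of_int D) | p q. p \<in> \<rat> \<and> q \<in> \<rat>}"

definition quad_integers :: "int \<Rightarrow> real set" where
  "quad_integers D = {z \<in> quad_field D. algebraic_int z}"

definition quad_norm :: "int \<Rightarrow> int \<Rightarrow> int \<Rightarrow> int" where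
  "quad_norm D A B = A\<^sup>2 - B\<^sup>2 * D"

definition S_set :: "int \<Rightarrow> real set" where
  "S_set D = {u. \<exists>A B :: int.
     u = of_int A + of_int B * sqrt (of_int D) \<and>
     (\<exists>n :: int. quad_norm D A B = n ^ 3) \<and>
     \<not> (\<exists>z \<in> quad_integers D. u = z ^ 3) \<and>
     (\<forall>p :: int. prime p \<longrightarrow> \<not> p ^ 3 dvd gcd A B)}"

text \<open>$C(u)$ and $N(u)$ are given in terms of the coordinates of $u = A + B\sqrt D$, which are
  determined by \<open>u\<close> because \<open>D > 1\<close> is squarefree.\<close>

definition C_of :: "int \<Rightarrow> int \<Rightarrow> int \<Rightarrow> int" where
  "C_of D A B = (\<Prod>p | prime p \<and> odd p \<and> p dvd gcd A B \<and> \<not> p dvd D. p)"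

end

theory Submission
  imports Defs "HOL-Number_Theory.Cong"
begin

text \<open>Put $X = ax + by$, $\beta = B/C$ and $M = a f(x,y) = X^2 + 27 C^2 D y^2$. Modulo \<open>a\<close> the
  numerator of \<open>L\<close> is \<open>y\<close> times the conjugate of the numerator of \<open>R\<close>, rational integers and
  $\sqrt{-3}$ have symbol \<open>1\<close>, so $L = R$ amounts to $(\nu/M)_3 = 1$ for
  $\nu = \beta X - 3Ay\sqrt{-3}$. The norm of \<open>\<nu>\<close> is $\beta^2 M + 27 N(u) y^2$, so modulo \<open>\<nu>\<close> the
  integer $M\beta^2 y$ is a cube, and reciprocity $(\nu/M)_3 = (M/\nu)_3$ reduces the claim to
  symbols $(l/\nu)_3 = (\nu/l)_3$ of primes \<open>l\<close> dividing one coordinate of \<open>\<nu>\<close>, which are \<open>1\<close>.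
  That $N(u)$ is a cube and $\gcd(A,B)$ is cube-free controls the primes at which numerator and
  denominator have to be cancelled first. Reciprocity between a primary element and a rational
  integer is proved with the cubic Gauss sum \<open>g\<close> of a primary prime \<open>\<pi>\<close> of norm \<open>p\<close>: $g^3 = p J$ with
  the Jacobi sum $J = \pm\pi$, and $g^m \equiv \overline{\chi}(m)\, g$ modulo \<open>q\<close> for a power \<open>m\<close> of the
  prime \<open>q\<close> with $m \equiv 1 \pmod 3$.\<close>

section \<open>Divisibility in the Eisenstein integers\<close>

text \<open>Cancellation disturbs the cube in N(u). If \<beta> = h P and A = h Q with P, Q coprime,
  then W = Q^2 - P^2 C^2 D is a cube only up to h^2, so the symbols of the primes of h have to be
  known as well. Such a prime l is harmless when it divides exactly one coordinate of what is left
  of \<nu>, and this is what C is for: at an odd l dividing A and B but not D the two valuations are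
  equal, and passing from B to B/C breaks the tie. At 2 the tie remains, but then X and y have
  opposite parity. The prime 3 is special. An element s - t sqrt(-3) with s prime to 3 is primary
  exactly when 3 divides t, while its symbol of 3 is shown to be trivial only when 9 divides t. The
  coefficient 3 A y supplies one factor 3; whenever the symbol of 3 occurs, a second one must come
  from A or y. If 3 divides \<beta> but not A, dividing \<nu> by 3 can destroy primarity, and A and
  B have to exchange roles. The 27 in d makes the norm of \<nu> equal to \<beta>^2 M + 27 N(u) y^2;
  being a cube, 27 then drops out.\<close>

lemma of_int_dvd_eis_iff: "of_int k dvd (x :: eisenstein) \<longleftrightarrow> k dvd eis_fst x \<and> k dvd eis_snd x"
proof
  assume "k dvd eis_fst x \<and> k dvd eis_snd x"
  then obtain a b where "eis_fst x = k * a" "eis_snd x = k * b" by (auto elim!: dvdE)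
  then have "x = of_int k * Eis a b" by (simp add: eis_eq_iff)
  then show "of_int k dvd x" by simp
qed (auto elim!: dvdE)

lemma of_int_dvd_of_int_eis_iff [simp]:
  "(of_int k :: eisenstein) dvd of_int n \<longleftrightarrow> k dvd n"
  by (simp add: of_int_dvd_eis_iff)

lemma of_int_eis_eq_iff [simp]: "(of_int k :: eisenstein) = of_int n \<longleftrightarrow> k = n"
  by (simp add: eis_eq_iff)

lemma of_int_eis_eq_0_iff [simp]: "(of_int k :: eisenstein) = 0 \<longleftrightarrow> k = 0"
  by (simp add: eis_eq_iff)

lemma numeral_eis_sel [simp]:
  "eis_fst (numeral n) = numeral n" "eis_snd (numeral n) = 0"
  using eis_of_nat[of "numeral n"] by simp_all

lemma eis_cnj_hom [simp]:
  "eis_cnj 0 = 0" "eis_cnj 1 = 1" "eis_cnj (- x) = - eis_cnj x"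
  "eis_cnj (x + y) = eis_cnj x + eis_cnj y" "eis_cnj (x - y) = eis_cnj x - eis_cnj y"
  "eis_cnj (x * y) = eis_cnj x * eis_cnj y" "eis_cnj (of_int k) = of_int k"
  "eis_cnj (eis_cnj x) = x"
  by (simp_all add: eis_eq_iff algebra_simps)

lemma eis_cnj_power [simp]: "eis_cnj (x ^ n) = eis_cnj x ^ n"
  by (induction n) simp_all

lemma eis_cnj_dvd_iff [simp]: "eis_cnj x dvd eis_cnj y \<longleftrightarrow> x dvd y"
proof -
  have *: "x dvd y \<Longrightarrow> eis_cnj x dvd eis_cnj y" for x y
    by (auto elim!: dvdE)
  from *[of x y] *[of "eis_cnj x" "eis_cnj y"] show ?thesis by auto
qed

lemma eis_cnj_eq_iff [simp]: "eis_cnj x = eis_cnj y \<longleftrightarrow> x = y"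
  by (metis eis_cnj_hom(8))

lemma eis_cnj_eq_0_iff [simp]: "eis_cnj x = 0 \<longleftrightarrow> x = 0"
  using eis_cnj_eq_iff[of x 0] by simp

lemma eis_norm_dvd: "x dvd y \<Longrightarrow> eis_norm x dvd eis_norm y"
  by (auto elim!: dvdE simp: eis_norm_mult)

lemma is_unit_eis_iff: "is_unit x \<longleftrightarrow> eis_norm x = 1"
proof
  assume "is_unit x"
  then have "eis_norm x dvd eis_norm 1" by (rule eis_norm_dvd)
  then show "eis_norm x = 1"
    using eis_norm_nonneg[of x] by (simp add: eis_norm_def[of 1] zdvd1_eq)
next
  assume "eis_norm x = 1"
  then have "x * eis_cnj x = 1" by (simp add: eis_mult_cnj)
  then show "is_unit x" by (metis dvd_triv_left)
qed

lemma prime_elem_eis_cnj [simp]: "prime_elem (eis_cnj x) \<longleftrightarrow> prime_elem x"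
proof -
  have *: "prime_elem (eis_cnj x)" if "prime_elem x" for x
  proof (rule prime_elemI)
    show "eis_cnj x \<noteq> 0" using that by auto
    show "\<not> is_unit (eis_cnj x)" using that by (simp add: is_unit_eis_iff prime_elem_def)
    fix a b assume "eis_cnj x dvd a * b"
    then have "x dvd eis_cnj a * eis_cnj b"
      using eis_cnj_dvd_iff[of "eis_cnj x" "a * b"] by simp
    then have "x dvd eis_cnj a \<or> x dvd eis_cnj b"
      using that by (simp add: prime_elem_dvd_mult_iff)
    then show "eis_cnj x dvd a \<or> eis_cnj x dvd b"
      using eis_cnj_dvd_iff[of "eis_cnj x" a] eis_cnj_dvd_iff[of "eis_cnj x" b] by simp
  qed
  from *[of x] *[of "eis_cnj x"] show ?thesis by auto
qed

text \<open>The norm is a product of rational primes and a multiple of \<open>\<pi>\<close>, so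
  \<open>\<pi>\<close> divides one of them, q. The norm of \<open>\<pi>\<close> then divides N(q) =
  q^2 and is not 1.\<close>

lemma eis_prime_over_int:
  fixes \<pi> :: eisenstein
  assumes "prime_elem \<pi>"
  obtains q :: int where "prime q" "\<pi> dvd of_int q" "eis_norm \<pi> = q \<or> eis_norm \<pi> = q\<^sup>2"
proof -
  have n: "eis_norm \<pi> \<noteq> 0" using assms by auto
  have *: "\<exists>q\<in>#M. \<pi> dvd of_int q" if "\<pi> dvd of_int (prod_mset M)" for M
    using that
  proof (induction M)
    case empty
    then show ?case using assms by (simp add: prime_elem_def)
  qed (use assms in \<open>auto simp: prime_elem_dvd_mult_iff\<close>)
  have "\<pi> dvd of_int (eis_norm \<pi>)" by (metis eis_mult_cnj dvd_triv_left)
  then have "\<pi> dvd of_int (prod_mset (prime_factorization (eis_norm \<pi>)))"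
    using n by (simp add: prod_mset_prime_factorization_int)
  then obtain q where q: "q \<in># prime_factorization (eis_norm \<pi>)" "\<pi> dvd of_int q"
    using * by blast
  then have pq: "prime q" by auto
  have "eis_norm \<pi> dvd q\<^sup>2" using eis_norm_dvd[OF q(2)] by simp
  then obtain i where i: "i \<le> 2" "normalize (eis_norm \<pi>) = normalize (q ^ i)"
    using pq divides_primepow_weak[of q "eis_norm \<pi>" 2] by auto
  then have e: "eis_norm \<pi> = q ^ i"
    using pq by (simp add: prime_ge_0_int)
  have "eis_norm \<pi> \<noteq> 1" using assms by (simp add: prime_elem_def flip: is_unit_eis_iff)
  with e have "i \<noteq> 0" by (metis power_0)
  with i(1) have "i = 1 \<or> i = 2" by auto
  then show thesis using that[OF pq q(2)] e by auto
qed

text \<open>An integer prime to \<open>q\<close> and divisible by \<open>\<pi>\<close> would make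
  \<open>\<pi>\<close> a unit, by Bezout. Divisibility of integers by a prime of Z[\<omega>] is thus
  decided in Z.\<close>

lemma eis_dvd_of_int_prime_iff:
  fixes \<pi> :: eisenstein and q n :: int
  assumes "prime_elem \<pi>" "prime q" "\<pi> dvd of_int q"
  shows "\<pi> dvd of_int n \<longleftrightarrow> q dvd n"
proof
  assume *: "\<pi> dvd of_int n"
  show "q dvd n"
  proof (rule ccontr)
    assume "\<not> q dvd n"
    then have "coprime q n" using assms(2) by (simp add: prime_imp_coprime)
    then obtain u v where uv: "u * q + v * n = 1"
      using bezout_int[of q n] by (auto simp: coprime_iff_gcd_eq_1)
    have "of_int u * of_int q + of_int v * of_int n = (1 :: eisenstein)"
      using arg_cong[OF uv, of "of_int :: int \<Rightarrow> eisenstein"] by simp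
    moreover have "\<pi> dvd of_int u * of_int q + of_int v * of_int n"
      using * assms(3) by simp
    ultimately show False using assms(1) by (simp add: prime_elem_def)
  qed
next
  assume "q dvd n"
  then have "(of_int q :: eisenstein) dvd of_int n" by simp
  with assms(3) show "\<pi> dvd of_int n" by (rule dvd_trans)
qed

lemma eis_norm_cong_3: "[eis_norm x = (eis_fst x + eis_snd x)\<^sup>2] (mod 3)"
proof -
  have "eis_norm x - (eis_fst x + eis_snd x)\<^sup>2 = 3 * (- (eis_fst x * eis_snd x))"
    by (simp add: eis_norm_def power2_eq_square algebra_simps)
  then show ?thesis by (simp only: cong_iff_dvd_diff dvd_triv_left)
qed

lemma eis_norm_mod_3:
  assumes "\<not> 3 dvd eis_norm x"
  shows "eis_norm x mod 3 = 1"
proof -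
  have "eis_norm x mod 3 = (eis_fst x + eis_snd x)\<^sup>2 mod 3"
    using eis_norm_cong_3[of x] by (simp add: cong_def)
  also have "\<dots> = ((eis_fst x + eis_snd x) mod 3)\<^sup>2 mod 3" by (simp add: power_mod)
  finally have e: "eis_norm x mod 3 = ((eis_fst x + eis_snd x) mod 3)\<^sup>2 mod 3" .
  define r where "r = (eis_fst x + eis_snd x) mod 3"
  have "0 \<le> r" "r < 3" by (simp_all add: r_def)
  then consider "r = 0" | "r = 1" | "r = 2" by linarith
  then show ?thesis
    using assms e unfolding r_def[symmetric] by cases (simp_all add: dvd_eq_mod_eq_0)
qed

lemma eis_norm_not_dvd_3:
  assumes "prime_elem \<pi>" "\<not> \<pi> dvd 3"
  shows "\<not> 3 dvd eis_norm \<pi>"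
proof
  assume *: "3 dvd eis_norm \<pi>"
  from assms(1) obtain q where q: "prime q" "\<pi> dvd of_int q" "eis_norm \<pi> = q \<or> eis_norm \<pi> = q\<^sup>2"
    by (rule eis_prime_over_int)
  have "3 dvd q" using * q(1,3) by (auto simp: prime_dvd_power_iff)
  then have "q = 3" using q(1) using primes_dvd_imp_eq[of 3 q] by simp
  with q(2) assms(2) show False by simp
qed

section \<open>Fermat's theorem and the cubic residue symbol\<close>

text \<open>The inner binomial coefficients are divisible by \<open>q\<close>. The ring is arbitrary
  because the Frobenius congruences built on this serve the integers, Z[\<omega>], and the
  polynomials that carry the Gauss sums.\<close>

lemma of_nat_prime_dvd_add_power:
  fixes x y :: "'a :: comm_ring_1"
  assumes "prime q"
  shows "of_nat q dvd (x + y) ^ q - (x ^ q + y ^ q)"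
proof -
  have q: "q > 0" using assms prime_gt_0_nat by blast
  have "(x + y) ^ q = (\<Sum>k\<le>q. of_nat (q choose k) * x ^ k * y ^ (q - k))"
    by (rule binomial_ring)
  also have "{..q} = insert 0 (insert q {0<..<q})" using q by auto
  also have "(\<Sum>k\<in>\<dots>. of_nat (q choose k) * x ^ k * y ^ (q - k))
      = x ^ q + y ^ q + (\<Sum>k\<in>{0<..<q}. of_nat (q choose k) * x ^ k * y ^ (q - k))"
    using q by simp
  finally have *: "(x + y) ^ q - (x ^ q + y ^ q) = (\<Sum>k\<in>{0<..<q}. of_nat (q choose k) * x ^ k * y ^ (q - k))"
    by simp
  have "of_nat q dvd of_nat (q choose k) * x ^ k * y ^ (q - k)" if "k \<in> {0<..<q}" for k
  proof -
    have "q dvd (q choose k)" using that assms by (intro dvd_choose_prime) auto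
    then have "(of_nat q :: 'a) dvd of_nat (q choose k)" by (auto elim!: dvdE)
    then show ?thesis by (simp add: dvd_mult2)
  qed
  then show ?thesis unfolding * by (rule dvd_sum)
qed

lemma diff_dvd_power_diff: "x - y dvd x ^ n - y ^ n" for x y :: "'a :: comm_ring_1"
  by (metis dvd_triv_left power_diff_sumr2)

lemma of_nat_prime_dvd_add_power_power:
  fixes x y :: "'a :: comm_ring_1"
  assumes "prime q"
  shows "of_nat q dvd (x + y) ^ (q ^ r) - (x ^ (q ^ r) + y ^ (q ^ r))"
proof (induction r)
  case (Suc r)
  let ?a = "(x + y) ^ (q ^ r)" and ?b = "x ^ (q ^ r) + y ^ (q ^ r)"
  have "?a - ?b dvd ?a ^ q - ?b ^ q" by (rule diff_dvd_power_diff)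
  with Suc have "of_nat q dvd ?a ^ q - ?b ^ q" by (rule dvd_trans)
  moreover have "of_nat q dvd ?b ^ q - ((x ^ (q ^ r)) ^ q + (y ^ (q ^ r)) ^ q)"
    by (rule of_nat_prime_dvd_add_power[OF assms])
  ultimately have "of_nat q dvd (?a ^ q - ?b ^ q) + (?b ^ q - ((x ^ (q ^ r)) ^ q + (y ^ (q ^ r)) ^ q))"
    by (rule dvd_add)
  then have "of_nat q dvd ?a ^ q - ((x ^ (q ^ r)) ^ q + (y ^ (q ^ r)) ^ q)"
    by (simp only: diff_add_cancel add_diff_eq)
  then show ?case by (simp add: mult.commute flip: power_mult)
qed simp

lemma of_nat_prime_dvd_sum_power:
  fixes f :: "'b \<Rightarrow> 'a :: comm_ring_1"
  assumes "prime q" "finite A"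
  shows "of_nat q dvd (\<Sum>x\<in>A. f x) ^ (q ^ r) - (\<Sum>x\<in>A. f x ^ (q ^ r))"
  using assms(2)
proof (induction A rule: finite_induct)
  case empty
  have "q ^ r > 0" using assms(1) prime_gt_0_nat by simp
  then show ?case by (simp add: power_0_left)
next
  case (insert a A)
  have "of_nat q dvd ((f a + (\<Sum>x\<in>A. f x)) ^ (q ^ r) - (f a ^ (q ^ r) + (\<Sum>x\<in>A. f x) ^ (q ^ r)))
     + ((\<Sum>x\<in>A. f x) ^ (q ^ r) - (\<Sum>x\<in>A. f x ^ (q ^ r)))"
    by (intro dvd_add of_nat_prime_dvd_add_power_power assms insert.IH)
  then show ?case using insert.hyps by (simp add: algebra_simps)
qed

lemma eis_omega_cube: "eis_omega ^ 3 = 1"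
  by (simp add: eis_eq_iff power3_eq_cube)

lemma eis_omega_pow_mod_1: "n mod 3 = 1 \<Longrightarrow> eis_omega ^ n = eis_omega"
  using arg_cong[OF mult_div_mod_eq[of 3 n], of "\<lambda>k. eis_omega ^ k"]
  by (simp add: power_add power_mult eis_omega_cube)

lemma eis_conv: "x = of_int (eis_fst x) + of_int (eis_snd x) * eis_omega"
  by (simp add: eis_eq_iff)

lemma of_int_power_prime_cong:
  assumes "prime q"
  shows "int q dvd k ^ (q ^ r) - k"
proof -
  have *: "int q dvd int m ^ (q ^ r) - int m" for m
  proof (induction m)
    case 0
    have "q ^ r > 0" using assms prime_gt_0_nat by simp
    then show ?case by (simp add: power_0_left)
  next
    case (Suc m)
    have "int q dvd (int m + 1) ^ (q ^ r) - (int m ^ (q ^ r) + 1 ^ (q ^ r))"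
      using of_nat_prime_dvd_add_power_power[OF assms, of "int m" 1 r] by simp
    from dvd_add[OF this Suc] show ?case by (simp add: algebra_simps)
  qed
  define m where "m = nat (k mod int q)"
  have m: "[int m = k] (mod int q)"
    using prime_gt_0_nat[OF assms] by (simp add: m_def cong_def)
  have "[int m ^ (q ^ r) - int m = k ^ (q ^ r) - k] (mod int q)"
    by (intro cong_diff cong_pow m)
  then show ?thesis using * cong_dvd_iff by blast
qed

text \<open>Raising to the power \<open>q ^ r\<close> is additive modulo \<open>q\<close>, fixes
  integers modulo \<open>q\<close>, and fixes \<omega> because \<open>q ^ r\<close> is 1 modulo 3.
  Taking \<open>q ^ r\<close> to be the norm of a prime gives Fermat's theorem for split and inert
  primes alike, without counting a residue field.\<close>

lemma eis_pow_prime_cong: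
  assumes "prime q" "q ^ r mod 3 = 1"
  shows "of_nat q dvd (x :: eisenstein) ^ (q ^ r) - x"
proof -
  let ?n = "q ^ r"
  define a b where "a = eis_fst x" and "b = eis_snd x"
  have x: "x = of_int a + of_int b * eis_omega" unfolding a_def b_def by (rule eis_conv)
  have 1: "of_nat q dvd x ^ ?n - (of_int a ^ ?n + (of_int b * eis_omega) ^ ?n)"
    unfolding x by (rule of_nat_prime_dvd_add_power_power[OF assms(1)])
  have *: "of_nat q dvd (of_int (k ^ ?n - k) :: eisenstein)" for k
    using of_int_power_prime_cong[OF assms(1), of k r]
    by (metis of_int_dvd_of_int_eis_iff of_int_of_nat_eq)
  have e: "of_int a ^ ?n + (of_int b * eis_omega) ^ ?n - x
      = of_int (a ^ ?n - a) + of_int (b ^ ?n - b) * eis_omega"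
    unfolding x by (simp add: power_mult_distrib eis_omega_pow_mod_1[OF assms(2)] algebra_simps)
  have 2: "of_nat q dvd of_int a ^ ?n + (of_int b * eis_omega) ^ ?n - x"
    unfolding e by (intro dvd_add dvd_mult2 *)
  from dvd_add[OF 1 2] show ?thesis by (simp add: algebra_simps)
qed

definition good_prime :: "eisenstein \<Rightarrow> bool" where
  "good_prime \<pi> \<longleftrightarrow> prime_elem \<pi> \<and> \<not> \<pi> dvd 3"

lemma good_prime_norm:
  assumes "good_prime \<pi>"
  shows "nat ((eis_norm \<pi> - 1) div 3) * 3 + 1 = nat (eis_norm \<pi>)"
    and "nat ((eis_norm \<pi> - 1) div 3) > 0"
proof -
  have m: "eis_norm \<pi> mod 3 = 1"
    using assms eis_norm_mod_3 eis_norm_not_dvd_3 by (auto simp: good_prime_def)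
  have "eis_norm \<pi> \<noteq> 0" "eis_norm \<pi> \<noteq> 1" using assms is_unit_eis_iff by (auto simp: good_prime_def prime_elem_def)
  with eis_norm_nonneg[of \<pi>] have p: "eis_norm \<pi> > 1" by linarith
  define k where "k = nat (eis_norm \<pi> div 3)"
  have "eis_norm \<pi> = 3 * (eis_norm \<pi> div 3) + 1" using m by presburger
  moreover have "eis_norm \<pi> div 3 \<ge> 0" using p by simp
  ultimately have "eis_norm \<pi> = 3 * int k + 1" by (simp add: k_def)
  with p show "nat ((eis_norm \<pi> - 1) div 3) * 3 + 1 = nat (eis_norm \<pi>)"
    "nat ((eis_norm \<pi> - 1) div 3) > 0" by simp_all
qed

lemma eis_fermat:
  assumes "good_prime \<pi>"
  shows "\<pi> dvd x ^ nat (eis_norm \<pi>) - x"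
proof -
  have pe: "prime_elem \<pi>" using assms by (simp add: good_prime_def)
  from pe obtain q :: int where q: "prime q" "\<pi> dvd of_int q" "eis_norm \<pi> = q \<or> eis_norm \<pi> = q\<^sup>2"
    by (rule eis_prime_over_int)
  define p where "p = nat q"
  have p: "prime p" "q = int p" using q(1) by (auto simp: p_def prime_ge_0_int)
  from q(3) obtain r where r: "eis_norm \<pi> = int (p ^ r)"
  proof
    assume "eis_norm \<pi> = q" then show ?thesis using that[of 1] p by simp
  next
    assume "eis_norm \<pi> = q\<^sup>2" then show ?thesis using that[of 2] p by simp
  qed
  have "eis_norm \<pi> mod 3 = 1"
    using assms eis_norm_mod_3 eis_norm_not_dvd_3 by (auto simp: good_prime_def)
  then have "p ^ r mod 3 = 1" unfolding r by presburger
  from eis_pow_prime_cong[OF p(1) this, of x] q(2) show ?thesis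
    unfolding r p(2) nat_int of_int_of_nat_eq by (rule dvd_trans[rotated])
qed

lemma eis_cube_roots_factor: "z ^ 3 - 1 = (z - 1) * ((z - eis_omega) * (z - eis_omega\<^sup>2))"
  for z :: eisenstein
proof -
  have w: "eis_omega * eis_omega = - 1 - eis_omega" by (simp add: eis_eq_iff)
  show ?thesis
    by (simp add: power2_eq_square power3_eq_cube w algebra_simps)
qed

text \<open>The differences of distinct values have norm 1 or 3, hence divide 3, which
  \<open>\<pi>\<close> does not. This is the uniqueness behind the definite description in
  \<open>cubic_residue\<close>.\<close>

lemma eis_cube_roots_incong:
  assumes "good_prime \<pi>" "s \<in> {0, 1, eis_omega, eis_omega\<^sup>2}" "t \<in> {0, 1, eis_omega, eis_omega\<^sup>2}"
    "\<pi> dvd s - t"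
  shows "s = t"
proof (rule ccontr)
  assume "s \<noteq> t"
  then have "s - t dvd 3"
  proof -
    have "eis_norm (s - t) \<in> {1, 3}"
      using assms(2,3) \<open>s \<noteq> t\<close> by (auto simp: eis_norm_def power2_eq_square)
    moreover have "s - t dvd of_int (eis_norm (s - t))" by (metis eis_mult_cnj dvd_triv_left)
    ultimately show ?thesis by (auto intro: dvd_trans[of _ 1])
  qed
  with assms(4) have "\<pi> dvd 3" by (rule dvd_trans)
  with assms(1) show False by (simp add: good_prime_def)
qed

text \<open>If \<open>\<pi>\<close> does not divide \<open>\<alpha>\<close>, Fermat's theorem makes
  the power z of \<open>\<alpha>\<close> a root of z^3 - 1 = (z - 1)(z - \<omega>)(z - \<omega>^2)
  modulo \<open>\<pi>\<close>. If it does, the value is 0 because the exponent is positive.\<close>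

lemma cubic_residue_ex:
  assumes "good_prime \<pi>"
  shows "\<exists>s\<in>{0, 1, eis_omega, eis_omega\<^sup>2}. \<pi> dvd \<alpha> ^ nat ((eis_norm \<pi> - 1) div 3) - s"
proof (cases "\<pi> dvd \<alpha>")
  case True
  have "\<pi> dvd \<alpha> ^ nat ((eis_norm \<pi> - 1) div 3) - 0"
    using dvd_power[OF disjI1[OF good_prime_norm(2)[OF assms]], of \<alpha>] True dvd_trans by auto
  then show ?thesis by blast
next
  case False
  define z where "z = \<alpha> ^ nat ((eis_norm \<pi> - 1) div 3)"
  have pe: "prime_elem \<pi>" using assms by (simp add: good_prime_def)
  have "\<alpha> ^ nat (eis_norm \<pi>) - \<alpha> = \<alpha> * (z ^ 3 - 1)"
    unfolding z_def good_prime_norm(1)[OF assms, symmetric] power_mult[symmetric]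
    by (simp add: power_mult right_diff_distrib)
  with eis_fermat[OF assms, of \<alpha>] have "\<pi> dvd \<alpha> * (z ^ 3 - 1)" by simp
  with False pe have "\<pi> dvd (z - 1) * ((z - eis_omega) * (z - eis_omega\<^sup>2))"
    by (simp add: prime_elem_dvd_mult_iff eis_cube_roots_factor)
  with pe show ?thesis unfolding z_def[symmetric] by (auto simp: prime_elem_dvd_mult_iff)
qed

lemma cubic_residue_eqI:
  assumes "good_prime \<pi>" "s \<in> {0, 1, eis_omega, eis_omega\<^sup>2}"
    "\<pi> dvd \<alpha> ^ nat ((eis_norm \<pi> - 1) div 3) - s"
  shows "cubic_residue \<alpha> \<pi> = s"
  unfolding cubic_residue_def
proof (rule the_equality)
  fix t assume t: "t \<in> {0, 1, eis_omega, eis_omega\<^sup>2} \<and> \<pi> dvd \<alpha> ^ nat ((eis_norm \<pi> - 1) div 3) - t"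
  have "\<pi> dvd (\<alpha> ^ nat ((eis_norm \<pi> - 1) div 3) - t) - (\<alpha> ^ nat ((eis_norm \<pi> - 1) div 3) - s)"
    using conjunct2[OF t] assms(3) by (rule dvd_diff)
  then have "\<pi> dvd s - t" by simp
  from eis_cube_roots_incong[OF assms(1,2) conjunct1[OF t] this] show "t = s" by simp
qed (use assms in blast)

lemma cubic_residue_spec:
  assumes "good_prime \<pi>"
  shows "cubic_residue \<alpha> \<pi> \<in> {0, 1, eis_omega, eis_omega\<^sup>2}"
    and "\<pi> dvd \<alpha> ^ nat ((eis_norm \<pi> - 1) div 3) - cubic_residue \<alpha> \<pi>"
proof -
  obtain s where s: "s \<in> {0, 1, eis_omega, eis_omega\<^sup>2}"
      "\<pi> dvd \<alpha> ^ nat ((eis_norm \<pi> - 1) div 3) - s"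
    using cubic_residue_ex[OF assms] by blast
  then show "cubic_residue \<alpha> \<pi> \<in> {0, 1, eis_omega, eis_omega\<^sup>2}"
    "\<pi> dvd \<alpha> ^ nat ((eis_norm \<pi> - 1) div 3) - cubic_residue \<alpha> \<pi>"
    unfolding cubic_residue_eqI[OF assms s] by simp_all
qed

lemma cubic_values_mult:
  assumes "s \<in> {0, 1, eis_omega, eis_omega\<^sup>2}" "t \<in> {0, 1, eis_omega, eis_omega\<^sup>2}"
  shows "s * t \<in> {0, 1, eis_omega, eis_omega\<^sup>2}"
  using assms by (auto simp: eis_eq_iff power2_eq_square)

lemma cubic_values_cnj:
  assumes "s \<in> {0, 1, eis_omega, eis_omega\<^sup>2}"
  shows "eis_cnj s \<in> {0, 1, eis_omega, eis_omega\<^sup>2}" "eis_cnj s = s\<^sup>2"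
    and "s \<noteq> 0 \<Longrightarrow> s ^ 3 = 1" "s \<noteq> 0 \<Longrightarrow> s * eis_cnj s = 1" "eis_cnj s = s \<Longrightarrow> s \<noteq> 0 \<Longrightarrow> s = 1"
  using assms by (auto simp: eis_eq_iff power2_eq_square power3_eq_cube)

lemma cubic_residue_mult:
  assumes "good_prime \<pi>"
  shows "cubic_residue (\<alpha> * \<beta>) \<pi> = cubic_residue \<alpha> \<pi> * cubic_residue \<beta> \<pi>"
proof (rule cubic_residue_eqI[OF assms])
  let ?k = "nat ((eis_norm \<pi> - 1) div 3)"
  note \<alpha> = cubic_residue_spec[OF assms, of \<alpha>] and \<beta> = cubic_residue_spec[OF assms, of \<beta>]
  show "cubic_residue \<alpha> \<pi> * cubic_residue \<beta> \<pi> \<in> {0, 1, eis_omega, eis_omega\<^sup>2}"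
    using \<alpha>(1) \<beta>(1) by (rule cubic_values_mult)
  have e: "(\<alpha> * \<beta>) ^ ?k - cubic_residue \<alpha> \<pi> * cubic_residue \<beta> \<pi>
     = (\<alpha> ^ ?k - cubic_residue \<alpha> \<pi>) * \<beta> ^ ?k + cubic_residue \<alpha> \<pi> * (\<beta> ^ ?k - cubic_residue \<beta> \<pi>)"
    by (simp add: algebra_simps)
  show "\<pi> dvd (\<alpha> * \<beta>) ^ ?k - cubic_residue \<alpha> \<pi> * cubic_residue \<beta> \<pi>"
    unfolding e using \<alpha>(2) \<beta>(2) by (intro dvd_add dvd_mult2 dvd_mult)
qed

lemma cubic_residue_cong:
  assumes "good_prime \<pi>" "\<pi> dvd \<alpha> - \<beta>"
  shows "cubic_residue \<alpha> \<pi> = cubic_residue \<beta> \<pi>"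
proof (rule cubic_residue_eqI[OF assms(1)])
  let ?k = "nat ((eis_norm \<pi> - 1) div 3)"
  note \<beta> = cubic_residue_spec[OF assms(1), of \<beta>]
  show "cubic_residue \<beta> \<pi> \<in> {0, 1, eis_omega, eis_omega\<^sup>2}" by (rule \<beta>(1))
  have "\<pi> dvd \<alpha> ^ ?k - \<beta> ^ ?k"
    using assms(2) diff_dvd_power_diff by (rule dvd_trans)
  from dvd_add[OF this \<beta>(2)] show "\<pi> dvd \<alpha> ^ ?k - cubic_residue \<beta> \<pi>" by simp
qed

lemma cubic_residue_eq_0_iff:
  assumes "good_prime \<pi>"
  shows "cubic_residue \<alpha> \<pi> = 0 \<longleftrightarrow> \<pi> dvd \<alpha>"
proof
  assume "cubic_residue \<alpha> \<pi> = 0"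
  with cubic_residue_spec(2)[OF assms, of \<alpha>] have "\<pi> dvd \<alpha> ^ nat ((eis_norm \<pi> - 1) div 3)" by simp
  then show "\<pi> dvd \<alpha>" using assms unfolding good_prime_def by (blast intro: prime_elem_dvd_power)
next
  assume "\<pi> dvd \<alpha>"
  then have "\<pi> dvd \<alpha> ^ nat ((eis_norm \<pi> - 1) div 3) - 0"
    using dvd_power[OF disjI1[OF good_prime_norm(2)[OF assms]], of \<alpha>] dvd_trans by auto
  then show "cubic_residue \<alpha> \<pi> = 0" by (intro cubic_residue_eqI[OF assms]) auto
qed

lemma good_prime_cnj [simp]: "good_prime (eis_cnj \<pi>) \<longleftrightarrow> good_prime \<pi>"
  using eis_cnj_dvd_iff[of \<pi> 3] eis_cnj_hom(7)[of 3] by (simp add: good_prime_def del: eis_cnj_dvd_iff)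

lemma cubic_residue_cnj:
  assumes "good_prime \<pi>"
  shows "cubic_residue (eis_cnj \<alpha>) (eis_cnj \<pi>) = eis_cnj (cubic_residue \<alpha> \<pi>)"
proof (rule cubic_residue_eqI)
  show "eis_cnj (cubic_residue \<alpha> \<pi>) \<in> {0, 1, eis_omega, eis_omega\<^sup>2}"
    by (intro cubic_values_cnj cubic_residue_spec assms)
  show "eis_cnj \<pi> dvd eis_cnj \<alpha> ^ nat ((eis_norm (eis_cnj \<pi>) - 1) div 3) - eis_cnj (cubic_residue \<alpha> \<pi>)"
    using cubic_residue_spec(2)[OF assms, of \<alpha>] eis_cnj_dvd_iff[of \<pi> "\<alpha> ^ nat ((eis_norm \<pi> - 1) div 3) - cubic_residue \<alpha> \<pi>"]
    by simp
qed (use assms in simp)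

text \<open>The definition sees \<open>\<pi>\<close> only through its norm and through what it
  divides, and associates share both. Normalized prime factors may therefore be replaced by any
  associates.\<close>

lemma cubic_residue_associated:
  assumes "\<pi> dvd \<rho>" "\<rho> dvd \<pi>"
  shows "cubic_residue \<alpha> \<pi> = cubic_residue \<alpha> \<rho>"
proof -
  have "eis_norm \<pi> = eis_norm \<rho>"
    using assms by (intro zdvd_antisym_nonneg eis_norm_nonneg eis_norm_dvd)
  moreover have "\<pi> dvd x \<longleftrightarrow> \<rho> dvd x" for x using assms dvd_trans by blast
  ultimately show ?thesis unfolding cubic_residue_def by simp
qed

lemma cubic_residue_1: "good_prime \<pi> \<Longrightarrow> cubic_residue 1 \<pi> = 1"
  by (rule cubic_residue_eqI) auto

lemma prime_factor_not_dvd_3: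
  fixes \<beta> :: eisenstein
  assumes "\<not> 3 dvd eis_norm \<beta>" "prime_elem \<pi>" "\<pi> dvd \<beta>"
  shows "good_prime \<pi>"
  unfolding good_prime_def
proof
  show "\<not> \<pi> dvd 3"
  proof
    assume "\<pi> dvd 3"
    then have "\<pi> dvd of_int 3" by simp
    then have "eis_norm \<pi> dvd 3\<^sup>2" using eis_norm_dvd by (metis eis_norm_of_int)
    moreover have "\<not> 3 dvd eis_norm \<pi>" using assms(1) eis_norm_dvd[OF assms(3)] dvd_trans by blast
    then have "coprime 3 (eis_norm \<pi>)" by (intro prime_imp_coprime) simp_all
    then have "coprime (eis_norm \<pi>) (3\<^sup>2)"
      by (simp only: coprime_power_right_iff coprime_commute[of "eis_norm \<pi>" 3] simp_thms)
    ultimately have "is_unit (eis_norm \<pi>)" by (meson coprime_common_divisor dvd_refl)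
    then have "eis_norm \<pi> = 1" using eis_norm_nonneg[of \<pi>] zdvd1_eq[of "eis_norm \<pi>"] by linarith
    with assms(2) show False by (simp add: prime_elem_def flip: is_unit_eis_iff)
  qed
qed (fact assms(2))

lemma not_3_dvd_eis_norm_mult_iff:
  "\<not> 3 dvd eis_norm (\<alpha> * \<beta>) \<longleftrightarrow> \<not> 3 dvd eis_norm \<alpha> \<and> \<not> 3 dvd eis_norm \<beta>"
  using prime_dvd_mult_iff[of "3 :: int" "eis_norm \<alpha>" "eis_norm \<beta>"] by (simp add: eis_norm_mult)

lemma not_3_dvd_eis_norm_of_int_iff: "\<not> 3 dvd eis_norm (of_int n) \<longleftrightarrow> \<not> 3 dvd n"
  using prime_dvd_power_iff[of "3 :: int" 2 n] by simp

lemma eis_coprime_iff: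
  fixes \<alpha> \<beta> :: eisenstein
  assumes "\<beta> \<noteq> 0"
  shows "coprime \<alpha> \<beta> \<longleftrightarrow> (\<forall>\<pi>. prime_elem \<pi> \<longrightarrow> \<pi> dvd \<alpha> \<longrightarrow> \<not> \<pi> dvd \<beta>)"
proof
  assume *: "\<forall>\<pi>. prime_elem \<pi> \<longrightarrow> \<pi> dvd \<alpha> \<longrightarrow> \<not> \<pi> dvd \<beta>"
  show "coprime \<alpha> \<beta>"
  proof (rule coprimeI)
    fix c assume c: "c dvd \<alpha>" "c dvd \<beta>"
    show "is_unit c"
    proof (rule ccontr)
      assume "\<not> is_unit c"
      moreover have "c \<noteq> 0" using c(2) assms by auto
      ultimately obtain \<pi> where "\<pi> dvd c" "prime \<pi>" using prime_divisor_exists by blast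
      with * c show False using dvd_trans prime_imp_prime_elem by blast
    qed
  qed
next
  assume "coprime \<alpha> \<beta>"
  then show "\<forall>\<pi>. prime_elem \<pi> \<longrightarrow> \<pi> dvd \<alpha> \<longrightarrow> \<not> \<pi> dvd \<beta>"
    by (auto simp: prime_elem_def dest: coprime_common_divisor)
qed

section \<open>The symbol for composite moduli\<close>

text \<open>The symbol $(\alpha/\beta)_3$ for a modulus \<open>\<beta>\<close> in $\mathbb{Z}[\omega]$ prime to $3$,
  which \<^const>\<open>cubic_symbol\<close> has only for rational moduli.\<close>

definition csym :: "eisenstein \<Rightarrow> eisenstein \<Rightarrow> eisenstein" where
  "csym \<alpha> \<beta> = (\<Prod>\<pi>\<in>#prime_factorization \<beta>. cubic_residue \<alpha> \<pi>)"

lemma cubic_symbol_eq_csym: "cubic_symbol \<alpha> n = csym \<alpha> (of_int n)"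
  by (simp add: cubic_symbol_def csym_def)

lemma csym_1_right [simp]: "csym \<alpha> 1 = 1"
  by (simp add: csym_def)

lemma csym_unit_right: "is_unit \<epsilon> \<Longrightarrow> csym \<alpha> \<epsilon> = 1"
  by (simp add: csym_def prime_factorization_unit)

lemma csym_mult_right: "\<beta> \<noteq> 0 \<Longrightarrow> \<gamma> \<noteq> 0 \<Longrightarrow> csym \<alpha> (\<beta> * \<gamma>) = csym \<alpha> \<beta> * csym \<alpha> \<gamma>"
  by (simp add: csym_def prime_factorization_mult)

lemma csym_prime_right:
  assumes "prime_elem \<pi>"
  shows "csym \<alpha> \<pi> = cubic_residue \<alpha> \<pi>"
proof -
  have "prime_factorization \<pi> = {#normalize \<pi>#}"
    using assms prime_factorization_prime[of "normalize \<pi>"] by simp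
  then have "csym \<alpha> \<pi> = cubic_residue \<alpha> (normalize \<pi>)" by (simp add: csym_def)
  also have "\<dots> = cubic_residue \<alpha> \<pi>" by (rule cubic_residue_associated) simp_all
  finally show ?thesis .
qed

lemma csym_prod_mset_cong:
  assumes "\<not> 3 dvd eis_norm \<beta>" "\<And>\<pi>. good_prime \<pi> \<Longrightarrow> \<pi> dvd \<beta> \<Longrightarrow> f \<pi> = g \<pi>"
  shows "(\<Prod>\<pi>\<in>#prime_factorization \<beta>. f \<pi>) = (\<Prod>\<pi>\<in>#prime_factorization \<beta>. g \<pi>)"
proof -
  have "image_mset f (prime_factorization \<beta>) = image_mset g (prime_factorization \<beta>)"
  proof (rule image_mset_cong)
    fix \<pi> assume "\<pi> \<in># prime_factorization \<beta>"
    then have "prime_elem \<pi>" "\<pi> dvd \<beta>"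
      by (auto simp: in_prime_factors_iff intro: prime_imp_prime_elem)
    then show "f \<pi> = g \<pi>" using assms prime_factor_not_dvd_3 by blast
  qed
  then show ?thesis by simp
qed

lemma csym_mult_left:
  assumes "\<not> 3 dvd eis_norm \<beta>"
  shows "csym (\<alpha> * \<alpha>') \<beta> = csym \<alpha> \<beta> * csym \<alpha>' \<beta>"
proof -
  have "csym (\<alpha> * \<alpha>') \<beta> = (\<Prod>\<pi>\<in>#prime_factorization \<beta>. cubic_residue \<alpha> \<pi> * cubic_residue \<alpha>' \<pi>)"
    unfolding csym_def by (rule csym_prod_mset_cong[OF assms cubic_residue_mult])
  then show ?thesis by (simp add: csym_def prod_mset.distrib)
qed

lemma csym_cong:
  assumes "\<not> 3 dvd eis_norm \<beta>" "\<beta> dvd \<alpha> - \<alpha>'"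
  shows "csym \<alpha> \<beta> = csym \<alpha>' \<beta>"
  unfolding csym_def
  by (rule csym_prod_mset_cong[OF assms(1)], rule cubic_residue_cong)
    (use assms(2) dvd_trans in blast)+

lemma csym_1_left [simp]: "\<not> 3 dvd eis_norm \<beta> \<Longrightarrow> csym 1 \<beta> = 1"
  unfolding csym_def
  by (subst csym_prod_mset_cong[where g = "\<lambda>_. 1"]) (auto intro: cubic_residue_1)

lemma csym_power_left: "\<not> 3 dvd eis_norm \<beta> \<Longrightarrow> csym (\<alpha> ^ n) \<beta> = csym \<alpha> \<beta> ^ n"
  by (induction n) (simp_all add: csym_mult_left)

lemma csym_values:
  assumes "\<not> 3 dvd eis_norm \<beta>"
  shows "csym \<alpha> \<beta> \<in> {0, 1, eis_omega, eis_omega\<^sup>2}"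
proof -
  have *: "(\<Prod>\<pi>\<in>#M. cubic_residue \<alpha> \<pi>) \<in> {0, 1, eis_omega, eis_omega\<^sup>2}"
    if "\<And>\<pi>. \<pi> \<in># M \<Longrightarrow> good_prime \<pi>" for M
    using that
  proof (induction M)
    case (add \<pi> M)
    then show ?case
      unfolding image_mset_add_mset prod_mset.add_mset
      by (intro cubic_values_mult cubic_residue_spec(1)) auto
  qed simp
  show ?thesis unfolding csym_def
    by (rule *) (use assms prime_factor_not_dvd_3 in \<open>auto simp: in_prime_factors_iff\<close>)
qed

lemma csym_eq_0_iff:
  assumes "\<not> 3 dvd eis_norm \<beta>"
  shows "csym \<alpha> \<beta> = 0 \<longleftrightarrow> \<not> coprime \<alpha> \<beta>"
proof -
  have nz: "\<beta> \<noteq> 0" using assms by auto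
  have "csym \<alpha> \<beta> = 0 \<longleftrightarrow> (\<exists>\<pi>\<in>prime_factors \<beta>. cubic_residue \<alpha> \<pi> = 0)"
    by (auto simp: csym_def prod_mset_zero_iff)
  also have "\<dots> \<longleftrightarrow> (\<exists>\<pi>\<in>prime_factors \<beta>. \<pi> dvd \<alpha>)"
  proof (intro bex_cong refl cubic_residue_eq_0_iff)
    fix \<pi> assume "\<pi> \<in> prime_factors \<beta>"
    then show "good_prime \<pi>" using assms prime_factor_not_dvd_3 by (auto simp: in_prime_factors_iff)
  qed
  also have "\<dots> \<longleftrightarrow> (\<exists>\<pi>. prime_elem \<pi> \<and> \<pi> dvd \<alpha> \<and> \<pi> dvd \<beta>)"
  proof
    assume "\<exists>\<pi>. prime_elem \<pi> \<and> \<pi> dvd \<alpha> \<and> \<pi> dvd \<beta>"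
    then obtain \<pi> where "prime_elem \<pi>" "\<pi> dvd \<alpha>" "\<pi> dvd \<beta>" by blast
    then have "normalize \<pi> \<in> prime_factors \<beta>" "normalize \<pi> dvd \<alpha>"
      using nz by (auto simp: in_prime_factors_iff)
    then show "\<exists>\<pi>\<in>prime_factors \<beta>. \<pi> dvd \<alpha>" by blast
  qed (auto simp: in_prime_factors_iff intro: prime_imp_prime_elem)
  finally show ?thesis using eis_coprime_iff[OF nz, of \<alpha>] by blast
qed

lemma csym_cnj:
  assumes "\<not> 3 dvd eis_norm \<beta>"
  shows "csym (eis_cnj \<alpha>) (eis_cnj \<beta>) = eis_cnj (csym \<alpha> \<beta>)"
  using assms
proof (induction \<beta> rule: prime_divisors_induct)
  case (unit \<epsilon>)
  moreover from unit have "is_unit (eis_cnj \<epsilon>)" by (simp add: is_unit_eis_iff)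
  ultimately show ?case by (simp add: csym_unit_right)
next
  case (factor \<pi> x)
  then have pe: "prime_elem \<pi>" by auto
  have nz: "\<pi> \<noteq> 0" "x \<noteq> 0" using factor.prems by auto
  have gp: "good_prime \<pi>" using factor.prems pe by (rule prime_factor_not_dvd_3) simp
  have x: "\<not> 3 dvd eis_norm x" using factor.prems unfolding not_3_dvd_eis_norm_mult_iff by blast
  show ?case
    using nz pe factor.IH[OF x] cubic_residue_cnj[OF gp, of \<alpha>]
    by (simp add: csym_mult_right csym_prime_right)
qed simp

text \<open>Conjugation fixes both arguments and hence the value, and 1 is the only nonzero value
  that it fixes.\<close>

lemma csym_of_int_of_int:
  assumes "\<not> 3 dvd n" "coprime (of_int k) (of_int n :: eisenstein)"
  shows "csym (of_int k) (of_int n) = 1"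
proof -
  have n: "\<not> 3 dvd eis_norm (of_int n)" using assms(1) by (simp only: not_3_dvd_eis_norm_of_int_iff not_False_eq_True)
  have "csym (of_int k) (of_int n) \<noteq> 0" using csym_eq_0_iff[OF n] assms(2) by simp
  moreover have "eis_cnj (csym (of_int k) (of_int n)) = csym (of_int k) (of_int n)"
    using csym_cnj[OF n, of "of_int k"] by simp
  ultimately show ?thesis using cubic_values_cnj(5)[OF csym_values[OF n]] by blast
qed

lemma csym_minus_1:
  assumes "\<not> 3 dvd eis_norm \<beta>"
  shows "csym (- 1) \<beta> = 1"
proof -
  have "csym (- 1) \<beta> ^ 2 = 1"
    using csym_power_left[OF assms, of "- 1" 2] assms by simp
  then show ?thesis using csym_values[OF assms, of "- 1"]
    by (auto simp: eis_eq_iff power2_eq_square)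
qed

lemma csym_minus: "\<not> 3 dvd eis_norm \<beta> \<Longrightarrow> csym (- \<alpha>) \<beta> = csym \<alpha> \<beta>"
  using csym_mult_left[of \<beta> "- 1" \<alpha>] by (simp add: csym_minus_1)

lemma coprime_imp_eis_coprime:
  assumes "coprime k n" "n \<noteq> 0"
  shows "coprime (of_int k) (of_int n :: eisenstein)"
proof (rule coprimeI)
  fix c :: eisenstein assume c: "c dvd of_int k" "c dvd of_int n"
  obtain u v where uv: "u * k + v * n = 1"
    using bezout_int[of k n] assms(1) by (auto simp: coprime_iff_gcd_eq_1)
  have "of_int u * of_int k + of_int v * of_int n = (1 :: eisenstein)"
    using arg_cong[OF uv, of "of_int :: int \<Rightarrow> eisenstein"] by simp
  then show "is_unit c" using c by (metis dvd_add dvd_mult)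
qed

lemma eis_coprime_if_coprime_norm:
  assumes "coprime (eis_norm \<alpha>) n" "n \<noteq> 0"
  shows "coprime \<alpha> (of_int n)" "coprime (of_int n) \<alpha>"
proof -
  have "coprime (of_int (eis_norm \<alpha>)) (of_int n :: eisenstein)"
    using assms by (rule coprime_imp_eis_coprime)
  then show "coprime \<alpha> (of_int n)"
    by (metis coprime_divisors dvd_refl dvd_triv_left eis_mult_cnj)
  then show "coprime (of_int n) \<alpha>" by (simp add: coprime_commute)
qed

section \<open>Gauss and Jacobi sums\<close>

text \<open>Gauss sums live in the group ring of $\mathbb{Z}/n$ over $\mathbb{Z}[\omega]$, modelled here by
  polynomials modulo $t^n - 1$ so that no roots of unity are needed; \<open>q = 0\<close> gives equality
  in that ring.\<close>

definition gcong :: "int \<Rightarrow> nat \<Rightarrow> eisenstein poly \<Rightarrow> eisenstein poly \<Rightarrow> bool" where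
  "gcong q n F G \<longleftrightarrow> (\<exists>H K. F - G = of_int q * H + (monom 1 n - 1) * K)"

lemma gcong_refl [simp]: "gcong q n F F"
  unfolding gcong_def by (intro exI[of _ 0]) simp

lemma gcong_sym:
  assumes "gcong q n F G"
  shows "gcong q n G F"
proof -
  from assms obtain H K where "F - G = of_int q * H + (monom 1 n - 1) * K" by (auto simp: gcong_def)
  then have "G - F = of_int q * (- H) + (monom 1 n - 1) * (- K)" by (simp add: algebra_simps)
  then show ?thesis unfolding gcong_def by blast
qed

lemma gcong_add:
  assumes "gcong q n F G" "gcong q n F' G'"
  shows "gcong q n (F + F') (G + G')"
proof -
  from assms obtain H K H' K' where "F - G = of_int q * H + (monom 1 n - 1) * K"
    "F' - G' = of_int q * H' + (monom 1 n - 1) * K'" by (auto simp: gcong_def)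
  moreover have "F + F' - (G + G') = (F - G) + (F' - G')" by simp
  ultimately have "F + F' - (G + G') = of_int q * (H + H') + (monom 1 n - 1) * (K + K')"
    by (simp only: ring_distribs add_ac)
  then show ?thesis unfolding gcong_def by blast
qed

lemma gcong_trans [trans]:
  assumes "gcong q n F G" "gcong q n G M"
  shows "gcong q n F M"
  using gcong_add[OF assms] by (simp add: gcong_def)

lemma gcong_mult_right:
  assumes "gcong q n F G"
  shows "gcong q n (F * M) (G * M)"
proof -
  from assms obtain H K where *: "F - G = of_int q * H + (monom 1 n - 1) * K" by (auto simp: gcong_def)
  have "F * M - G * M = (F - G) * M" by (simp add: algebra_simps)
  also have "\<dots> = of_int q * (H * M) + (monom 1 n - 1) * (K * M)"
    unfolding * by (simp only: ring_distribs mult_ac)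
  finally show ?thesis unfolding gcong_def by blast
qed

lemma gcong_mult:
  assumes "gcong q n F G" "gcong q n F' G'"
  shows "gcong q n (F * F') (G * G')"
  by (rule gcong_trans[OF gcong_mult_right[OF assms(1)]])
    (use gcong_mult_right[OF assms(2), of G] in \<open>simp add: mult.commute\<close>)

lemma gcong_smult: "gcong q n F G \<Longrightarrow> gcong q n (smult c F) (smult c G)"
  using gcong_mult[OF gcong_refl[of q n "[:c:]"], of F G] by simp

lemma gcong_power: "gcong q n F G \<Longrightarrow> gcong q n (F ^ k) (G ^ k)"
  by (induction k) (simp_all add: gcong_mult)

lemma gcong_sum:
  assumes "\<And>x. x \<in> A \<Longrightarrow> gcong q n (F x) (G x)"
  shows "gcong q n (\<Sum>x\<in>A. F x) (\<Sum>x\<in>A. G x)"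
  using assms by (induction A rule: infinite_finite_induct) (simp_all add: gcong_add)

lemma gcong_of_nat_dvd:
  assumes "of_nat q dvd F - G"
  shows "gcong (int q) n F G"
proof -
  from assms obtain H where "F - G = of_int (int q) * H + (monom 1 n - 1) * 0" by (auto elim: dvdE)
  then show ?thesis unfolding gcong_def by blast
qed

lemma gcong_monom_mod: "gcong q n (monom 1 a) (monom 1 (a mod n))"
proof -
  let ?k = "a div n"
  have "monom 1 n - 1 dvd (monom 1 n) ^ ?k - (1 :: eisenstein poly) ^ ?k"
    by (rule diff_dvd_power_diff)
  then obtain K where K: "monom 1 (n * ?k) - 1 = (monom 1 n - 1) * (K :: eisenstein poly)"
    by (auto simp: monom_power elim: dvdE)
  have "monom 1 a = monom 1 (n * ?k) * (monom 1 (a mod n) :: eisenstein poly)"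
    by (simp add: mult_monom)
  then have "monom 1 a - monom 1 (a mod n) = (monom 1 (n * ?k) - 1) * (monom 1 (a mod n) :: eisenstein poly)"
    by (simp add: algebra_simps)
  also have "\<dots> = of_int q * 0 + (monom 1 n - 1) * (K * monom 1 (a mod n))"
    unfolding K by simp
  finally show ?thesis unfolding gcong_def by blast
qed

lemma gcong_monom:
  assumes "a mod n = b mod n"
  shows "gcong q n (monom 1 a) (monom 1 b)"
  using gcong_trans[OF gcong_monom_mod[of q n a, unfolded assms] gcong_sym[OF gcong_monom_mod[of q n b]]] .

text \<open>The way back from the group ring to Z[\<omega>]: t^n - 1 is monic, so it divides no
  nonzero polynomial of degree below n, and representatives of such degree can be compared
  coefficient by coefficient.\<close>

lemma gcong_coeff_dvd:
  assumes "gcong q n F G" "degree F < n" "degree G < n"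
  shows "of_int q dvd coeff F i - coeff G i"
proof -
  from assms(1) obtain H K where HK: "F - G = of_int q * H + (monom 1 n - 1) * K"
    by (auto simp: gcong_def)
  \<comment> \<open>Reducing the exponents of \<open>H\<close> modulo \<open>n\<close> changes
    \<open>H\<close> by a multiple of t^n - 1 only and brings its degree below
    \<open>n\<close>.\<close>
  define H' where "H' = (\<Sum>j\<le>degree H. smult (coeff H j) (monom 1 (j mod n)))"
  have "gcong 0 n (\<Sum>j\<le>degree H. smult (coeff H j) (monom 1 j)) H'"
    unfolding H'_def by (intro gcong_sum gcong_smult gcong_monom_mod)
  also have "(\<Sum>j\<le>degree H. smult (coeff H j) (monom 1 j)) = H"
    by (subst (3) poly_as_sum_of_monoms[symmetric]) (simp add: smult_monom)
  finally obtain K' where K': "H - H' = (monom 1 n - 1) * K'" by (auto simp: gcong_def)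
  define R where "R = F - G - of_int q * H'"
  have "R = (F - G - of_int q * H) + of_int q * (H - H')" by (simp add: R_def algebra_simps)
  also have "\<dots> = (monom 1 n - 1) * (K + of_int q * K')"
    unfolding HK K' by (simp add: algebra_simps)
  finally have R: "R = (monom 1 n - 1) * (K + of_int q * K')" .
  have "degree H' \<le> n - 1"
    unfolding H'_def using assms(2)
  proof (intro degree_sum_le)
    fix j
    have "j mod n \<le> n - 1" using assms(2) mod_less_divisor[of n j] by linarith
    then show "degree (smult (coeff H j) (monom 1 (j mod n))) \<le> n - 1"
      by (intro degree_smult_le[THEN order_trans] degree_monom_le[THEN order_trans])
  qed simp
  then have "degree (of_int q * H') \<le> n - 1"
    unfolding of_int_poly by (simp add: degree_smult_le[THEN order_trans])
  then have dR: "degree R < n"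
    unfolding R_def using assms(2,3) by (intro degree_diff_less) auto
  have mon: "degree (monom 1 n - 1 :: eisenstein poly) = n"
  proof (rule antisym)
    show "degree (monom 1 n - 1 :: eisenstein poly) \<le> n"
      by (intro degree_diff_le degree_monom_le) simp
    show "n \<le> degree (monom 1 n - 1 :: eisenstein poly)"
      using assms(2) by (intro le_degree) (simp add: coeff_1)
  qed
  have "R = 0"
  proof (rule ccontr)
    assume "R \<noteq> 0"
    then have "monom 1 n - 1 \<noteq> (0 :: eisenstein poly)" "K + of_int q * K' \<noteq> 0" by (auto simp: R)
    then have "degree R = n + degree (K + of_int q * K')" unfolding R by (simp add: degree_mult_eq mon)
    with dR show False by simp
  qed
  then have "F - G = of_int q * H'" by (simp add: R_def)
  then have "coeff (F - G) i = of_int q * coeff H' i" by (simp add: of_int_poly)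
  then show ?thesis by simp
qed

text \<open>Telescoping (x+1)^(j+1) - x^(j+1) over x < p expresses j + 1 times this sum, modulo p,
  by the sums with smaller exponents, and j + 1 < p can be cancelled. For j = 0 the convention 0^0 =
  1 makes the sum equal to p.\<close>

lemma prime_dvd_power_sum:
  assumes p: "prime p" and "j < p - 1"
  shows "int p dvd (\<Sum>x<p. int x ^ j)"
  using assms(2)
proof (induction j rule: less_induct)
  case (less j)
  have "(\<Sum>x<p. int (Suc x) ^ Suc j - int x ^ Suc j) = int p ^ Suc j - int 0 ^ Suc j"
    by (rule sum_lessThan_telescope)
  moreover have "int (Suc x) ^ Suc j - int x ^ Suc j = (\<Sum>i\<le>j. int (Suc j choose i) * int x ^ i)" for x
    using binomial_ring[of "int x" 1 "Suc j"] by (simp add: add.commute)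
  ultimately have "(\<Sum>x<p. \<Sum>i\<le>j. int (Suc j choose i) * int x ^ i) = int p ^ Suc j" by simp
  also have "(\<Sum>x<p. \<Sum>i\<le>j. int (Suc j choose i) * int x ^ i)
      = (\<Sum>i\<le>j. int (Suc j choose i) * (\<Sum>x<p. int x ^ i))"
    by (subst sum.swap) (simp add: sum_distrib_left)
  also have "\<dots> = (\<Sum>i<j. int (Suc j choose i) * (\<Sum>x<p. int x ^ i)) + int (Suc j) * (\<Sum>x<p. int x ^ j)"
    by (simp add: lessThan_Suc_atMost[symmetric])
  finally have e: "int (Suc j) * (\<Sum>x<p. int x ^ j)
      = int p ^ Suc j - (\<Sum>i<j. int (Suc j choose i) * (\<Sum>x<p. int x ^ i))" by simp
  have "int p dvd int (Suc j) * (\<Sum>x<p. int x ^ j)"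
    unfolding e
  proof (intro dvd_diff dvd_sum)
    show "int p dvd int (Suc j choose i) * (\<Sum>x<p. int x ^ i)" if "i \<in> {..<j}" for i
      using that less by (intro dvd_mult) simp
  qed simp
  moreover have "\<not> int p dvd int (Suc j)"
    using less.prems by (metis Suc_eq_plus1 dvd_imp_le int_dvd_int_iff less_diff_conv not_less zero_less_Suc)
  ultimately show ?case using p by (simp add: prime_dvd_mult_iff)
qed

lemma sum_periodic_affine:
  fixes f :: "int \<Rightarrow> 'a :: comm_monoid_add"
  assumes "\<And>x. f (x mod p) = f x" "coprime a p" "p > 0"
  shows "(\<Sum>x\<in>{0..<p}. f (a * x + b)) = (\<Sum>x\<in>{0..<p}. f x)"
proof -
  let ?g = "\<lambda>x. (a * x + b) mod p"
  have inj: "inj_on ?g {0..<p}"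
  proof (rule inj_onI)
    fix x y assume xy: "x \<in> {0..<p}" "y \<in> {0..<p}" "?g x = ?g y"
    then have "[a * x + b = a * y + b] (mod p)" by (simp add: cong_def)
    then have "[x = y] (mod p)" using assms(2) by (simp add: cong_add_rcancel cong_mult_lcancel)
    with xy show "x = y" by (simp add: cong_def)
  qed
  have "?g ` {0..<p} \<subseteq> {0..<p}" using assms(3) by auto
  then have img: "?g ` {0..<p} = {0..<p}"
    by (intro card_subset_eq) (auto simp: card_image[OF inj])
  have "(\<Sum>x\<in>{0..<p}. f x) = (\<Sum>x\<in>?g ` {0..<p}. f x)" by (simp only: img)
  also have "\<dots> = (\<Sum>x\<in>{0..<p}. f (?g x))" by (simp add: sum.reindex[OF inj])
  finally show ?thesis by (simp add: assms(1))
qed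

section \<open>The cubic character modulo a prime of Z[\<omega>] of prime norm\<close>

locale split_prime =
  fixes \<pi> :: eisenstein and p :: nat
  assumes prime_pi: "prime_elem \<pi>" and prime_p: "prime p" and norm_pi: "eis_norm \<pi> = int p"
    and p_neq_3: "p \<noteq> 3"
begin

lemma good_pi: "good_prime \<pi>"
proof (rule prime_factor_not_dvd_3[OF _ prime_pi dvd_refl])
  show "\<not> 3 dvd eis_norm \<pi>"
    using prime_p p_neq_3 primes_dvd_imp_eq[of 3 p] int_dvd_int_iff[of 3 p]
    unfolding norm_pi by auto
qed

lemma p_pos: "int p > 0" using prime_gt_0_nat[OF prime_p] by simp

lemma pi_dvd_of_int_iff: "\<pi> dvd of_int n \<longleftrightarrow> int p dvd n"
proof (rule eis_dvd_of_int_prime_iff[OF prime_pi])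
  show "prime (int p)" using prime_p by simp
  show "\<pi> dvd of_int (int p)" by (metis eis_mult_cnj dvd_triv_left norm_pi)
qed

definition k where "k = nat ((eis_norm \<pi> - 1) div 3)"

lemma p_eq: "p = 3 * k + 1" and k_pos: "k > 0"
  using good_prime_norm[OF good_pi] unfolding norm_pi k_def[unfolded norm_pi, symmetric] by simp_all

definition \<chi> :: "int \<Rightarrow> eisenstein" where "\<chi> x = cubic_residue (of_int x) \<pi>"

text \<open>The inverse character: on cube roots of unity, conjugate, square and inverse
  agree.\<close>

definition \<chi>' :: "int \<Rightarrow> eisenstein" where "\<chi>' x = eis_cnj (\<chi> x)"

lemma chi_mult: "\<chi> (x * y) = \<chi> x * \<chi> y"
  by (simp add: \<chi>_def cubic_residue_mult[OF good_pi])

lemma chi'_mult: "\<chi>' (x * y) = \<chi>' x * \<chi>' y"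
  by (simp add: \<chi>'_def chi_mult)

lemma chi_cong: "[x = y] (mod int p) \<Longrightarrow> \<chi> x = \<chi> y"
  unfolding \<chi>_def by (rule cubic_residue_cong[OF good_pi])
    (simp add: pi_dvd_of_int_iff cong_iff_dvd_diff flip: of_int_diff)

lemma chi_mod [simp]: "\<chi> (x mod int p) = \<chi> x" "\<chi>' (x mod int p) = \<chi>' x"
  using chi_cong[of "x mod int p" x] by (simp_all add: \<chi>'_def cong_def)

lemma chi_values: "\<chi> x \<in> {0, 1, eis_omega, eis_omega\<^sup>2}"
  unfolding \<chi>_def by (rule cubic_residue_spec[OF good_pi])

lemma chi_eq_0_iff: "\<chi> x = 0 \<longleftrightarrow> int p dvd x"
  unfolding \<chi>_def by (simp add: cubic_residue_eq_0_iff[OF good_pi] pi_dvd_of_int_iff)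

lemma chi'_eq: "\<chi>' x = \<chi> x ^ 2"
  unfolding \<chi>'_def using cubic_values_cnj(2)[OF chi_values] .

lemma chi_1 [simp]: "\<chi> 1 = 1"
  by (simp add: \<chi>_def cubic_residue_1[OF good_pi])

lemma chi_mult_chi': "\<chi> x * \<chi>' x = (if int p dvd x then 0 else 1)"
  using cubic_values_cnj(4)[OF chi_values, of x] chi_eq_0_iff[of x] by (auto simp: \<chi>'_def)

lemma chi_cube: "\<chi> x ^ 3 = (if int p dvd x then 0 else 1)"
  using cubic_values_cnj(3)[OF chi_values, of x] chi_eq_0_iff[of x] by auto

lemma chi_uminus: "\<chi> (- x) = \<chi> x"
proof -
  have "\<chi> (- 1) ^ 2 = 1" using chi_mult[of "- 1" "- 1"] by (simp add: power2_eq_square)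
  then have "\<chi> (- 1) = 1" using chi_values[of "- 1"] by (auto simp: eis_eq_iff power2_eq_square)
  then show ?thesis using chi_mult[of "- 1" x] by simp
qed

lemma chi_cong_power: "\<pi> dvd of_int (x ^ k) - \<chi> x"
  using cubic_residue_spec(2)[OF good_pi, of "of_int x"] by (simp add: \<chi>_def k_def)

abbreviation S where "S \<equiv> {0..<int p}"

lemma p_dvd_sum_powers: "j < p - 1 \<Longrightarrow> int p dvd (\<Sum>x\<in>S. x ^ j)"
  using prime_dvd_power_sum[OF prime_p, of j]
  using sum.reindex[of int "{0..<p}" "\<lambda>x. x ^ j"]
  by (simp add: lessThan_atLeast0 image_int_atLeastLessThan)

lemma coprime_p_iff: "coprime x (int p) \<longleftrightarrow> \<not> int p dvd x"
  using prime_imp_coprime[of "int p" x] coprime_common_divisor[of x "int p" "int p"] prime_p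
  by (auto simp: coprime_commute)

lemma sum_S_affine:
  fixes f :: "int \<Rightarrow> 'a :: comm_monoid_add"
  assumes "\<And>x. f (x mod int p) = f x" "\<not> int p dvd a"
  shows "(\<Sum>x\<in>S. f (a * x + b)) = (\<Sum>x\<in>S. f x)"
  using assms p_pos by (intro sum_periodic_affine) (simp_all add: coprime_p_iff)

lemma one_not_0_mod_p: "\<not> int p dvd 1" "1 < int p"
  using prime_gt_1_nat[OF prime_p] by auto

lemma S_insert_0: "S = insert 0 {1..<int p}"
  using p_pos by auto

lemma p_dvd_S_iff: "x \<in> S \<Longrightarrow> int p dvd x \<longleftrightarrow> x = 0"
  by (auto dest: zdvd_imp_le)

lemma sum_indicator_0: "(\<Sum>x\<in>S. if int p dvd x then a else b) = a + of_int (int p - 1) * (b :: eisenstein)"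
proof -
  have "(\<Sum>x\<in>S. if int p dvd x then a else b) = (\<Sum>x\<in>S. if x = 0 then a else b)"
    by (intro sum.cong refl) (simp add: p_dvd_S_iff)
  also have "\<dots> = a + (\<Sum>x\<in>{1..<int p}. b)"
    unfolding S_insert_0 by simp
  also have "(\<Sum>x\<in>{1..<int p}. b) = of_int (int p - 1) * b"
    using p_pos by (simp add: of_nat_diff)
  finally show ?thesis .
qed

lemma sum_chi: "(\<Sum>x\<in>S. \<chi> x) = 0"
proof -
  \<comment> \<open>Nontriviality of the character. Modulo \<open>\<pi>\<close> it is x^k with 0 < k
    < p - 1, so its sum is 0 there; a trivial character would have sum p - 1, which is not.\<close>
  have "\<exists>a. \<not> int p dvd a \<and> \<chi> a \<noteq> 1"
  proof (rule ccontr)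
    assume *: "\<not> ?thesis"
    have "\<pi> dvd (\<Sum>x\<in>S. of_int (x ^ k) - \<chi> x)"
      by (intro dvd_sum chi_cong_power)
    moreover have "\<pi> dvd of_int (\<Sum>x\<in>S. x ^ k)"
      unfolding pi_dvd_of_int_iff using p_eq k_pos by (intro p_dvd_sum_powers) simp
    ultimately have "\<pi> dvd of_int (\<Sum>x\<in>S. x ^ k) - (\<Sum>x\<in>S. of_int (x ^ k) - \<chi> x)"
      by (rule dvd_diff[rotated])
    then have "\<pi> dvd (\<Sum>x\<in>S. \<chi> x)" by (simp add: sum_subtractf)
    also have "(\<Sum>x\<in>S. \<chi> x) = (\<Sum>x\<in>S. if int p dvd x then 0 else 1)"
      using * chi_eq_0_iff by (intro sum.cong) auto
    also have "\<dots> = of_int (int p - 1)" by (simp add: sum_indicator_0)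
    finally have "int p dvd int p - 1" by (simp only: pi_dvd_of_int_iff)
    from dvd_diff[OF dvd_refl this] have "int p dvd 1" by (simp only: diff_diff_eq2 add_diff_cancel_left')
    then show False using one_not_0_mod_p by blast
  qed
  then obtain a where a: "\<not> int p dvd a" "\<chi> a \<noteq> 1" by blast
  have "(\<Sum>x\<in>S. \<chi> (a * x + 0)) = (\<Sum>x\<in>S. \<chi> x)"
    using a(1) by (intro sum_S_affine) simp_all
  then have "\<chi> a * (\<Sum>x\<in>S. \<chi> x) = 1 * (\<Sum>x\<in>S. \<chi> x)"
    by (simp add: chi_mult sum_distrib_left)
  with a(2) show ?thesis unfolding mult_cancel_right by blast
qed

lemma eis_cnj_sum: "eis_cnj (\<Sum>x\<in>A. f x) = (\<Sum>x\<in>A. eis_cnj (f x))"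
  by (induction A rule: infinite_finite_induct) simp_all

lemma sum_chi': "(\<Sum>x\<in>S. \<chi>' x) = 0"
  unfolding \<chi>'_def using eis_cnj_sum[of \<chi> S] sum_chi by simp

section \<open>Convolutions of characters and the Jacobi sum\<close>

definition conv :: "(int \<Rightarrow> eisenstein) \<Rightarrow> (int \<Rightarrow> eisenstein) \<Rightarrow> int \<Rightarrow> eisenstein" where
  "conv f h c = (\<Sum>x\<in>S. f x * h (c - x))"

definition J :: eisenstein where "J = conv \<chi> \<chi> 1"

text \<open>For c prime to p, the substitution of c x for x releases a factor \<chi>(c) from each
  character. For p dividing c, \<chi>(-1) = 1 turns the sum into that of \<chi>^2, which is
  0.\<close>

lemma conv_chi_chi: "conv \<chi> \<chi> c = J * \<chi>' c"
proof (cases "int p dvd c")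
  case True
  then have "\<chi> (c - x) = \<chi> x" for x
    using chi_cong[of "c - x" "- x"] by (simp add: chi_uminus cong_iff_dvd_diff)
  then have "conv \<chi> \<chi> c = (\<Sum>x\<in>S. \<chi>' x)" by (simp add: conv_def chi'_eq power2_eq_square)
  with True sum_chi' chi_eq_0_iff[of c] show ?thesis by (simp add: \<chi>'_def)
next
  case False
  have "conv \<chi> \<chi> c = (\<Sum>x\<in>S. \<chi> (c * x + 0) * \<chi> (c - (c * x + 0)))"
    unfolding conv_def
  proof (rule sum_S_affine[OF _ False, symmetric])
    show "\<chi> (x mod int p) * \<chi> (c - x mod int p) = \<chi> x * \<chi> (c - x)" for x
      using chi_cong[of "c - x mod int p" "c - x"] by (simp add: cong_def mod_diff_right_eq)
  qed
  also have "\<dots> = (\<Sum>x\<in>S. \<chi>' c * (\<chi> x * \<chi> (1 - x)))"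
  proof (rule sum.cong)
    fix x
    have "c - (c * x + 0) = c * (1 - x)" by (simp add: algebra_simps)
    then show "\<chi> (c * x + 0) * \<chi> (c - (c * x + 0)) = \<chi>' c * (\<chi> x * \<chi> (1 - x))"
      by (simp add: chi_mult chi'_eq power2_eq_square)
  qed simp
  finally show ?thesis by (simp add: J_def conv_def sum_distrib_left mult.commute)
qed

lemma conv_chi'_chi': "conv \<chi>' \<chi>' c = eis_cnj J * \<chi> c"
  using arg_cong[OF conv_chi_chi[of c], of eis_cnj]
  by (simp add: conv_def eis_cnj_sum \<chi>'_def)

text \<open>This is p times the indicator of 0, minus the constant 1. In the group ring it stands
  for p minus the sum of all t^x. At a nontrivial p-th root of unity that sum vanishes, leaving the
  p of the classical relation between a Gauss sum and its conjugate; here the extra term is kept,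
  and \<open>gs_delta_power\<close> shows that powers behave as those of p do.\<close>

definition \<delta> :: "int \<Rightarrow> eisenstein" where
  "\<delta> c = (if int p dvd c then of_int (int p - 1) else - 1)"

lemma conv_chi_chi': "conv \<chi> \<chi>' c = \<delta> c"
proof -
  have 0: "conv \<chi> \<chi>' c = of_int (int p - 1)" if "int p dvd c" for c
  proof -
    have "\<chi>' (c - x) = \<chi>' x" for x
      using that chi_cong[of "c - x" "- x"] by (simp add: chi_uminus cong_iff_dvd_diff \<chi>'_def)
    then show ?thesis by (simp add: conv_def chi_mult_chi' sum_indicator_0)
  qed
  have 1: "conv \<chi> \<chi>' c = conv \<chi> \<chi>' 1" if "\<not> int p dvd c" for c
  proof -
    have "conv \<chi> \<chi>' c = (\<Sum>x\<in>S. \<chi> (c * x + 0) * \<chi>' (c - (c * x + 0)))"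
      unfolding conv_def
    proof (rule sum_S_affine[OF _ that, symmetric])
      show "\<chi> (x mod int p) * \<chi>' (c - x mod int p) = \<chi> x * \<chi>' (c - x)" for x
        using chi_cong[of "c - x mod int p" "c - x"] by (simp add: cong_def mod_diff_right_eq \<chi>'_def)
    qed
    also have "\<dots> = (\<Sum>x\<in>S. \<chi> x * \<chi>' (1 - x))"
    proof (rule sum.cong)
      fix x
      have "c - (c * x + 0) = c * (1 - x)" by (simp add: algebra_simps)
      moreover have "\<chi> c * \<chi>' c = 1" using that by (simp add: chi_mult_chi')
      ultimately show "\<chi> (c * x + 0) * \<chi>' (c - (c * x + 0)) = \<chi> x * \<chi>' (1 - x)"
        by (simp add: chi_mult chi'_mult)
    qed simp
    finally show ?thesis by (simp add: conv_def)
  qed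
  \<comment> \<open>By scaling, all c prime to p give one value v. The total over c vanishes because
    the sum of \<chi>' does, so (p - 1)(1 + v) = 0.\<close>
  have "(\<Sum>c\<in>S. conv \<chi> \<chi>' c) = (\<Sum>x\<in>S. \<chi> x * (\<Sum>c\<in>S. \<chi>' (1 * c + (- x))))"
    unfolding conv_def sum_distrib_left by (subst sum.swap) simp
  also have "\<dots> = 0"
  proof (intro sum.neutral ballI)
    fix x
    have "(\<Sum>c\<in>S. \<chi>' (1 * c + (- x))) = (\<Sum>c\<in>S. \<chi>' c)"
      using one_not_0_mod_p by (intro sum_S_affine) auto
    then show "\<chi> x * (\<Sum>c\<in>S. \<chi>' (1 * c + (- x))) = 0" by (simp only: sum_chi' mult_zero_right)
  qed
  also have "(\<Sum>c\<in>S. conv \<chi> \<chi>' c)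
      = (\<Sum>c\<in>S. if int p dvd c then of_int (int p - 1) else conv \<chi> \<chi>' 1)"
    using 0 1 by (intro sum.cong) auto
  also have "\<dots> = of_int (int p - 1) * (1 + conv \<chi> \<chi>' 1)"
    by (simp add: sum_indicator_0 algebra_simps)
  finally have "1 + conv \<chi> \<chi>' 1 = 0" using one_not_0_mod_p by (simp del: of_int_diff)
  then have "conv \<chi> \<chi>' 1 = - 1" by (simp add: eq_neg_iff_add_eq_0 add.commute)
  with 0 1 show ?thesis by (simp add: \<delta>_def)
qed

section \<open>Gauss sums as elements of the group ring\<close>

definition e :: "int \<Rightarrow> eisenstein poly" where "e x = monom 1 (nat (x mod int p))"

definition gs :: "(int \<Rightarrow> eisenstein) \<Rightarrow> eisenstein poly" where
  "gs f = (\<Sum>x\<in>S. smult (f x) (e x))"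

lemma e_mod [simp]: "e (x mod int p) = e x"
  by (simp add: e_def)

lemma gcong_monom_e:
  assumes "[int a = x] (mod int p)"
  shows "gcong q p (monom 1 a) (e x)"
  unfolding e_def
proof (rule gcong_monom)
  have "int (nat (x mod int p) mod p) = int (a mod p)"
    using assms p_pos by (simp add: cong_def zmod_int)
  then show "a mod p = nat (x mod int p) mod p" by linarith
qed

lemma gcong_e_mult: "gcong q p (e x * e y) (e (x + y))"
proof -
  have "e x * e y = monom 1 (nat (x mod int p) + nat (y mod int p))"
    by (simp add: e_def mult_monom)
  moreover have "[int (nat (x mod int p) + nat (y mod int p)) = x + y] (mod int p)"
    using p_pos by (simp add: cong_def mod_add_eq)
  ultimately show ?thesis using gcong_monom_e by simp
qed

lemma gcong_e_power: "gcong q p (e x ^ m) (e (int m * x))"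
proof -
  have "e x ^ m = monom 1 (nat (x mod int p) * m)"
    by (simp add: e_def monom_power)
  moreover have "[int (nat (x mod int p) * m) = int m * x] (mod int p)"
    using p_pos by (simp add: cong_def mod_simps mult.commute)
  ultimately show ?thesis using gcong_monom_e by simp
qed

lemma gs_mult:
  assumes "\<And>x. h (x mod int p) = h x"
  shows "gcong q p (gs f * gs h) (gs (conv f h))"
proof -
  have "gs f * gs h = (\<Sum>x\<in>S. \<Sum>y\<in>S. smult (f x * h y) (e x * e y))"
    unfolding gs_def sum_product by (simp add: mult.commute)
  also have "gcong q p \<dots> (\<Sum>x\<in>S. \<Sum>y\<in>S. smult (f x * h y) (e (x + y)))"
    by (intro gcong_sum gcong_smult gcong_e_mult)
  also have "(\<Sum>x\<in>S. \<Sum>y\<in>S. smult (f x * h y) (e (x + y)))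
      = (\<Sum>x\<in>S. \<Sum>c\<in>S. smult (f x * h (c - x)) (e c))"
  proof (rule sum.cong)
    fix x
    have "(\<Sum>c\<in>S. smult (f x * h (1 * c + (- x))) (e (x + (1 * c + (- x)))))
       = (\<Sum>y\<in>S. smult (f x * h y) (e (x + y)))"
    proof (rule sum_S_affine[where a = 1 and b = "- x" and f = "\<lambda>y. smult (f x * h y) (e (x + y))"])
      show "smult (f x * h (y mod int p)) (e (x + y mod int p)) = smult (f x * h y) (e (x + y))" for y
        using assms e_mod[of "x + y mod int p"] e_mod[of "x + y"] by (simp add: mod_add_right_eq del: e_mod)
    qed (use one_not_0_mod_p in simp)
    then show "(\<Sum>y\<in>S. smult (f x * h y) (e (x + y))) = (\<Sum>c\<in>S. smult (f x * h (c - x)) (e c))"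
      by simp
  qed simp
  also have "\<dots> = gs (conv f h)"
    unfolding gs_def conv_def by (subst sum.swap) (simp add: smult_sum)
  finally show ?thesis .
qed

lemma degree_gs: "degree (gs f) < p"
proof -
  have "degree (gs f) \<le> p - 1" unfolding gs_def
  proof (intro degree_sum_le)
    fix x
    have "x mod int p < int p" using p_pos by simp
    then have "nat (x mod int p) \<le> p - 1" by linarith
    then show "degree (smult (f x) (e x)) \<le> p - 1"
      unfolding e_def by (intro degree_smult_le[THEN order_trans] degree_monom_le[THEN order_trans])
  qed simp
  then show ?thesis using p_pos by linarith
qed

text \<open>The coefficient at 1 is the one that gets compared: there \<chi> and \<chi>' are 1 and
  \<open>\<delta>\<close> is -1, so no factor is lost.\<close>

lemma coeff_gs_1: "coeff (gs f) 1 = f 1"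
proof -
  have "coeff (gs f) 1 = (\<Sum>x\<in>S. if x = 1 then f x else 0)"
    unfolding gs_def coeff_sum by (intro sum.cong) (auto simp: e_def)
  then show ?thesis using one_not_0_mod_p by simp
qed

lemma smult_sum_right: "(\<Sum>x\<in>A. smult c (F x)) = smult c (\<Sum>x\<in>A. F x)"
  for F :: "'a \<Rightarrow> eisenstein poly"
  by (induction A rule: infinite_finite_induct) (simp_all add: smult_add_right)

lemma gs_smult: "gs (\<lambda>x. c * f x) = smult c (gs f)"
  by (simp add: gs_def smult_sum_right flip: smult_smult)

lemma gcong_gs_dvd:
  assumes "gcong q p (smult a (gs f)) (smult b (gs h))"
  shows "of_int q dvd a * f 1 - b * h 1"
proof -
  have d: "degree (smult c (gs f)) < p" for c f
    using degree_gs degree_smult_le le_less_trans by blast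
  from gcong_coeff_dvd[OF assms d d, of 1] show ?thesis by (simp only: coeff_gs_1 coeff_smult)
qed

lemma gs_chi_chi: "gcong q p (gs \<chi> * gs \<chi>) (smult J (gs \<chi>'))"
  using gs_mult[of \<chi> q \<chi>] by (simp add: conv_chi_chi[abs_def] gs_smult)

lemma gs_chi'_chi': "gcong q p (gs \<chi>' * gs \<chi>') (smult (eis_cnj J) (gs \<chi>))"
  using gs_mult[of \<chi>' q \<chi>'] by (simp add: conv_chi'_chi'[abs_def] gs_smult)

lemma gs_chi_chi': "gcong q p (gs \<chi> * gs \<chi>') (gs \<delta>)"
  using gs_mult[of \<chi>' q \<chi>] by (simp add: conv_chi_chi'[abs_def])

text \<open>The product of \<open>gs \<chi>\<close> with itself and with \<open>gs \<chi>'\<close>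
  is evaluated in two ways: as \<open>gs \<chi> * gs \<delta>\<close>, and as J times the square of
  \<open>gs \<chi>'\<close>, which is J times its conjugate times \<open>gs \<chi>\<close>. The
  coefficient of the first at 1 is p \<chi>(1) minus the vanishing sum of \<chi>.\<close>

lemma J_cnj_J: "J * eis_cnj J = of_int (int p)"
proof -
  have \<delta>_mod: "\<delta> (x mod int p) = \<delta> x" for x
    by (simp add: \<delta>_def dvd_mod_iff)
  have "gcong 0 p (gs (conv \<chi> \<delta>)) (gs \<chi> * gs \<delta>)"
    by (rule gcong_sym[OF gs_mult[where h = \<delta>, OF \<delta>_mod]])
  also have "gcong 0 p (gs \<chi> * gs \<delta>) (gs \<chi> * (gs \<chi> * gs \<chi>'))"
    by (intro gcong_mult gcong_sym[OF gs_chi_chi'] gcong_refl)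
  also have "gs \<chi> * (gs \<chi> * gs \<chi>') = gs \<chi> * gs \<chi> * gs \<chi>'" by (simp only: mult.assoc)
  also have "gcong 0 p \<dots> (smult J (gs \<chi>') * gs \<chi>')"
    by (intro gcong_mult gs_chi_chi gcong_refl)
  also have "smult J (gs \<chi>') * gs \<chi>' = smult J (gs \<chi>' * gs \<chi>')" by simp
  also have "gcong 0 p \<dots> (smult J (smult (eis_cnj J) (gs \<chi>)))"
    by (intro gcong_smult gs_chi'_chi')
  finally have "gcong 0 p (smult 1 (gs (conv \<chi> \<delta>))) (smult (J * eis_cnj J) (gs \<chi>))" by simp
  from gcong_gs_dvd[OF this] have "conv \<chi> \<delta> 1 = J * eis_cnj J" by simp
  moreover have "conv \<chi> \<delta> 1 = (\<Sum>x\<in>S. (if x = 1 then of_int (int p) * \<chi> x else 0) - \<chi> x)"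
    unfolding conv_def
  proof (rule sum.cong)
    fix x assume x: "x \<in> S"
    have "int p dvd 1 - x \<longleftrightarrow> x = 1"
    proof
      assume "int p dvd 1 - x"
      then have "[x = 1] (mod int p)" by (simp add: cong_iff_dvd_diff dvd_diff_commute)
      with x one_not_0_mod_p show "x = 1" by (simp add: cong_def)
    qed simp
    then show "\<chi> x * \<delta> (1 - x) = (if x = 1 then of_int (int p) * \<chi> x else 0) - \<chi> x"
      by (simp add: \<delta>_def)
  qed simp
  moreover have "\<dots> = of_int (int p)"
    using one_not_0_mod_p by (simp add: sum_subtractf sum_chi)
  ultimately show ?thesis by simp
qed

text \<open>Modulo \<open>\<pi>\<close> the Jacobi sum is the sum of x^k (1 - x)^k, a polynomial of
  degree 2k < 3k = p - 1, so all the power sums involved vanish modulo p.\<close>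

lemma pi_dvd_J: "\<pi> dvd J"
proof -
  have "\<pi> dvd of_int (x ^ k) * of_int ((1 - x) ^ k) - \<chi> x * \<chi> (1 - x)" for x
  proof -
    have "of_int (x ^ k) * of_int ((1 - x) ^ k) - \<chi> x * \<chi> (1 - x)
        = (of_int (x ^ k) - \<chi> x) * of_int ((1 - x) ^ k) + \<chi> x * (of_int ((1 - x) ^ k) - \<chi> (1 - x))"
      by (simp add: algebra_simps)
    then show ?thesis using chi_cong_power[of x] chi_cong_power[of "1 - x"] by simp
  qed
  then have "\<pi> dvd (\<Sum>x\<in>S. of_int (x ^ k) * of_int ((1 - x) ^ k) - \<chi> x * \<chi> (1 - x))"
    by (intro dvd_sum)
  then have 1: "\<pi> dvd of_int (\<Sum>x\<in>S. x ^ k * (1 - x) ^ k) - J"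
    by (simp add: sum_subtractf J_def conv_def)
  have "(\<Sum>x\<in>S. x ^ k * (1 - x) ^ k) = (\<Sum>x\<in>S. \<Sum>i\<le>k. int (k choose i) * (- 1) ^ i * x ^ (k + i))"
  proof (rule sum.cong)
    fix x :: int
    have "(1 - x) ^ k = (\<Sum>i\<le>k. int (k choose i) * (- x) ^ i)"
      using binomial_ring[of "- x" 1 k] by simp
    then show "x ^ k * (1 - x) ^ k = (\<Sum>i\<le>k. int (k choose i) * (- 1) ^ i * x ^ (k + i))"
      by (simp add: sum_distrib_left power_add power_minus[of x] ac_simps)
  qed simp
  also have "\<dots> = (\<Sum>i\<le>k. int (k choose i) * (- 1) ^ i * (\<Sum>x\<in>S. x ^ (k + i)))"
    by (subst sum.swap) (simp add: sum_distrib_left)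
  finally have e: "(\<Sum>x\<in>S. x ^ k * (1 - x) ^ k) = (\<Sum>i\<le>k. int (k choose i) * (- 1) ^ i * (\<Sum>x\<in>S. x ^ (k + i)))" .
  have "int p dvd (\<Sum>x\<in>S. x ^ k * (1 - x) ^ k)"
    unfolding e using p_eq k_pos by (intro dvd_sum dvd_mult p_dvd_sum_powers) simp
  then have 2: "\<pi> dvd of_int (\<Sum>x\<in>S. x ^ k * (1 - x) ^ k)" by (simp only: pi_dvd_of_int_iff)
  from dvd_diff[OF 2 1] show ?thesis by simp
qed

lemma gs_chi_cube: "gcong q p (gs \<chi> ^ 3) (smult J (gs \<delta>))"
proof -
  have "gs \<chi> ^ 3 = gs \<chi> * gs \<chi> * gs \<chi>" by (simp add: power3_eq_cube)
  also have "gcong q p \<dots> (smult J (gs \<chi>') * gs \<chi>)"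
    by (intro gcong_mult gs_chi_chi gcong_refl)
  also have "smult J (gs \<chi>') * gs \<chi> = smult J (gs \<chi> * gs \<chi>')" by (simp add: mult.commute)
  also have "gcong q p \<dots> (smult J (gs \<delta>))" by (intro gcong_smult gs_chi_chi')
  finally show ?thesis .
qed

lemma gs_delta_power: "gcong q p (gs \<delta> ^ Suc m) (smult (of_int (int p ^ m)) (gs \<delta>))"
proof (induction m)
  case (Suc m)
  have "gcong q p (gs \<delta> * gs \<delta>) ((gs \<chi> * gs \<chi>') * (gs \<chi> * gs \<chi>'))"
    by (intro gcong_mult gcong_sym[OF gs_chi_chi'])
  also have "(gs \<chi> * gs \<chi>') * (gs \<chi> * gs \<chi>') = (gs \<chi> * gs \<chi>) * (gs \<chi>' * gs \<chi>')" by (simp only: mult_ac)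
  also have "gcong q p \<dots> (smult J (gs \<chi>') * smult (eis_cnj J) (gs \<chi>))"
    by (intro gcong_mult gs_chi_chi gs_chi'_chi')
  also have "smult J (gs \<chi>') * smult (eis_cnj J) (gs \<chi>) = smult (of_int (int p)) (gs \<chi> * gs \<chi>')"
    by (simp add: mult.commute J_cnj_J)
  also have "gcong q p \<dots> (smult (of_int (int p)) (gs \<delta>))" by (intro gcong_smult gs_chi_chi')
  finally have 1: "gcong q p (gs \<delta> * gs \<delta>) (smult (of_int (int p)) (gs \<delta>))" .
  have "gcong q p (gs \<delta> ^ Suc m * gs \<delta>) (smult (of_int (int p ^ m)) (gs \<delta>) * gs \<delta>)"
    by (intro gcong_mult Suc gcong_refl)
  also have "smult (of_int (int p ^ m)) (gs \<delta>) * gs \<delta> = smult (of_int (int p ^ m)) (gs \<delta> * gs \<delta>)" by simp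
  also have "gcong q p \<dots> (smult (of_int (int p ^ m)) (smult (of_int (int p)) (gs \<delta>)))"
    by (intro gcong_smult 1)
  finally show ?case by (simp add: ac_simps)
qed simp

section \<open>Frobenius on Gauss sums, and reciprocity for a primary prime of prime norm\<close>

lemma gs_chi_frobenius:
  assumes "prime q"
  shows "gcong (int q) p (gs \<chi> ^ (q ^ r)) (\<Sum>x\<in>S. smult (\<chi> x ^ (q ^ r)) (e (int (q ^ r) * x)))"
proof -
  have "gcong (int q) p (gs \<chi> ^ (q ^ r)) (\<Sum>x\<in>S. smult (\<chi> x) (e x) ^ (q ^ r))"
    unfolding gs_def by (intro gcong_of_nat_dvd of_nat_prime_dvd_sum_power assms) simp
  also have "(\<Sum>x\<in>S. smult (\<chi> x) (e x) ^ (q ^ r)) = (\<Sum>x\<in>S. smult (\<chi> x ^ (q ^ r)) (e x ^ (q ^ r)))"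
    by (simp add: smult_power)
  also have "gcong (int q) p \<dots> (\<Sum>x\<in>S. smult (\<chi> x ^ (q ^ r)) (e (int (q ^ r) * x)))"
    by (intro gcong_sum gcong_smult gcong_e_power)
  finally show ?thesis .
qed

text \<open>The cube of \<open>gs \<chi>\<close> is J times \<open>gs \<delta>\<close>. By Frobenius
  at 3 it is also, modulo 3, the sum of t^(3x) over x prime to p, since \<chi>^3 is 1 there; as 3 is
  prime to p, this is the sum of t^x over the same x. At 1 this gives -J on one side and 1 on the
  other.\<close>

lemma three_dvd_J_plus_1: "3 dvd J + 1"
proof -
  define f where "f x = (if int p dvd x then 0 else 1 :: eisenstein)" for x
  have "\<not> int p dvd 3"
    using primes_dvd_imp_eq[OF prime_p, of 3] p_neq_3 int_dvd_int_iff[of p 3] by auto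
  then have "(\<Sum>x\<in>S. smult (f (3 * x + 0)) (e (3 * x + 0))) = gs f"
    unfolding gs_def by (intro sum_S_affine) (simp_all add: f_def dvd_mod_iff)
  moreover have "f (3 * x) = \<chi> x ^ 3" for x
    using \<open>\<not> int p dvd 3\<close> prime_p by (simp add: f_def chi_cube prime_dvd_mult_iff)
  ultimately have 1: "(\<Sum>x\<in>S. smult (\<chi> x ^ 3) (e (3 * x))) = gs f" by simp
  have "gcong 3 p (smult J (gs \<delta>)) (gs \<chi> ^ 3)" by (rule gcong_sym[OF gs_chi_cube])
  also have "gcong 3 p \<dots> (gs f)"
    using gs_chi_frobenius[of 3 1] by (simp add: 1)
  finally have "gcong 3 p (smult J (gs \<delta>)) (smult 1 (gs f))" by simp
  from gcong_gs_dvd[OF this] have "3 dvd - J - 1"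
    using one_not_0_mod_p by (simp add: \<delta>_def f_def)
  then have "3 dvd - (- J - 1)" by (simp only: dvd_minus_iff)
  then show ?thesis by (simp add: add.commute)
qed

text \<open>Frobenius and the substitution x -> q^r x give g^(q^r) = \<chi>'(q^r) g modulo q for g =
  \<open>gs \<chi>\<close>, while g^3 = J \<open>gs \<delta>\<close>. Both sides are made multiples
  of \<open>gs \<delta>\<close>; this costs the factor J, which has norm p and is cancelled later
  modulo primes above q.\<close>

lemma J_power_cong:
  assumes "prime q" "q \<noteq> p" "q ^ r = 3 * m + 1"
  shows "of_int (int q) dvd J * ((J * of_int (int p)) ^ m - \<chi>' (int (q ^ r)))"
proof -
  let ?M = "int (q ^ r)"
  have M: "\<not> int p dvd ?M"
    using assms(1,2) prime_p primes_dvd_imp_eq[of p q] prime_dvd_power_nat[of p q r]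
    by (metis int_dvd_int_iff)
  have pow1: "\<chi> x ^ (q ^ r) = \<chi> x" for x
    unfolding assms(3) by (simp add: power_mult chi_cube chi_eq_0_iff)
  have "\<chi>' ?M * \<chi> (?M * x) = \<chi> x" for x
  proof -
    have "\<chi>' ?M * \<chi> (?M * x) = (\<chi> ?M * \<chi>' ?M) * \<chi> x" by (simp only: chi_mult mult_ac)
    with M show ?thesis by (simp only: chi_mult_chi' if_False mult_1_left)
  qed
  then have "(\<Sum>x\<in>S. smult (\<chi> x ^ (q ^ r)) (e (?M * x)))
      = smult (\<chi>' ?M) (\<Sum>x\<in>S. smult (\<chi> (?M * x + 0)) (e (?M * x + 0)))"
    by (simp add: pow1 flip: smult_sum_right)
  also have "(\<Sum>x\<in>S. smult (\<chi> (?M * x + 0)) (e (?M * x + 0))) = gs \<chi>"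
    unfolding gs_def using M by (intro sum_S_affine) simp_all
  finally have 1: "gcong (int q) p (gs \<chi> ^ (q ^ r)) (smult (\<chi>' ?M) (gs \<chi>))"
    using gs_chi_frobenius[OF assms(1), of r] by simp
  have "gcong (int q) p (smult (J ^ Suc m) (smult (of_int (int p ^ m)) (gs \<delta>))) (smult (J ^ Suc m) (gs \<delta> ^ Suc m))"
    by (intro gcong_smult gcong_sym[OF gs_delta_power])
  also have "smult (J ^ Suc m) (gs \<delta> ^ Suc m) = (smult J (gs \<delta>)) ^ Suc m"
    by (simp only: smult_power)
  also have "gcong (int q) p \<dots> ((gs \<chi> ^ 3) ^ Suc m)"
    by (intro gcong_power gcong_sym[OF gs_chi_cube])
  \<comment> \<open>The exponents match because 3 (m + 1) = (3 m + 1) + 2 = q^r + 2.\<close>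
  also have "(gs \<chi> ^ 3) ^ Suc m = gs \<chi> ^ (q ^ r) * (gs \<chi> * gs \<chi>)"
    unfolding assms(3) power_add power_mult power_Suc power_one_right by (simp only: power3_eq_cube mult_ac)
  also have "gcong (int q) p \<dots> (smult (\<chi>' ?M) (gs \<chi>) * (gs \<chi> * gs \<chi>))"
    by (intro gcong_mult 1 gcong_refl)
  also have "smult (\<chi>' ?M) (gs \<chi>) * (gs \<chi> * gs \<chi>) = smult (\<chi>' ?M) (gs \<chi> ^ 3)"
    by (simp add: power3_eq_cube mult.assoc)
  also have "gcong (int q) p \<dots> (smult (\<chi>' ?M) (smult J (gs \<delta>)))"
    by (intro gcong_smult gs_chi_cube)
  finally have "gcong (int q) p (smult (J ^ Suc m * of_int (int p ^ m)) (gs \<delta>)) (smult (\<chi>' ?M * J) (gs \<delta>))"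
    by simp
  from gcong_gs_dvd[OF this]
  have "of_int (int q) dvd - (J ^ Suc m * of_int (int p ^ m) - \<chi>' ?M * J)"
    using one_not_0_mod_p by (simp add: \<delta>_def algebra_simps)
  then have "of_int (int q) dvd J ^ Suc m * of_int (int p ^ m) - \<chi>' ?M * J" by (simp only: dvd_minus_iff)
  also have "J ^ Suc m * of_int (int p ^ m) - \<chi>' ?M * J = J * ((J * of_int (int p)) ^ m - \<chi>' ?M)"
    by (simp add: power_mult_distrib algebra_simps)
  finally show ?thesis .
qed

lemma norm_J: "eis_norm J = int p"
  using J_cnj_J by (simp only: eis_mult_cnj of_int_eis_eq_iff)

text \<open>When q^r is the norm of \<open>\<rho>\<close>, the exponent m of
  \<open>J_power_cong\<close> is exactly the one in the residue symbol.\<close>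

lemma cubic_residue_J_p:
  assumes "prime q" "q \<noteq> p" "q \<noteq> 3" "prime_elem \<rho>" "\<rho> dvd of_int (int q)" "eis_norm \<rho> = int (q ^ r)"
  shows "cubic_residue (J * of_int (int p)) \<rho> = \<chi>' (eis_norm \<rho>)"
proof -
  have "\<not> 3 dvd int q"
    using assms(1,3) primes_dvd_imp_eq[of 3 q] int_dvd_int_iff[of 3 q] by auto
  then have gp: "good_prime \<rho>"
    using prime_factor_not_dvd_3[OF _ assms(4,5)] unfolding not_3_dvd_eis_norm_of_int_iff by blast
  define m where "m = nat ((eis_norm \<rho> - 1) div 3)"
  have m: "q ^ r = 3 * m + 1"
    using good_prime_norm(1)[OF gp] unfolding m_def[symmetric] unfolding assms(6) nat_int by simp
  have "\<rho> dvd J * ((J * of_int (int p)) ^ m - \<chi>' (int (q ^ r)))"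
    using assms(5) J_power_cong[OF assms(1,2) m] by (rule dvd_trans)
  moreover have "\<not> \<rho> dvd J"
  proof
    assume "\<rho> dvd J"
    then have "\<rho> dvd of_int (int p)" using J_cnj_J by (metis dvd_mult2)
    moreover have "prime (int q)" using assms(1) by simp
    ultimately have "int q dvd int p" using eis_dvd_of_int_prime_iff[OF assms(4) _ assms(5)] by blast
    then show False using assms(1,2) prime_p primes_dvd_imp_eq[of q p] by simp
  qed
  ultimately have "\<rho> dvd (J * of_int (int p)) ^ m - \<chi>' (int (q ^ r))"
    using assms(4) by (simp add: prime_elem_dvd_mult_iff)
  then show ?thesis
    unfolding m_def assms(6)[symmetric] using gp chi_values cubic_values_cnj(1)
    by (intro cubic_residue_eqI) (auto simp: \<chi>'_def)
qed

text \<open>If q splits, its two primes contribute \<chi>'(q) each, and \<chi>'(q)^2 = \<chi>(q). If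
  q is inert, its single prime contributes \<chi>'(q^2) = \<chi>(q). The rational factor p has
  symbol 1.\<close>

lemma csym_J:
  assumes "prime q" "q \<noteq> p" "q \<noteq> 3"
  shows "csym J (of_int (int q)) = \<chi> (int q)"
proof -
  have 3: "\<not> 3 dvd int q"
    using assms(1,3) primes_dvd_imp_eq[of 3 q] int_dvd_int_iff[of 3 q] by auto
  then have n3: "\<not> 3 dvd eis_norm (of_int (int q))" by (simp only: not_3_dvd_eis_norm_of_int_iff not_False_eq_True)
  have q1: "int q > 1" using prime_gt_1_nat[OF assms(1)] by simp
  have "of_int (int q) \<noteq> (0 :: eisenstein)" "\<not> is_unit (of_int (int q) :: eisenstein)"
    using q1 by (simp_all add: is_unit_eis_iff power2_eq_1_iff del: of_int_of_nat_eq)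
  then obtain \<rho> :: eisenstein where \<rho>: "\<rho> dvd of_int (int q)" "prime \<rho>"
    using prime_divisor_exists by blast
  then have pe: "prime_elem \<rho>" by auto
  then obtain q' where q': "prime q'" "\<rho> dvd of_int q'" "eis_norm \<rho> = q' \<or> eis_norm \<rho> = q'\<^sup>2"
    by (rule eis_prime_over_int)
  have "q' dvd int q" using eis_dvd_of_int_prime_iff[OF pe q'(1,2)] \<rho>(1) by blast
  then have "q' = int q" using q'(1) assms(1) by (intro primes_dvd_imp_eq) simp_all
  with q'(3) have cases: "eis_norm \<rho> = int q \<or> eis_norm \<rho> = (int q)\<^sup>2" by simp
  have "csym (J * of_int (int p)) (of_int (int q)) = \<chi> (int q)"
    using cases
  proof
    assume n: "eis_norm \<rho> = int q"
    then have q: "of_int (int q) = \<rho> * eis_cnj \<rho>" by (simp only: eis_mult_cnj)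
    then have "eis_cnj \<rho> dvd of_int (int q)" by simp
    then have "cubic_residue (J * of_int (int p)) (eis_cnj \<rho>) = \<chi>' (int q)"
      using cubic_residue_J_p[OF assms, of "eis_cnj \<rho>" 1] n pe by simp
    moreover have "cubic_residue (J * of_int (int p)) \<rho> = \<chi>' (int q)"
      using cubic_residue_J_p[OF assms pe \<rho>(1), of 1] n by simp
    ultimately have "csym (J * of_int (int p)) (of_int (int q)) = \<chi>' (int q) * \<chi>' (int q)"
      unfolding q using pe by (subst csym_mult_right) (auto simp: csym_prime_right)
    also have "\<dots> = \<chi> (int q)"
      using chi_values[of "int q"] by (auto simp: \<chi>'_def eis_eq_iff power2_eq_square)
    finally show ?thesis .
  next
    assume n: "eis_norm \<rho> = (int q)\<^sup>2"
    from \<rho>(1) obtain u where u: "of_int (int q) = \<rho> * u" by (elim dvdE)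
    have "(int q)\<^sup>2 = (int q)\<^sup>2 * eis_norm u"
      using arg_cong[OF u, of eis_norm] n by (simp only: eis_norm_mult eis_norm_of_int)
    with q1 have "is_unit u" by (simp add: is_unit_eis_iff)
    then have "csym (J * of_int (int p)) (of_int (int q)) = cubic_residue (J * of_int (int p)) \<rho>"
      unfolding u using pe by (subst csym_mult_right) (auto simp: csym_prime_right csym_unit_right)
    also have "\<dots> = \<chi>' ((int q)\<^sup>2)"
      using cubic_residue_J_p[OF assms pe \<rho>(1), of 2] n by simp
    also have "\<dots> = \<chi> (int q)"
      using chi_values[of "int q"] by (auto simp: \<chi>'_def eis_eq_iff power2_eq_square chi_mult)
    finally show ?thesis .
  qed
  moreover have "csym (of_int (int p)) (of_int (int q)) = 1"
  proof (intro csym_of_int_of_int coprime_imp_eis_coprime 3)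
    show "coprime (int p) (int q)"
      using assms(1,2) prime_p primes_coprime[of p q] by simp
  qed (use q1 in simp)
  ultimately show ?thesis by (simp add: csym_mult_left[OF n3] del: of_int_of_nat_eq)
qed

text \<open>J is a multiple of \<open>\<pi>\<close> of the same norm, hence \<open>\<pi>\<close>
  times a unit. As J is -1 modulo 3 and \<open>\<pi>\<close> is primary, that unit is 1 or -1, and
  the symbol does not see the sign.\<close>

lemma csym_primary:
  assumes "3 dvd eis_snd \<pi>" "\<not> 3 dvd eis_fst \<pi>" "prime q" "q \<noteq> p" "q \<noteq> 3"
  shows "csym \<pi> (of_int (int q)) = csym (of_int (int q)) \<pi>"
proof -
  have n3: "\<not> 3 dvd eis_norm (of_int (int q))"
    using assms(3,5) primes_dvd_imp_eq[of 3 q] int_dvd_int_iff[of 3 q]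
    unfolding not_3_dvd_eis_norm_of_int_iff by auto
  obtain u where u: "J = \<pi> * u" using pi_dvd_J by (elim dvdE)
  have "int p = int p * eis_norm u"
    using arg_cong[OF u, of eis_norm] by (simp add: norm_J norm_pi eis_norm_mult)
  with p_pos have uu: "is_unit u" by (simp add: is_unit_eis_iff)
  have "3 dvd eis_snd (J + 1)" using three_dvd_J_plus_1 of_int_dvd_eis_iff[of 3 "J + 1"] by simp
  then have "3 dvd eis_fst \<pi> * eis_snd u + eis_snd \<pi> * (eis_fst u - eis_snd u)"
    by (simp add: u algebra_simps)
  then have "3 dvd eis_fst \<pi> * eis_snd u" using assms(1) by (simp add: dvd_add_left_iff)
  then have "3 dvd eis_snd u" using assms(2) by (simp add: prime_dvd_mult_iff)
  then have "u = 1 \<or> u = - 1" using eis_unit_cases[OF uu] by auto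
  then have "csym J (of_int (int q)) = csym \<pi> (of_int (int q))"
    unfolding u using csym_minus[OF n3, of \<pi>] by auto
  then show ?thesis
    using csym_J[OF assms(3-5)] by (simp add: csym_prime_right[OF prime_pi] \<chi>_def)
qed

end

section \<open>Reciprocity for rational moduli\<close>

text \<open>In other words, \<alpha> is 1 or -1 modulo 3. The sign is left free because -1 is a
  cube.\<close>

definition eis_primary :: "eisenstein \<Rightarrow> bool" where
  "eis_primary \<alpha> \<longleftrightarrow> 3 dvd eis_snd \<alpha> \<and> \<not> 3 dvd eis_fst \<alpha>"

lemma three_dvd_eis_norm_iff: "3 dvd eis_norm x \<longleftrightarrow> 3 dvd eis_fst x + eis_snd x"
  using cong_dvd_iff[OF eis_norm_cong_3[of x]] prime_dvd_power_iff[of "3 :: int" 2 "eis_fst x + eis_snd x"]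
  by simp

lemma eis_primary_norm: "eis_primary \<alpha> \<Longrightarrow> \<not> 3 dvd eis_norm \<alpha>"
  by (simp add: eis_primary_def three_dvd_eis_norm_iff dvd_add_left_iff)

lemma eis_primary_1 [simp]: "eis_primary 1"
  by (simp add: eis_primary_def)

lemma eis_primary_of_int: "eis_primary (of_int n) \<longleftrightarrow> \<not> 3 dvd n"
  by (simp add: eis_primary_def)

lemma eis_primary_mult:
  assumes "eis_primary \<alpha>" "eis_primary \<beta>"
  shows "eis_primary (\<alpha> * \<beta>)"
  using assms by (auto simp: eis_primary_def prime_dvd_mult_iff dvd_diff_left_iff)

lemma eis_primary_unit:
  assumes "eis_primary \<alpha>" "is_unit \<epsilon>" "eis_primary (\<alpha> * \<epsilon>)"
  shows "\<epsilon> = 1 \<or> \<epsilon> = - 1"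
proof -
  have "3 dvd eis_fst \<alpha> * eis_snd \<epsilon> + eis_snd \<alpha> * (eis_fst \<epsilon> - eis_snd \<epsilon>)"
    using assms(3) by (simp add: eis_primary_def algebra_simps)
  then have "3 dvd eis_fst \<alpha> * eis_snd \<epsilon>" using assms(1) by (simp add: dvd_add_left_iff eis_primary_def)
  then have "3 dvd eis_snd \<epsilon>" using assms(1) by (simp add: prime_dvd_mult_iff eis_primary_def)
  then show ?thesis using eis_unit_cases[OF assms(2)] by auto
qed

lemma eis_primary_associate:
  assumes "\<not> 3 dvd eis_norm \<alpha>"
  obtains \<epsilon> where "is_unit \<epsilon>" "eis_primary (\<alpha> * \<epsilon>)"
proof -
  let ?a = "eis_fst \<alpha>" and ?b = "eis_snd \<alpha>"
  have ab: "\<not> 3 dvd ?a + ?b" using assms by (simp add: three_dvd_eis_norm_iff)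
  have "3 dvd b \<or> 3 dvd a \<or> 3 dvd a - b" if "\<not> 3 dvd a + b" for a b :: int
    using that by presburger
  with ab consider "3 dvd ?b" | "3 dvd ?a" | "3 dvd ?a - ?b" by blast
  \<comment> \<open>The \<omega>-coordinates of \<alpha>, \<alpha> \<omega>, \<alpha> \<omega>^2 are
    b, a - b and -a.\<close>
  then have "\<exists>\<epsilon>\<in>{1, eis_omega, eis_omega\<^sup>2}. 3 dvd eis_snd (\<alpha> * \<epsilon>)"
    by cases (simp_all add: power2_eq_square)
  then obtain \<epsilon> where \<epsilon>: "\<epsilon> \<in> {1, eis_omega, eis_omega\<^sup>2}" "3 dvd eis_snd (\<alpha> * \<epsilon>)" by blast
  then have u: "is_unit \<epsilon>" by (auto simp: is_unit_eis_iff eis_norm_def power2_eq_square)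
  then have "\<not> 3 dvd eis_norm (\<alpha> * \<epsilon>)" using assms by (simp add: eis_norm_mult is_unit_eis_iff)
  with \<epsilon>(2) have "eis_primary (\<alpha> * \<epsilon>)"
    by (auto simp: eis_primary_def three_dvd_eis_norm_iff simp del: eis_sel_simps)
  with u show thesis by (rule that)
qed

lemma csym_reciprocity_prime_prime:
  assumes "prime_elem \<alpha>" "eis_primary \<alpha>" "prime q" "q \<noteq> 3" "\<not> \<alpha> dvd of_int (int q)"
  shows "csym \<alpha> (of_int (int q)) = csym (of_int (int q)) \<alpha>"
proof -
  have \<alpha>3: "\<not> 3 dvd eis_norm \<alpha>" using assms(2) by (rule eis_primary_norm)
  obtain p' where p': "prime p'" "\<alpha> dvd of_int p'" "eis_norm \<alpha> = p' \<or> eis_norm \<alpha> = p'\<^sup>2"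
    using assms(1) by (rule eis_prime_over_int)
  define p where "p = nat p'"
  have p: "prime p" "p' = int p" using p'(1) by (auto simp: p_def prime_ge_0_int)
  have "p \<noteq> q" using assms(5) p'(2) p(2) by auto
  have p3: "p \<noteq> 3" using \<alpha>3 p'(3) p(2) by auto
  from p'(3) show ?thesis
  proof
    assume "eis_norm \<alpha> = p'"
    then interpret split_prime \<alpha> p
      using assms(1) p p3 by unfold_locales auto
    show ?thesis using assms(2-4) \<open>p \<noteq> q\<close> by (intro csym_primary) (auto simp: eis_primary_def)
  next
    \<comment> \<open>An inert primary prime is a rational prime up to sign, so both symbols are
      between coprime integers and equal 1.\<close>
    assume n: "eis_norm \<alpha> = p'\<^sup>2"
    have q0: "int q > 0" "p' > 0" using prime_gt_0_nat[OF assms(3)] prime_gt_0_int[OF p'(1)] by auto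
    from p'(2) obtain u where u: "of_int p' = \<alpha> * u" by (elim dvdE)
    have "p'\<^sup>2 = p'\<^sup>2 * eis_norm u"
      using arg_cong[OF u, of eis_norm] n by (simp only: eis_norm_mult eis_norm_of_int)
    with q0 have uu: "is_unit u" by (simp add: is_unit_eis_iff)
    have p'3: "\<not> 3 dvd p'" using \<alpha>3 n by auto
    have q3: "\<not> 3 dvd int q" using assms(3,4) primes_dvd_imp_eq[of 3 q] int_dvd_int_iff[of 3 q] by auto
    have n3: "\<not> 3 dvd eis_norm (of_int (int q))" using q3 unfolding not_3_dvd_eis_norm_of_int_iff .
    have "u = 1 \<or> u = - 1"
      using eis_primary_unit[OF assms(2) uu] p'3 unfolding u[symmetric] eis_primary_of_int by blast
    then have "csym \<alpha> (of_int (int q)) = csym (of_int p') (of_int (int q))"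
      unfolding u using csym_minus[OF n3, of \<alpha>] by auto
    moreover have "csym (of_int (int q)) (of_int p') = csym (of_int (int q)) \<alpha>"
      unfolding u using assms(1) uu by (subst csym_mult_right) (auto simp: csym_unit_right)
    moreover have "coprime p' (int q)"
      using p assms(3) \<open>p \<noteq> q\<close> primes_coprime[of p q] by simp
    then have "csym (of_int p') (of_int (int q)) = 1" "csym (of_int (int q)) (of_int p') = 1"
      using q3 p'3 q0 by (intro csym_of_int_of_int coprime_imp_eis_coprime; simp add: coprime_commute)+
    ultimately show ?thesis by simp
  qed
qed

lemma csym_reciprocity_prime:
  fixes n :: int
  assumes "prime_elem \<alpha>" "eis_primary \<alpha>" "\<not> 3 dvd n" "\<not> \<alpha> dvd of_int n"
  shows "csym \<alpha> (of_int n) = csym (of_int n) \<alpha>"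
  using assms(3,4)
proof (induction n rule: prime_divisors_induct)
  case (unit n)
  then have "n = 1 \<or> n = - 1" by auto
  then show ?case
    using eis_primary_norm[OF assms(2)] by (auto simp: csym_minus_1 csym_unit_right)
next
  case (factor q n)
  have nz: "q \<noteq> 0" "n \<noteq> 0" using factor.prems(1) by auto
  have q3: "\<not> 3 dvd q" "\<not> 3 dvd n" using factor.prems(1) by (auto simp: dvd_mult dvd_mult2)
  have d: "\<not> \<alpha> dvd of_int q" "\<not> \<alpha> dvd of_int n" using factor.prems(2) by auto
  define q' where "q' = nat q"
  have q': "prime q'" "q = int q'" using factor.hyps by (auto simp: q'_def prime_ge_0_int)
  have "csym \<alpha> (of_int q) = csym (of_int q) \<alpha>"
    unfolding q'(2) using q' q3(1) d(1) assms(1,2) by (intro csym_reciprocity_prime_prime) auto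
  then show ?case
    using nz factor.IH[OF q3(2) d(2)] eis_primary_norm[OF assms(2)]
    by (simp add: csym_mult_right csym_mult_left)
qed auto

text \<open>The multiplicativity of both symbols leaves a unit \<open>\<epsilon>\<close> undetermined, which is \<open>\<plusminus>1\<close>
  when \<open>\<alpha>\<close> is primary.\<close>

theorem csym_reciprocity:
  fixes n :: int
  assumes "eis_primary \<alpha>" "\<not> 3 dvd n" "coprime \<alpha> (of_int n)"
  shows "csym \<alpha> (of_int n) = csym (of_int n) \<alpha>"
proof -
  have n0: "of_int n \<noteq> (0 :: eisenstein)" using assms(2) by auto
  have n3: "\<not> 3 dvd eis_norm (of_int n)" using assms(2) unfolding not_3_dvd_eis_norm_of_int_iff .
  have "\<not> 3 dvd eis_norm \<alpha> \<Longrightarrow> coprime \<alpha> (of_int n) \<Longrightarrow>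
      \<exists>\<epsilon>. is_unit \<epsilon> \<and> eis_primary (\<alpha> * \<epsilon>) \<and> csym (\<alpha> * \<epsilon>) (of_int n) = csym (of_int n) \<alpha>" for \<alpha>
  proof (induction \<alpha> rule: prime_divisors_induct)
    case (unit \<alpha>)
    then have "\<alpha> * eis_cnj \<alpha> = 1" "is_unit (eis_cnj \<alpha>)" by (simp_all add: is_unit_eis_iff eis_mult_cnj)
    then show ?case using unit.hyps n3 by (intro exI[of _ "eis_cnj \<alpha>"]) (simp add: csym_unit_right)
  next
    case (factor \<pi> x)
    have pe: "prime_elem \<pi>" using factor.hyps by auto
    have 3: "\<not> 3 dvd eis_norm \<pi>" "\<not> 3 dvd eis_norm x"
      using factor.prems(1) unfolding not_3_dvd_eis_norm_mult_iff by auto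
    have nz: "\<pi> \<noteq> 0" "x \<noteq> 0" using factor.prems(1) by auto
    have co: "coprime x (of_int n)" "\<not> \<pi> dvd of_int n"
      using factor.prems(2) pe unfolding eis_coprime_iff[OF n0] by (auto simp: prime_elem_dvd_mult_iff)
    obtain \<epsilon> where \<epsilon>: "is_unit \<epsilon>" "eis_primary (x * \<epsilon>)" "csym (x * \<epsilon>) (of_int n) = csym (of_int n) x"
      using factor.IH[OF 3(2) co(1)] by blast
    obtain \<epsilon>' where \<epsilon>': "is_unit \<epsilon>'" "eis_primary (\<pi> * \<epsilon>')"
      using eis_primary_associate[OF 3(1)] .
    have "prime_elem (\<pi> * \<epsilon>')" using pe \<epsilon>'(1) by (simp add: prime_elem_mult_unit_left mult.commute)
    moreover have "\<not> \<pi> * \<epsilon>' dvd of_int n" using co(2) \<epsilon>'(1) by (simp add: mult_unit_dvd_iff)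
    ultimately have "csym (\<pi> * \<epsilon>') (of_int n) = csym (of_int n) (\<pi> * \<epsilon>')"
      using \<epsilon>'(2) assms(2) by (intro csym_reciprocity_prime)
    also have "\<dots> = csym (of_int n) \<pi>"
      using nz \<epsilon>'(1) by (subst csym_mult_right) (auto simp: csym_unit_right)
    finally have 1: "csym (\<pi> * \<epsilon>') (of_int n) = csym (of_int n) \<pi>" .
    have e: "\<pi> * x * (\<epsilon>' * \<epsilon>) = (\<pi> * \<epsilon>') * (x * \<epsilon>)" by (simp only: mult_ac)
    show ?case
    proof (intro exI[of _ "\<epsilon>' * \<epsilon>"] conjI)
      show "is_unit (\<epsilon>' * \<epsilon>)" using \<epsilon>'(1) \<epsilon>(1) by (rule unit_prod)
      show "eis_primary (\<pi> * x * (\<epsilon>' * \<epsilon>))" unfolding e using \<epsilon>'(2) \<epsilon>(2) by (rule eis_primary_mult)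
      show "csym (\<pi> * x * (\<epsilon>' * \<epsilon>)) (of_int n) = csym (of_int n) (\<pi> * x)"
        unfolding e using nz 1 \<epsilon>(3) n3 by (simp add: csym_mult_left csym_mult_right)
    qed
  qed simp
  from this[OF eis_primary_norm[OF assms(1)] assms(3)] obtain \<epsilon>
    where \<epsilon>: "is_unit \<epsilon>" "eis_primary (\<alpha> * \<epsilon>)" "csym (\<alpha> * \<epsilon>) (of_int n) = csym (of_int n) \<alpha>" by blast
  have "\<epsilon> = 1 \<or> \<epsilon> = - 1" using assms(1) \<epsilon>(1,2) by (rule eis_primary_unit)
  then show ?thesis using \<epsilon>(3) csym_minus[OF n3, of \<alpha>] by auto
qed

section \<open>Symbols of elements of $\mathbb{Z}[\sqrt{-3}]$\<close>

definition eis_theta :: eisenstein where "eis_theta = 1 + 2 * eis_omega"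

lemma eis_theta_sel [simp]: "eis_fst eis_theta = 1" "eis_snd eis_theta = 2"
  by (simp_all add: eis_theta_def)

lemma eis_theta_mult_theta: "eis_theta * eis_theta = of_int (- 3)"
  by (simp add: eis_eq_iff)

text \<open>\<open>eis_theta\<close> is a square root of -3, so the square of its symbol is the
  symbol of a rational integer, that is 1; a cube root of unity with square 1 is 1.\<close>

lemma csym_theta:
  assumes "\<not> 3 dvd n"
  shows "csym eis_theta (of_int n) = 1"
proof -
  have n3: "\<not> 3 dvd eis_norm (of_int n)" using assms unfolding not_3_dvd_eis_norm_of_int_iff .
  have "coprime (- 3) n" using assms prime_imp_coprime[of 3 n] by simp
  then have "csym (of_int (- 3)) (of_int n) = 1"
    using assms by (intro csym_of_int_of_int coprime_imp_eis_coprime) auto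
  then have "csym eis_theta (of_int n) ^ 2 = 1"
    using csym_mult_left[OF n3, of eis_theta eis_theta] unfolding eis_theta_mult_theta power2_eq_square by simp
  then show ?thesis using csym_values[OF n3, of eis_theta] by (auto simp: eis_eq_iff power2_eq_square)
qed

definition eis_quad :: "int \<Rightarrow> int \<Rightarrow> eisenstein" where
  "eis_quad s t = of_int s - of_int t * eis_theta"

lemma eis_quad_sel [simp]: "eis_fst (eis_quad s t) = s - t" "eis_snd (eis_quad s t) = - 2 * t"
  by (simp_all add: eis_quad_def)

lemma eis_norm_quad: "eis_norm (eis_quad s t) = s\<^sup>2 + 3 * t\<^sup>2"
  by (simp add: eis_norm_def power2_eq_square algebra_simps)

lemma eis_primary_quad: "3 dvd t \<Longrightarrow> \<not> 3 dvd s \<Longrightarrow> eis_primary (eis_quad s t)"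
  by (simp add: eis_primary_def dvd_diff_left_iff)

lemma int_coprimeI:
  fixes a b :: int
  assumes "\<And>l. prime l \<Longrightarrow> l dvd a \<Longrightarrow> l dvd b \<Longrightarrow> False"
  shows "coprime a b"
proof (rule ccontr)
  assume "\<not> coprime a b"
  then have nu: "\<not> is_unit (gcd a b)" by (simp add: coprime_iff_gcd_eq_1)
  show False
  proof (cases "gcd a b = 0")
    case True
    then show False using assms[of 2] by simp
  next
    case False
    with nu obtain l where "l dvd gcd a b" "prime l" using prime_divisor_exists by blast
    with assms[of l] show False by simp
  qed
qed

lemma coprime_prime_not_dvd:
  fixes a b :: int
  assumes "coprime a b" "prime l" "l dvd a"
  shows "\<not> l dvd b"
  using assms coprime_common_divisor not_prime_unit by blast

lemma csym_of_int_left_eq_1I: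
  fixes k :: int
  assumes "\<not> 3 dvd eis_norm \<alpha>" "k \<noteq> 0" "\<And>l. prime l \<Longrightarrow> l dvd k \<Longrightarrow> csym (of_int l) \<alpha> = 1"
  shows "csym (of_int k) \<alpha> = 1"
  using assms(2,3)
proof (induction k rule: prime_divisors_induct)
  case (unit k)
  then have "k = 1 \<or> k = - 1" by auto
  then show ?case using assms(1) by (auto simp: csym_minus_1)
next
  case (factor l k)
  then show ?case using assms(1) by (simp add: csym_mult_left)
qed auto

text \<open>Reciprocity turns the symbol around, and modulo \<open>l\<close> the element s - t
  sqrt(-3) reduces to s or to -t sqrt(-3), whose symbols are trivial.\<close>

lemma csym_quad_prime_neq_3:
  assumes "coprime s t" "\<not> 3 dvd s" "3 dvd t" "prime l" "l \<noteq> 3" "l dvd s * t"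
  shows "csym (of_int l) (eis_quad s t) = 1"
proof -
  have prim: "eis_primary (eis_quad s t)" using assms by (intro eis_primary_quad)
  have l3: "\<not> 3 dvd l" using assms(4,5) primes_dvd_imp_eq[of 3 l] by auto
  have l30: "\<not> l dvd 3" using assms(4,5) primes_dvd_imp_eq[of l 3] by auto
  have l0: "l \<noteq> 0" using assms(4) by auto
  have n3: "\<not> 3 dvd eis_norm (of_int l)" using l3 unfolding not_3_dvd_eis_norm_of_int_iff .
  consider "l dvd s" "\<not> l dvd t" | "l dvd t" "\<not> l dvd s"
    using coprime_prime_not_dvd[OF assms(1,4)] assms(6) prime_dvd_mult_iff[OF assms(4), of s t] by blast
  then show ?thesis
  proof cases
    case 1
    then have "\<not> l dvd s\<^sup>2 + 3 * t\<^sup>2"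
      using assms(4) l30 by (simp add: dvd_add_right_iff prime_dvd_mult_iff prime_dvd_power_iff)
    then have "coprime (eis_norm (eis_quad s t)) l"
      unfolding eis_norm_quad coprime_commute[of _ l] by (rule prime_imp_coprime[OF assms(4)])
    then have "csym (of_int l) (eis_quad s t) = csym (eis_quad s t) (of_int l)"
      using prim l3 l0 by (intro csym_reciprocity[symmetric] eis_coprime_if_coprime_norm) auto
    also have "\<dots> = csym (of_int (- t) * eis_theta) (of_int l)"
      using 1 by (intro csym_cong[OF n3]) (simp add: eis_quad_def)
    also have "\<dots> = csym (of_int (- t)) (of_int l)"
      using csym_theta[OF l3] by (simp only: csym_mult_left[OF n3] mult_1_right)
    also have "\<dots> = 1"
      using 1 l3 l0 prime_imp_coprime[OF assms(4), of t]
      by (intro csym_of_int_of_int coprime_imp_eis_coprime) (auto simp: coprime_commute)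
    finally show ?thesis .
  next
    case 2
    then have "\<not> l dvd s\<^sup>2 + 3 * t\<^sup>2"
      using assms(4) by (simp add: dvd_add_left_iff prime_dvd_power_iff power2_eq_square prime_dvd_mult_iff)
    then have "coprime (eis_norm (eis_quad s t)) l"
      unfolding eis_norm_quad coprime_commute[of _ l] by (rule prime_imp_coprime[OF assms(4)])
    then have "csym (of_int l) (eis_quad s t) = csym (eis_quad s t) (of_int l)"
      using prim l3 l0 by (intro csym_reciprocity[symmetric] eis_coprime_if_coprime_norm) auto
    also have "\<dots> = csym (of_int s) (of_int l)"
      using 2 by (intro csym_cong[OF n3]) (simp add: eis_quad_def)
    also have "\<dots> = 1"
      using 2 l3 l0 prime_imp_coprime[OF assms(4), of s]
      by (intro csym_of_int_of_int coprime_imp_eis_coprime) (auto simp: coprime_commute)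
    finally show ?thesis .
  qed
qed

text \<open>Since $-3t^2 \equiv s^2 \pmod{s - t\sqrt{-3}}$, the preceding lemma shows that the power
  $1 + 2 v_3(t)$ of the symbol of \<open>3\<close> is \<open>1\<close>.\<close>

lemma csym_3_quad_exact:
  assumes "coprime s t" "\<not> 3 dvd s" "t = 9 * t0" "\<not> 3 dvd t0"
  shows "csym (of_int 3) (eis_quad s t) = 1"
proof -
  let ?\<alpha> = "eis_quad s t"
  have t3: "3 dvd t" using assms(3) by simp
  have \<alpha>3: "\<not> 3 dvd eis_norm ?\<alpha>" using t3 assms(2) by (intro eis_primary_norm eis_primary_quad)
  have *: "csym (of_int k) ?\<alpha> = 1" if "\<not> 3 dvd k" "k dvd s * t" for k
  proof (rule csym_of_int_left_eq_1I[OF \<alpha>3])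
    fix l :: int assume l: "prime l" "l dvd k"
    with that have "l \<noteq> 3" "l dvd s * t" using dvd_trans by blast+
    then show "csym (of_int l) ?\<alpha> = 1" by (intro csym_quad_prime_neq_3[OF assms(1,2) t3 l(1)])
  qed (use that(1) in auto)
  have s: "csym (of_int s) ?\<alpha> = 1" by (rule *[OF assms(2)]) simp
  have t0: "csym (of_int t0) ?\<alpha> = 1" by (rule *[OF assms(4)]) (simp add: assms(3))
  \<comment> \<open>With t = 9 t0 one has 3 t^2 = 3^5 t0^2, and 5 is prime to 3. For t = 3 t0 the
    exponent would be 3 and nothing would follow.\<close>
  have "?\<alpha> dvd of_int s * of_int s - - (of_int 3 ^ 5 * (of_int t0 * of_int t0))"
  proof -
    have "?\<alpha> * eis_cnj ?\<alpha> = of_int s * of_int s - - (of_int 3 ^ 5 * (of_int t0 * of_int t0))"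
      unfolding eis_mult_cnj eis_norm_quad assms(3) by (simp add: power2_eq_square)
    then show ?thesis by (metis dvd_triv_left)
  qed
  then have "csym (of_int s * of_int s) ?\<alpha> = csym (- (of_int 3 ^ 5 * (of_int t0 * of_int t0))) ?\<alpha>"
    by (rule csym_cong[OF \<alpha>3])
  then have "csym (of_int 3) ?\<alpha> ^ 5 = 1"
    by (simp only: csym_mult_left[OF \<alpha>3] csym_minus[OF \<alpha>3] csym_power_left[OF \<alpha>3] s t0 mult_1_right)
  then show ?thesis using csym_values[OF \<alpha>3, of "of_int 3"]
    by (auto simp: eis_eq_iff numeral_eq_Suc)
qed

lemma eis_quad_mult_of_int: "of_int g * eis_quad s t = eis_quad (g * s) (g * t)"
  by (simp add: eis_quad_def algebra_simps)

text \<open>Removes coprimality: the common factor of s and t is a rational integer prime to 3, for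
  which the symbol of 3 is 1.\<close>

lemma csym_3_quad_exact':
  assumes "\<not> 3 dvd s" "t = 9 * t0" "\<not> 3 dvd t0"
  shows "csym (of_int 3) (eis_quad s t) = 1"
proof -
  have "gcd s t \<noteq> 0" using assms by auto
  then obtain s' t' where st: "s = gcd s t * s'" "t = gcd s t * t'" "coprime s' t'"
    by (metis gcd_coprime_exists mult.commute)
  define g where "g = gcd s t"
  have g3: "\<not> 3 dvd g" using assms(1) unfolding g_def using dvd_trans gcd_dvd1 by blast
  have "\<not> 3 dvd s'" using assms(1) st(1) by (metis dvd_mult)
  have "9 dvd g * t'" using assms(2) st(2) unfolding g_def by (metis dvd_triv_left)
  moreover have "coprime (3 ^ 2) g" using g3 prime_imp_coprime[of 3 g] by (simp only: coprime_power_left_iff) simp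
  ultimately have "9 dvd t'" by (simp add: coprime_dvd_mult_right_iff)
  then obtain t1 where t1: "t' = 9 * t1" by (elim dvdE)
  have "\<not> 3 dvd t1" using assms(2,3) st(2) t1 unfolding g_def[symmetric]
    by (metis dvd_mult mult.left_commute mult_cancel_left zero_neq_numeral)
  then have 1: "csym (of_int 3) (eis_quad s' t') = 1"
    using st(3) \<open>\<not> 3 dvd s'\<close> t1 by (intro csym_3_quad_exact)
  have "eis_quad s t = of_int g * eis_quad s' t'"
    unfolding eis_quad_mult_of_int using st by (simp add: g_def)
  moreover have "csym (of_int 3) (of_int g) = 1"
    using g3 prime_imp_coprime[of 3 g] \<open>gcd s t \<noteq> 0\<close>
    by (intro csym_of_int_of_int coprime_imp_eis_coprime) (auto simp: g_def)
  moreover have "eis_quad s' t' \<noteq> 0"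
    using eis_primary_norm[OF eis_primary_quad[of t' s']] \<open>\<not> 3 dvd s'\<close> t1 by auto
  ultimately show ?thesis using 1 \<open>gcd s t \<noteq> 0\<close>
    by (simp add: csym_mult_right g_def del: of_int_numeral)
qed

text \<open>If \<open>27\<close> divides \<open>t\<close>, multiplication by $1 - 9\sqrt{-3}$ leads back to a coefficient divisible
  by \<open>9\<close> but not by \<open>27\<close>.\<close>

lemma csym_3_quad:
  assumes "\<not> 3 dvd s" "9 dvd t"
  shows "csym (of_int 3) (eis_quad s t) = 1"
proof (cases "27 dvd t")
  case False
  obtain t0 where "t = 9 * t0" using assms(2) by (elim dvdE)
  with False assms(1) show ?thesis by (intro csym_3_quad_exact'[of s t t0]) auto
next
  case True
  then obtain t0 where t0: "t = 27 * t0" by (elim dvdE)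
  have e: "eis_quad s t * eis_quad 1 9 = eis_quad (s - 27 * t) (9 * (3 * t0 + s))"
    by (simp add: eis_eq_iff t0)
  have "csym (of_int 3) (eis_quad s t * eis_quad 1 9) = 1"
    unfolding e using assms(1) by (intro csym_3_quad_exact'[of _ _ "3 * t0 + s"]) (simp_all add: dvd_diff_left_iff dvd_add_right_iff)
  moreover have "eis_quad s t \<noteq> 0" "eis_quad 1 9 \<noteq> 0"
    using eis_primary_norm[OF eis_primary_quad[of t s]] assms(1) t0 by (auto simp: eis_eq_iff)
  moreover have "csym (of_int 3) (eis_quad 1 9) = 1"
    by (rule csym_3_quad_exact'[of _ _ 1]) simp_all
  ultimately show ?thesis by (simp add: csym_mult_right del: of_int_numeral)
qed

text \<open>By reciprocity the symbol is that of \<open>M\<close> modulo s - t sqrt(-3). There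
  \<open>M * k\<close> is a cube, and \<open>k\<close> has symbol 1 prime by prime: primes other
  than 3 divide a coordinate, and 3 is covered by 9 dividing t.\<close>

lemma csym_quad_eq_1:
  assumes "\<not> 3 dvd M" "coprime s t" "\<not> 3 dvd s" "3 dvd t" "coprime M (s\<^sup>2 + 3 * t\<^sup>2)"
    and "k \<noteq> 0" "s\<^sup>2 + 3 * t\<^sup>2 dvd M * k - m ^ 3"
    and "\<And>l. prime l \<Longrightarrow> l dvd k \<Longrightarrow> l \<noteq> 3 \<Longrightarrow> l dvd s * t" "3 dvd k \<Longrightarrow> 9 dvd t"
  shows "csym (eis_quad s t) (of_int M) = 1"
proof -
  let ?\<alpha> = "eis_quad s t"
  have prim: "eis_primary ?\<alpha>" using assms by (intro eis_primary_quad)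
  have \<alpha>3: "\<not> 3 dvd eis_norm ?\<alpha>" using prim by (rule eis_primary_norm)
  have co: "coprime ?\<alpha> (of_int M)"
    using assms(1,5) by (intro eis_coprime_if_coprime_norm) (auto simp: eis_norm_quad coprime_commute)
  have k: "csym (of_int k) ?\<alpha> = 1"
  proof (rule csym_of_int_left_eq_1I[OF \<alpha>3 assms(6)])
    fix l :: int assume l: "prime l" "l dvd k"
    show "csym (of_int l) ?\<alpha> = 1"
    proof (cases "l = 3")
      case True
      then show ?thesis using csym_3_quad[OF assms(3)] assms(9) l by simp
    next
      case False
      then show ?thesis using csym_quad_prime_neq_3[OF assms(2-4) l(1)] assms(8)[OF l] by simp
    qed
  qed
  have "?\<alpha> dvd of_int (s\<^sup>2 + 3 * t\<^sup>2)" by (metis dvd_triv_left eis_mult_cnj eis_norm_quad)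
  also have "of_int (s\<^sup>2 + 3 * t\<^sup>2) dvd (of_int (M * k - m ^ 3) :: eisenstein)"
    using assms(7) by (simp only: of_int_dvd_of_int_eis_iff)
  finally have "?\<alpha> dvd of_int M * of_int k - of_int m ^ 3" by simp
  then have "csym (of_int M * of_int k) ?\<alpha> = csym (of_int m ^ 3) ?\<alpha>" by (rule csym_cong[OF \<alpha>3])
  then have e: "csym (of_int M) ?\<alpha> = csym (of_int m) ?\<alpha> ^ 3"
    by (simp only: csym_mult_left[OF \<alpha>3] csym_power_left[OF \<alpha>3] k mult_1_right)
  have "csym (of_int M) ?\<alpha> \<noteq> 0"
    using csym_eq_0_iff[OF \<alpha>3, of "of_int M"] co by (simp add: coprime_commute)
  with e have "csym (of_int m) ?\<alpha> \<noteq> 0" by auto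
  then have "csym (of_int M) ?\<alpha> = 1" unfolding e by (rule cubic_values_cnj(3)[OF csym_values[OF \<alpha>3]])
  then show ?thesis using csym_reciprocity[OF prim assms(1) co] by simp
qed

text \<open>The common engine of the direct and the twisted argument. W is the norm of Q + P
  sqrt(E), and r and w record how far it is from being a cube. The primes of r w are required to
  divide exactly one of P X and Q y, so that they still divide one coordinate after
  cancellation.\<close>

lemma csym_quad_form_eq_1:
  fixes X y E P Q M W r w z :: int
  assumes M: "M = X\<^sup>2 + 27 * E * y\<^sup>2" "\<not> 3 dvd M" "coprime M y" "y \<noteq> 0"
    and PQ: "coprime P Q" "\<not> 3 dvd P"
    and W: "W = Q\<^sup>2 - P\<^sup>2 * E" "coprime M W"
    and r: "r * W = w * z ^ 3" "r * w \<noteq> 0"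
    and l: "\<And>l. prime l \<Longrightarrow> l dvd r * w \<Longrightarrow> l \<noteq> 3 \<Longrightarrow>
        \<not> l dvd P * X \<and> l dvd Q * y \<or> l dvd P * X \<and> \<not> l dvd Q * y"
    and l3: "3 dvd r * w \<Longrightarrow> 3 dvd Q"
  shows "csym (eis_quad (P * X) (3 * Q * y)) (of_int M) = 1"
proof -
  have X3: "\<not> 3 dvd X" using M(1,2) by (auto simp: power2_eq_square)
  have P0: "P \<noteq> 0" using PQ(2) by auto
  \<comment> \<open>A prime of both P and y divides both coordinates. Once d is removed, each prime
    other than 3 of P1^2 r w^2 y1 divides exactly one of s1 and t1, so it survives the cancellation
    of g.\<close>
  define d where "d = gcd P y"
  have d0: "d \<noteq> 0" using M(4) by (simp add: d_def)
  obtain P1 y1 where P1: "P = d * P1" and y1: "y = d * y1" and cop1: "coprime P1 y1"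
    using gcd_coprime_exists[of P y] d0 unfolding d_def by (metis mult.commute)
  define s1 t1 where "s1 = P1 * X" and "t1 = 3 * Q * y1"
  define g where "g = gcd s1 t1"
  have s1_3: "\<not> 3 dvd s1"
    using X3 PQ(2) unfolding s1_def P1 by (auto simp: prime_dvd_mult_iff)
  then have g0: "g \<noteq> 0" by (auto simp: g_def)
  obtain s t where s: "s1 = g * s" and t: "t1 = g * t" and cop: "coprime s t"
    using gcd_coprime_exists[of s1 t1] g0 unfolding g_def by (metis mult.commute)
  have g3: "\<not> 3 dvd g" "\<not> 3 dvd s" using s1_3 unfolding s by auto
  have dvd_g: "l dvd t" if "prime l" "l dvd t1" "\<not> l dvd s1" for l
    using that unfolding s t by (auto simp: prime_dvd_mult_iff)
  have dvd_g': "l dvd s" if "prime l" "l dvd s1" "\<not> l dvd t1" for l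
    using that unfolding s t by (auto simp: prime_dvd_mult_iff)
  have t9: "9 dvd t" if "9 dvd t1"
  proof -
    have "coprime (3 ^ 2) g" using g3 prime_imp_coprime[of 3 g] by (simp only: coprime_power_left_iff) simp
    with that show ?thesis unfolding t by (simp add: coprime_dvd_mult_right_iff)
  qed
  have t3: "3 dvd t" using dvd_g[of 3] s1_3 by (simp add: t1_def)
  have noPQ: False if "prime l" "l dvd P" "l dvd Q" for l
    using that coprime_prime_not_dvd[OF PQ(1)] by blast
  have noMy: False if "prime l" "l dvd M" "l dvd y" for l
    using that coprime_prime_not_dvd[OF M(3)] by blast
  have noMW: False if "prime l" "l dvd M" "l dvd W" for l
    using that coprime_prime_not_dvd[OF W(2)] by blast
  have noM3: "l \<noteq> 3" if "l dvd M" for l using that M(2) by auto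
  have l_3: "\<not> l dvd 3" if "prime l" "l \<noteq> 3" for l :: int
    using that primes_dvd_imp_eq[of l 3] by auto
  have l_27: "\<not> l dvd 27" if "prime l" "l \<noteq> 3" for l :: int
    using l_3[OF that] prime_dvd_power[OF that(1), of 3 3] by auto
  have key: "g\<^sup>2 * (s\<^sup>2 + 3 * t\<^sup>2) = P1\<^sup>2 * M + 27 * y1\<^sup>2 * W"
  proof -
    have "g\<^sup>2 * (s\<^sup>2 + 3 * t\<^sup>2) = s1\<^sup>2 + 3 * t1\<^sup>2" unfolding s t by (simp add: power2_eq_square algebra_simps)
    also have "\<dots> = P1\<^sup>2 * M + 27 * y1\<^sup>2 * W"
      unfolding s1_def t1_def M(1) W(1) P1 y1 by (simp add: power2_eq_square algebra_simps)
    finally show ?thesis .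
  qed
  have "csym (eis_quad s t) (of_int M) = 1"
  \<comment> \<open>Multiplying \<open>key\<close> by r w^2 y1 and replacing r W by w z^3 turns the
    last term into 27 y1^3 w^3 z^3 = (3 y1 w z)^3; this dictates k and m.\<close>
  proof (rule csym_quad_eq_1[where k = "P1\<^sup>2 * r * w\<^sup>2 * y1" and m = "- 3 * y1 * w * z"])
    show "\<not> 3 dvd M" "coprime s t" "\<not> 3 dvd s" "3 dvd t" by fact+
    show "coprime M (s\<^sup>2 + 3 * t\<^sup>2)"
    proof (rule int_coprimeI)
      fix l assume ll: "prime l" "l dvd M" "l dvd s\<^sup>2 + 3 * t\<^sup>2"
      then have "l dvd P1\<^sup>2 * M + 27 * y1\<^sup>2 * W" unfolding key[symmetric] by simp
      with ll(2) have "l dvd 27 * y1\<^sup>2 * W" by (simp add: dvd_add_right_iff)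
      then have "l dvd 27 \<or> l dvd y1 \<or> l dvd W"
        using ll(1) by (auto simp: prime_dvd_mult_iff prime_dvd_power_iff)
      then show False
        using noMW[OF ll(1,2)] noMy[OF ll(1,2)] l_27[OF ll(1) noM3[OF ll(2)]]
        by (auto simp: y1)
    qed
    show "P1\<^sup>2 * r * w\<^sup>2 * y1 \<noteq> 0" using P0 r(2) M(4) P1 y1 by auto
    have "M * (P1\<^sup>2 * r * w\<^sup>2 * y1) - (- 3 * y1 * w * z) ^ 3
        = w\<^sup>2 * y1 * (r * (P1\<^sup>2 * M) + 27 * y1\<^sup>2 * (w * z ^ 3))"
      by (simp add: power2_eq_square power3_eq_cube algebra_simps)
    also have "\<dots> = w\<^sup>2 * y1 * r * (g\<^sup>2 * (s\<^sup>2 + 3 * t\<^sup>2))"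
      unfolding r(1)[symmetric] key by (simp add: algebra_simps)
    finally show "s\<^sup>2 + 3 * t\<^sup>2 dvd M * (P1\<^sup>2 * r * w\<^sup>2 * y1) - (- 3 * y1 * w * z) ^ 3" by simp
    show "l dvd s * t" if ll: "prime l" "l dvd P1\<^sup>2 * r * w\<^sup>2 * y1" "l \<noteq> 3" for l
    proof -
      note pd = prime_dvd_mult_iff[OF ll(1)]
      have "l dvd P1 \<or> l dvd y1 \<or> l dvd r * w"
        using ll(1,2) by (auto simp: pd prime_dvd_power_iff)
      then consider "l dvd P1" | "l dvd y1" | "\<not> l dvd P1" "\<not> l dvd y1" "l dvd r * w" by blast
      then have "l dvd s \<or> l dvd t"
      proof cases
        case 1
        then have "\<not> l dvd y1" using coprime_prime_not_dvd[OF cop1 ll(1)] by blast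
        moreover have "\<not> l dvd Q" using noPQ[OF ll(1)] 1 by (auto simp: P1)
        ultimately have "\<not> l dvd t1" using l_3[OF ll(1,3)] by (simp add: t1_def pd)
        then show ?thesis using dvd_g'[OF ll(1)] 1 by (simp add: s1_def)
      next
        case 2
        then have "\<not> l dvd P1" using coprime_prime_not_dvd[OF cop1 ll(1)] by blast
        moreover have "\<not> l dvd X"
        proof
          assume "l dvd X"
          with 2 have "l dvd M" "l dvd y" unfolding M(1) y1 by (simp_all add: power2_eq_square)
          then show False using noMy[OF ll(1)] by blast
        qed
        ultimately have "\<not> l dvd s1" by (simp add: s1_def pd)
        then show ?thesis using dvd_g[OF ll(1)] 2 by (simp add: t1_def)
      next
        case 3
        from l[OF ll(1) 3(3) ll(3)] show ?thesis
        proof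
          assume "\<not> l dvd P * X \<and> l dvd Q * y"
          then have "\<not> l dvd s1" "l dvd t1" using 3(2) by (auto simp: s1_def t1_def P1 y1 pd)
          then show ?thesis using dvd_g[OF ll(1)] by simp
        next
          assume "l dvd P * X \<and> \<not> l dvd Q * y"
          then have "\<not> l dvd t1" "l dvd s1" using l_3[OF ll(1,3)] by (auto simp: s1_def t1_def P1 y1 pd)
          then show ?thesis using dvd_g'[OF ll(1)] by simp
        qed
      qed
      then show ?thesis by auto
    qed
    \<comment> \<open>One factor 3 is explicit in t1 = 3 Q y1; if 3 divides k, a second one lies in
      y1 or in Q.\<close>
    show "9 dvd t" if "3 dvd P1\<^sup>2 * r * w\<^sup>2 * y1"
    proof -
      have "\<not> 3 dvd P1" using PQ(2) P1 by auto
      with that have "3 dvd y1 \<or> 3 dvd r * w"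
        by (auto simp: prime_dvd_mult_iff prime_dvd_power_iff)
      then have "3 dvd Q * y1" using l3 by auto
      then have "3 * 3 dvd 3 * (Q * y1)" by (rule mult_dvd_mono[OF dvd_refl])
      then show ?thesis using t9 by (simp add: t1_def mult.assoc)
    qed
  qed
  moreover have "eis_quad (P * X) (3 * Q * y) = of_int (d * g) * eis_quad s t"
  proof -
    have "d * g * s = P * X" "d * g * t = 3 * Q * y"
      unfolding mult.assoc s[symmetric] t[symmetric] by (simp_all add: P1 y1 s1_def t1_def)
    then show ?thesis unfolding eis_quad_mult_of_int by simp
  qed
  \<comment> \<open>A prime of M does not divide y, hence not d. If it divided g, it would divide Q
    and X, then E and W, although M is prime to W.\<close>
  moreover have "csym (of_int (d * g)) (of_int M) = 1"
  proof (intro csym_of_int_of_int M(2) coprime_imp_eis_coprime int_coprimeI)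
    fix l assume ll: "prime l" "l dvd d * g" "l dvd M"
    have "\<not> l dvd y" using noMy[OF ll(1,3)] by blast
    then have "\<not> l dvd d" "\<not> l dvd y1" by (auto simp: y1)
    then have "l dvd s1" "l dvd t1" using ll(1,2) s t by (auto simp: prime_dvd_mult_iff)
    then have Q: "l dvd Q" and PX: "l dvd P1 \<or> l dvd X"
      using l_3[OF ll(1) noM3[OF ll(3)]] \<open>\<not> l dvd y1\<close> ll(1) by (auto simp: s1_def t1_def prime_dvd_mult_iff)
    then have "\<not> l dvd P" using noPQ[OF ll(1)] by blast
    then have "l dvd X" using PX by (auto simp: P1)
    then have "l dvd 27 * E * y\<^sup>2" using ll(3) unfolding M(1) by (simp add: dvd_add_right_iff power2_eq_square)
    moreover have "\<not> l dvd 27" using l_27[OF ll(1) noM3[OF ll(3)]] .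
    ultimately have "l dvd E" using \<open>\<not> l dvd y\<close> ll(1) by (simp add: prime_dvd_mult_iff prime_dvd_power_iff)
    with Q have "l dvd W" by (simp add: W(1) power2_eq_square)
    then show False using noMW[OF ll(1,3)] by blast
  next
    show "M \<noteq> 0" using M(2) by auto
  qed
  moreover have "\<not> 3 dvd eis_norm (of_int M)" using M(2) unfolding not_3_dvd_eis_norm_of_int_iff .
  ultimately show ?thesis by (simp add: csym_mult_left del: of_int_mult)
qed

section \<open>Elements of cubic norm\<close>

lemma quad_coordinates_unique:
  fixes D A B A' B' :: int
  assumes "D > 1" "squarefree D"
    and "of_int A + of_int B * sqrt (of_int D) = of_int A' + of_int B' * sqrt (of_int D)"
  shows "A = A' \<and> B = B'"
proof -
  have e: "of_int (A - A') = of_int (B' - B) * sqrt (of_int D)"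
    using assms(3) by (simp add: algebra_simps)
  have "(of_int ((A - A')\<^sup>2) :: real) = (of_int (A - A'))\<^sup>2" by simp
  also have "\<dots> = of_int ((B' - B)\<^sup>2 * D)"
    unfolding e using assms(1) by (simp add: power_mult_distrib)
  finally have sq: "(A - A')\<^sup>2 = (B' - B)\<^sup>2 * D" by (simp only: of_int_eq_iff)
  have "B = B'"
  proof (rule ccontr)
    assume "B \<noteq> B'"
    have "(B' - B)\<^sup>2 dvd (A - A')\<^sup>2" by (simp add: sq)
    then have "B' - B dvd A - A'" by simp
    then obtain q where q: "A - A' = (B' - B) * q" by (elim dvdE)
    have "q\<^sup>2 = D" using sq \<open>B \<noteq> B'\<close> by (simp add: q power_mult_distrib)
    then have "q\<^sup>2 dvd D" by simp
    then have "is_unit q" using assms(2) unfolding squarefree_def by blast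
    then have "q\<^sup>2 = 1" by (simp add: abs_square_eq_1)
    with \<open>q\<^sup>2 = D\<close> assms(1) show False by simp
  qed
  with sq show ?thesis by simp
qed

lemma squarefree_dvd_int:
  fixes m x :: int
  assumes "squarefree m" "\<And>l. prime l \<Longrightarrow> l dvd m \<Longrightarrow> l dvd x"
  shows "m dvd x"
  using assms
proof (induction m arbitrary: x rule: prime_divisors_induct)
  case (factor l m)
  have l0: "l \<noteq> 0" using factor.hyps by auto
  have "l dvd x" using factor.prems(2) factor.hyps by simp
  then obtain x' where x': "x = l * x'" by (elim dvdE)
  have lm: "\<not> l dvd m"
  proof
    assume "l dvd m"
    then have "l\<^sup>2 dvd l * m" by (simp add: power2_eq_square)
    then show False using factor.prems(1) factor.hyps not_prime_unit unfolding squarefree_def by blast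
  qed
  have "m dvd x'"
  proof (rule factor.IH)
    show "squarefree m" using factor.prems(1) by (rule squarefree_mono[rotated]) simp
    fix l' assume l': "prime l'" "l' dvd m"
    then have "l' dvd l * x'" using factor.prems(2)[of l'] by (simp add: x')
    moreover have "\<not> l' dvd l"
      using l' lm factor.hyps primes_dvd_imp_eq[of l' l] by auto
    ultimately show "l' dvd x'" using l'(1) by (simp add: prime_dvd_mult_iff)
  qed
  then show ?case by (simp add: x')
next
  case (unit m)
  then show ?case by (simp only: unit_imp_dvd)
qed auto

text \<open>Carries local information through the cancellation of a gcd: \<open>k\<close> will be
  the power of one prime that visibly divides both entries, and \<open>h'\<close> the rest of the
  gcd.\<close>

lemma gcd_quotients_common_factor:
  fixes k x y :: int
  assumes "k * x = h * P" "k * y = h * Q" "k dvd h" "k \<noteq> 0"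
  obtains h' where "h = k * h'" "x = h' * P" "y = h' * Q"
proof -
  obtain h' where h': "h = k * h'" using assms(3) by (elim dvdE)
  show thesis
    by (rule that[OF h']) (use assms(1,2,4) in \<open>simp_all add: h' mult.assoc\<close>)
qed

lemma C_of_props:
  assumes "gcd A B \<noteq> 0"
  shows C_of_dvd: "C_of D A B dvd gcd A B"
    and prime_dvd_C_of_iff: "prime l \<Longrightarrow> l dvd C_of D A B \<longleftrightarrow> odd l \<and> l dvd gcd A B \<and> \<not> l dvd D"
    and squarefree_C_of: "squarefree (C_of D A B)"
proof -
  define T where "T = {p :: int. prime p \<and> odd p \<and> p dvd gcd A B \<and> \<not> p dvd D}"
  have T: "finite T"
    by (rule finite_subset[OF _ finite_divisors_int[OF assms]]) (auto simp: T_def)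
  have C: "C_of D A B = \<Prod>T" by (simp add: C_of_def T_def)
  have pr: "prime p" if "p \<in> T" for p using that by (simp add: T_def)
  have dvd_iff: "l dvd \<Prod>T' \<longleftrightarrow> l \<in> T'" if "prime l" "T' \<subseteq> T" for l T'
  proof -
    have "finite T'" using T that(2) finite_subset by blast
    then have "l dvd \<Prod>T' \<longleftrightarrow> (\<exists>p\<in>T'. l dvd p)" using that(1) prime_dvd_prod_iff[of T' l "\<lambda>x. x"] by simp
    also have "\<dots> \<longleftrightarrow> l \<in> T'"
    proof
      assume "\<exists>p\<in>T'. l dvd p"
      then obtain p where "p \<in> T'" "l dvd p" by blast
      then show "l \<in> T'" using that(2) pr primes_dvd_imp_eq[OF that(1), of p] by auto
    qed (auto intro: bexI[of _ l])
    finally show ?thesis .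
  qed
  show iff: "l dvd C_of D A B \<longleftrightarrow> odd l \<and> l dvd gcd A B \<and> \<not> l dvd D" if "prime l" for l
    unfolding C using dvd_iff[OF that order_refl] that by (simp add: T_def)
  show sq: "squarefree (C_of D A B)"
  proof (rule squarefreeI)
    fix x assume x: "x\<^sup>2 dvd C_of D A B"
    show "is_unit x"
    proof (rule ccontr)
      assume nu: "\<not> is_unit x"
      have "C_of D A B \<noteq> 0" unfolding C using T pr[of 0] by (auto simp: prod_zero_iff)
      then have "x \<noteq> 0" using x by auto
      with nu obtain l where l: "l dvd x" "prime l" using prime_divisor_exists by blast
      have ll: "l * l dvd \<Prod>T" using x l(1) unfolding C[symmetric] power2_eq_square
        by (meson dvd_trans mult_dvd_mono)
      then have "l dvd \<Prod>T" by (rule dvd_mult_left)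
      then have "l \<in> T" using dvd_iff[OF l(2) order_refl] by simp
      then have "\<Prod>T = l * \<Prod>(T - {l})" using T by (rule prod.remove[rotated])
      with ll l(2) have "l dvd \<Prod>(T - {l})" by auto
      then show False using dvd_iff[OF l(2), of "T - {l}"] by auto
    qed
  qed
  show "C_of D A B dvd gcd A B"
    using sq by (rule squarefree_dvd_int) (use iff in blast)
qed

section \<open>Valuations at the common primes of A and B\<close>

locale cube_norm =
  fixes D A B n :: int
  assumes D_squarefree: "squarefree D"
    and norm_cube: "A\<^sup>2 - B\<^sup>2 * D = n ^ 3"
    and cubefree: "\<And>l. prime l \<Longrightarrow> l ^ 3 dvd A \<Longrightarrow> l ^ 3 dvd B \<Longrightarrow> False"
begin

lemma prime_square_not_dvd_D: "prime l \<Longrightarrow> \<not> l * l dvd D"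
  using D_squarefree not_prime_unit unfolding squarefree_def power2_eq_square by blast

text \<open>Since l^3 divides A^2 - B^2 D, and A and B are not both divisible by l^3, little is
  possible: if l does not divide D, A and B have the same valuation, 1 or 2; if it does, B has
  valuation 1 and A at least 2. The proof is a descent that keeps dividing by l.\<close>

lemma common_prime_cases:
  assumes l: "prime l" "l dvd A" "l dvd B"
  obtains (ndvd) e A' B' where "\<not> l dvd D" "e = 0 \<or> e = 1" "A = l ^ e * (l * A')" "B = l ^ e * (l * B')"
      "\<not> l dvd A'" "\<not> l dvd B'"
    | (dvd) A' B' where "l dvd D" "A = l * (l * A')" "B = l * B'" "\<not> l dvd B'"
proof -
  have l0: "l \<noteq> 0" using l(1) by auto
  have cancel: "l * u = l * v \<Longrightarrow> u = v" for u v using l0 by simp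
  have pd: "l dvd u * v \<longleftrightarrow> l dvd u \<or> l dvd v" for u v using prime_dvd_mult_iff[OF l(1)] .
  obtain A1 B1 where A1: "A = l * A1" and B1: "B = l * B1" using l(2,3) by (auto elim!: dvdE)
  have cf: False if "A1 = l * (l * x)" "B1 = l * (l * y)" for x y
    using cubefree[OF l(1)] that by (auto simp: A1 B1 power3_eq_cube)
  have "l dvd n ^ 3" unfolding norm_cube[symmetric] A1 B1 by (simp add: power2_eq_square)
  then have "l dvd n" using l(1) prime_dvd_power by blast
  then obtain n1 where n1: "n = l * n1" by (elim dvdE)
  have "l * (l * (A1 * A1 - B1 * B1 * D)) = l * (l * (l * (n1 * n1 * n1)))"
    using norm_cube unfolding A1 B1 n1 by (simp add: power2_eq_square power3_eq_cube algebra_simps)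
  then have N1: "A1 * A1 - B1 * B1 * D = l * (n1 * n1 * n1)" by (rule cancel[OF cancel])
  show thesis
  proof (cases "l dvd D")
    case True
    then obtain D1 where D1: "D = l * D1" by (elim dvdE)
    have "\<not> l dvd D1" using prime_square_not_dvd_D[OF l(1)] unfolding D1 by simp
    have "A1 * A1 = l * (n1 * n1 * n1 + B1 * B1 * D1)" using N1 unfolding D1 by (simp add: algebra_simps)
    then have "l dvd A1" using pd[of A1 A1] by simp
    then obtain A2 where A2: "A1 = l * A2" by (elim dvdE)
    have "l * (l * (A2 * A2) - B1 * B1 * D1) = l * (n1 * n1 * n1)"
      using N1 unfolding A2 D1 by (simp add: algebra_simps)
    then have N2: "l * (A2 * A2) - B1 * B1 * D1 = n1 * n1 * n1" by (rule cancel)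
    have "\<not> l dvd B1"
    proof
      assume "l dvd B1"
      then obtain B2 where B2: "B1 = l * B2" by (elim dvdE)
      have "l dvd n1 * n1 * n1" unfolding N2[symmetric] B2 by simp
      then obtain n2 where n2: "n1 = l * n2" using pd by (auto elim: dvdE)
      have "l * (A2 * A2) = l * (l * (B2 * B2 * D1 + l * (n2 * n2 * n2)))"
        using N2 unfolding B2 n2 by (simp add: algebra_simps)
      then have "A2 * A2 = l * (B2 * B2 * D1 + l * (n2 * n2 * n2))" by (rule cancel)
      then have "l dvd A2" using pd[of A2 A2] by simp
      then obtain A3 where A3: "A2 = l * A3" by (elim dvdE)
      have "l * (l * (B2 * B2 * D1)) = l * (l * (l * (A3 * A3 - n2 * n2 * n2)))"
        using N2 unfolding A3 B2 n2 by (simp add: algebra_simps)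
      then have "B2 * B2 * D1 = l * (A3 * A3 - n2 * n2 * n2)" by (rule cancel[OF cancel])
      then have "l dvd B2 * B2 * D1" by simp
      then have "l dvd B2" using pd \<open>\<not> l dvd D1\<close> by auto
      then obtain B3 where "B2 = l * B3" by (elim dvdE)
      then show False using cf[of A3 B3] A2 A3 B2 by simp
    qed
    then show thesis using True A1 A2 B1 by (intro dvd) auto
  next
    case False
    have iff: "l dvd x \<longleftrightarrow> l dvd y" if "l dvd x * x - y * y * D" for x y
    proof -
      have "l dvd x * x \<longleftrightarrow> l dvd y * y * D"
        using dvd_add_right_iff[OF that, of "y * y * D"] by simp
      then show ?thesis using False pd by auto
    qed
    show thesis
    proof (cases "l dvd A1")
      case True
      moreover have "l dvd B1" using iff[of A1 B1] True by (simp add: N1)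
      ultimately obtain A2 B2 where A2: "A1 = l * A2" and B2: "B1 = l * B2" by (auto elim!: dvdE)
      have "l * (l * (A2 * A2 - B2 * B2 * D)) = l * (n1 * n1 * n1)"
        using N1 unfolding A2 B2 by (simp add: algebra_simps)
      then have N2: "l * (A2 * A2 - B2 * B2 * D) = n1 * n1 * n1" by (rule cancel)
      have "l dvd n1 * n1 * n1" unfolding N2[symmetric] by simp
      then obtain n2 where n2: "n1 = l * n2" using pd by (auto elim: dvdE)
      have "l * (A2 * A2 - B2 * B2 * D) = l * (l * (l * (n2 * n2 * n2)))"
        using N2 unfolding n2 by (simp add: algebra_simps)
      then have "A2 * A2 - B2 * B2 * D = l * (l * (n2 * n2 * n2))" by (rule cancel)
      then have "l dvd A2 \<longleftrightarrow> l dvd B2" using iff[of A2 B2] by simp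
      moreover have "\<not> (l dvd A2 \<and> l dvd B2)" using cf A2 B2 by (auto elim!: dvdE)
      ultimately show thesis using False A1 A2 B1 B2 by (intro ndvd[of 1 A2 B2]) auto
    next
      case False
      moreover have "\<not> l dvd B1" using iff[of A1 B1] False by (simp add: N1)
      ultimately show thesis using \<open>\<not> l dvd D\<close> A1 B1 by (intro ndvd[of 0 A1 B1]) auto
    qed
  qed
qed

lemma common_prime_dvd_n: "prime l \<Longrightarrow> l dvd A \<Longrightarrow> l dvd B \<Longrightarrow> l dvd n"
  using prime_dvd_power[of l n 3] unfolding norm_cube[symmetric] power2_eq_square by simp

end

section \<open>The symbol of \<nu> modulo M, directly and after the twist\<close>

locale cube_norm_form = cube_norm +
  fixes C \<beta> X y M :: int
  assumes B_eq: "B = C * \<beta>"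
    and prime_dvd_C_iff: "\<And>l. prime l \<Longrightarrow> l dvd C \<longleftrightarrow> odd l \<and> l dvd A \<and> l dvd B \<and> \<not> l dvd D"
    and C_squarefree: "squarefree C"
    and M_eq: "M = X\<^sup>2 + 27 * (C\<^sup>2 * D) * y\<^sup>2"
    and M_coprime: "\<not> 3 dvd M" "coprime M n" "coprime M D" "coprime M y"
    and y_nonzero: "y \<noteq> 0"
begin

lemma D_nonzero: "D \<noteq> 0"
  using D_squarefree by auto

lemma C_nonzero: "C \<noteq> 0"
  using C_squarefree by auto

lemma A_or_B_nonzero: "A \<noteq> 0 \<or> B \<noteq> 0"
  using cubefree[of 2] by auto

lemma X_not_dvd:
  assumes "prime l" "l dvd D \<or> l dvd C"
  shows "\<not> l dvd X"
proof
  assume "l dvd X"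
  with assms(2) have "l dvd M" unfolding M_eq by (auto simp: power2_eq_square)
  then have "\<not> l dvd D" "\<not> l dvd n"
    using coprime_prime_not_dvd assms(1) M_coprime(2,3) by blast+
  then show False using assms common_prime_dvd_n prime_dvd_C_iff by blast
qed

text \<open>Since 2 does not divide C, the tie between A and B at 2 is not broken. In compensation n
  is even, so M is odd, and M is X + y modulo 2 because C and D are odd.\<close>

lemma even_X_iff:
  assumes "even A" "even B" "odd D"
  shows "even X \<longleftrightarrow> odd y"
proof -
  have "even n" using common_prime_dvd_n[of 2] assms by simp
  then have "odd M" using coprime_prime_not_dvd[of n M 2] M_coprime(2) by (auto simp: coprime_commute)
  moreover have "odd C" using prime_dvd_C_iff[of 2] by simp
  ultimately show ?thesis using assms(3) unfolding M_eq by simp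
qed

text \<open>Squarefreeness of C lowers the valuation of B by exactly one at an odd l not dividing D,
  leaving A one ahead of \<beta>. At 2 and at primes of D nothing is removed.\<close>

lemma common_prime_beta_cases:
  assumes l: "prime l" "l dvd A" "l dvd B"
  obtains (odd) e A' \<beta>' C' where "odd l" "\<not> l dvd D" "A = l ^ e * (l * A')" "\<beta> = l ^ e * \<beta>'" "C = l * C'"
      "\<not> l dvd A'" "\<not> l dvd \<beta>'" "\<not> l dvd C'"
    | (two) e A' \<beta>' where "l = 2" "\<not> l dvd D" "A = l ^ e * A'" "\<beta> = l ^ e * \<beta>'"
      "\<not> l dvd A'" "\<not> l dvd \<beta>'" "\<not> l dvd C"
    | (dvd) A' \<beta>' where "l dvd D" "A = l * (l * A')" "\<beta> = l * \<beta>'" "\<not> l dvd \<beta>'" "\<not> l dvd C"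
  using l
proof (cases rule: common_prime_cases)
  case (ndvd e A' B')
  have l0: "l \<noteq> 0" using l(1) by auto
  show thesis
  proof (cases "odd l")
    case True
    then have "l dvd C" using l ndvd(1) prime_dvd_C_iff by blast
    then obtain C' where C': "C = l * C'" by (elim dvdE)
    have lC': "\<not> l dvd C'"
    proof
      assume "l dvd C'"
      then have "l\<^sup>2 dvd C" unfolding C' by (simp add: power2_eq_square)
      then show False using C_squarefree l(1) not_prime_unit unfolding squarefree_def by blast
    qed
    have e: "l ^ e * B' = C' * \<beta>" using B_eq l0 unfolding ndvd(4) C' by simp
    have "coprime (l ^ e) C'" using prime_imp_coprime[OF l(1) lC'] by simp
    moreover have "l ^ e dvd C' * \<beta>" unfolding e[symmetric] by simp
    ultimately have "l ^ e dvd \<beta>" by (simp add: coprime_dvd_mult_right_iff)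
    then obtain \<beta>' where \<beta>': "\<beta> = l ^ e * \<beta>'" by (elim dvdE)
    have "B' = C' * \<beta>'" using e l0 unfolding \<beta>' by simp
    then have "\<not> l dvd \<beta>'" using ndvd(6) by auto
    with True ndvd(1,3,5) \<beta>' C' lC' show thesis by (intro odd)
  next
    case False
    then have l2: "l = 2" using l(1) primes_dvd_imp_eq[of 2 l] by auto
    then have lC: "\<not> l dvd C" using prime_dvd_C_iff[of 2] by simp
    have e: "l ^ Suc e * B' = C * \<beta>" using B_eq unfolding ndvd(4) by (simp add: ac_simps)
    have "coprime (l ^ Suc e) C" using prime_imp_coprime[OF l(1) lC] by simp
    moreover have "l ^ Suc e dvd C * \<beta>" unfolding e[symmetric] by simp
    ultimately have "l ^ Suc e dvd \<beta>" by (simp only: coprime_dvd_mult_right_iff)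
    then obtain \<beta>' where \<beta>': "\<beta> = l ^ Suc e * \<beta>'" by (elim dvdE)
    have "B' = C * \<beta>'" using e l0 unfolding \<beta>' by simp
    then have "\<not> l dvd \<beta>'" using ndvd(6) by auto
    moreover have "A = l ^ Suc e * A'" using ndvd(3) by (simp add: ac_simps)
    ultimately show thesis using l2 ndvd(1,5) \<beta>' lC by (intro two)
  qed
next
  case (dvd A' B')
  have l0: "l \<noteq> 0" using l(1) by auto
  have lC: "\<not> l dvd C" using dvd(1) l prime_dvd_C_iff by blast
  have e: "l * B' = C * \<beta>" using B_eq unfolding dvd(3) .
  have "l dvd C * \<beta>" unfolding e[symmetric] by simp
  then have "l dvd \<beta>" using lC l(1) by (simp add: prime_dvd_mult_iff)
  then obtain \<beta>' where \<beta>': "\<beta> = l * \<beta>'" by (elim dvdE)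
  have "B' = C * \<beta>'" using e l0 unfolding \<beta>' by simp
  then have "\<not> l dvd \<beta>'" using dvd(4) by auto
  with dvd(1,2) \<beta>' lC show thesis by (intro that(3))
qed

lemma M_coprime_common:
  assumes "\<And>l. prime l \<Longrightarrow> l dvd h \<Longrightarrow> l dvd M \<Longrightarrow> l dvd A \<and> l dvd B"
  shows "csym (of_int h) (of_int M) = 1"
proof (intro csym_of_int_of_int coprime_imp_eis_coprime int_coprimeI M_coprime(1))
  fix l assume "prime l" "l dvd h" "l dvd M"
  then show False
    using assms common_prime_dvd_n coprime_prime_not_dvd[OF M_coprime(2)] by blast
next
  show "M \<noteq> 0" using M_coprime(1) by auto
qed

text \<open>Divides \<nu> by h = gcd(\<beta>, A); then h^2 W = n^3, so r = h^2 and w = 1. The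
  hypothesis ensures that 3 does not divide P, as a primary element requires.\<close>

lemma csym_nu_direct:
  assumes "3 dvd A \<or> \<not> 3 dvd \<beta>"
  shows "csym (eis_quad (\<beta> * X) (3 * A * y)) (of_int M) = 1"
proof -
  define h where "h = gcd \<beta> A"
  have "h \<noteq> 0" using A_or_B_nonzero unfolding h_def B_eq by auto
  then obtain P Q where P: "\<beta> = h * P" and Q: "A = h * Q" and cop: "coprime P Q"
    using gcd_coprime_exists[of \<beta> A] unfolding h_def by (metis mult.commute)
  \<comment> \<open>Either way exactly one of P X and Q y is divisible by l: in the exceptional case
    l = 2 this rests on the opposite parity of X and y.\<close>
  have loc: "\<not> l dvd P \<and> l dvd Q \<and> \<not> l dvd X \<or> l = 2 \<and> odd P \<and> odd Q \<and> (even X \<longleftrightarrow> odd y)"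
    if l: "prime l" "l dvd A" "l dvd \<beta> \<or> l dvd C" for l
  proof -
    have lB: "l dvd B" using l(3) unfolding B_eq by auto
    have l0: "l \<noteq> 0" using l(1) by auto
    note pd = prime_dvd_mult_iff[OF l(1)]
    from l(1,2) lB show ?thesis
    proof (cases rule: common_prime_beta_cases)
      case (odd e A' \<beta>' C')
      obtain h' where h': "h = l ^ e * h'" "\<beta>' = h' * P" "l * A' = h' * Q"
      proof (rule gcd_quotients_common_factor[OF trans[OF odd(4)[symmetric] P] trans[OF odd(3)[symmetric] Q]])
        show "l ^ e dvd h" unfolding h_def by (rule gcd_greatest) (simp_all add: odd(3,4))
      qed (use l0 in auto)
      have "\<not> l dvd h'" "\<not> l dvd P" using odd(7) unfolding h'(2) by auto
      moreover have "l dvd h' * Q" unfolding h'(3)[symmetric] by simp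
      moreover have "\<not> l dvd X" using odd(5) by (intro X_not_dvd l(1)) simp
      ultimately show ?thesis using pd by auto
    next
      case (two e A' \<beta>')
      obtain h' where h': "h = l ^ e * h'" "\<beta>' = h' * P" "A' = h' * Q"
      proof (rule gcd_quotients_common_factor[OF trans[OF two(4)[symmetric] P] trans[OF two(3)[symmetric] Q]])
        show "l ^ e dvd h" unfolding h_def by (rule gcd_greatest) (simp_all add: two(3,4))
      qed (use l0 in auto)
      have "\<not> l dvd P" "\<not> l dvd Q" using two(5,6) unfolding h' by auto
      then show ?thesis using even_X_iff l(2) lB two(1,2) by auto
    next
      case (dvd A' \<beta>')
      obtain h' where h': "h = l * h'" "\<beta>' = h' * P" "l * A' = h' * Q"
      proof (rule gcd_quotients_common_factor[OF trans[OF dvd(3)[symmetric] P] trans[OF dvd(2)[symmetric] Q]])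
        show "l dvd h" unfolding h_def by (rule gcd_greatest) (simp_all add: dvd(2,3))
      qed (use l0 in auto)
      have "\<not> l dvd h'" "\<not> l dvd P" using dvd(4) unfolding h'(2) by auto
      moreover have "l dvd h' * Q" unfolding h'(3)[symmetric] by simp
      moreover have "\<not> l dvd X" using dvd(1) by (intro X_not_dvd l(1)) simp
      ultimately show ?thesis using pd by auto
    qed
  qed
  define W where "W = Q\<^sup>2 - P\<^sup>2 * (C\<^sup>2 * D)"
  have hW: "h\<^sup>2 * W = n ^ 3"
  proof -
    have "h\<^sup>2 * W = A\<^sup>2 - B\<^sup>2 * D"
      unfolding W_def B_eq P Q by (simp add: power2_eq_square algebra_simps)
    then show ?thesis by (simp only: norm_cube)
  qed
  have "csym (eis_quad (P * X) (3 * Q * y)) (of_int M) = 1"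
  proof (rule csym_quad_form_eq_1[OF M_eq M_coprime(1,4) y_nonzero cop _ W_def, where r = "h\<^sup>2" and w = 1 and z = n])
    show "\<not> 3 dvd P"
    proof
      assume *: "3 dvd P"
      then have "3 dvd \<beta>" unfolding P by simp
      then show False using assms loc[of 3] * by simp
    qed
    show "coprime M W"
    proof (rule coprime_divisors[OF dvd_refl])
      show "W dvd n ^ 3" unfolding hW[symmetric] by simp
      show "coprime M (n ^ 3)" using M_coprime(2) by simp
    qed
    show "h\<^sup>2 * W = 1 * n ^ 3" using hW by simp
    show "h\<^sup>2 * 1 \<noteq> 0" using \<open>h \<noteq> 0\<close> by simp
    show "\<not> l dvd P * X \<and> l dvd Q * y \<or> l dvd P * X \<and> \<not> l dvd Q * y"
      if "prime l" "l dvd h\<^sup>2 * 1" for l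
    proof -
      have "l dvd h" using that prime_dvd_power[of l h 2] by simp
      then have "l dvd A" "l dvd \<beta>" by (simp_all add: h_def)
      with loc[OF that(1)] that(1) show ?thesis by (auto simp: prime_dvd_mult_iff)
    qed
    show "3 dvd Q" if "3 dvd h\<^sup>2 * 1"
    proof -
      have "3 dvd h" using that prime_dvd_power[of 3 h 2] by simp
      then have "3 dvd A" "3 dvd \<beta>" by (simp_all add: h_def)
      with loc[of 3] show ?thesis by simp
    qed
  qed
  moreover have "eis_quad (\<beta> * X) (3 * A * y) = of_int h * eis_quad (P * X) (3 * Q * y)"
    unfolding eis_quad_mult_of_int by (simp add: P Q mult_ac)
  moreover have "csym (of_int h) (of_int M) = 1"
    by (rule M_coprime_common) (auto simp: h_def B_eq)
  moreover have "\<not> 3 dvd eis_norm (of_int M)" using M_coprime(1) unfolding not_3_dvd_eis_norm_of_int_iff .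
  ultimately show ?thesis by (simp add: csym_mult_left)
qed

lemma prime_dvd_A_D:
  assumes l: "prime l" "l dvd A" "l dvd D"
  shows "l dvd B"
proof -
  have l0: "l \<noteq> 0" using l(1) by auto
  obtain A1 D1 where A1: "A = l * A1" and D1: "D = l * D1" using l(2,3) by (auto elim!: dvdE)
  have "l dvd n ^ 3" unfolding norm_cube[symmetric] A1 D1 by (simp add: power2_eq_square)
  then have "l dvd n" using l(1) prime_dvd_power by blast
  then obtain n1 where n1: "n = l * n1" by (elim dvdE)
  have "l * (B * B * D1) = l * (l * (A1 * A1 - l * (n1 * n1 * n1)))"
    using norm_cube unfolding A1 D1 n1 by (simp add: power2_eq_square power3_eq_cube algebra_simps)
  then have "B * B * D1 = l * (A1 * A1 - l * (n1 * n1 * n1))" using l0 by simp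
  then have "l dvd B * B * D1" by simp
  moreover have "\<not> l dvd D1" using prime_square_not_dvd_D[OF l(1)] unfolding D1 by simp
  ultimately show ?thesis using l(1) by (auto simp: prime_dvd_mult_iff)
qed

text \<open>Multiplying $A + B\sqrt D$ by $\sqrt D$, which is a cube up to a rational factor, does not
  change the symbol and exchanges the roles of \<open>A\<close> and \<open>B\<close>. This version works when \<open>3\<close>
  divides \<open>\<beta>\<close> but not \<open>A\<close>, where the direct one would not be primary.\<close>

lemma csym_nu_twisted:
  assumes "\<not> 3 dvd A"
  shows "csym (eis_quad (A * X) (3 * (B * C * D) * y)) (of_int M) = 1"
proof -
  have A0: "A \<noteq> 0" using assms by auto
  \<comment> \<open>A prime of both D and A divides A at least twice and B exactly once, so its
    square divides both A and B C D. Removing D0^2 leaves D' = D / D0 and n' = n / D0.\<close>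
  define D0 where "D0 = gcd D A"
  have D00: "D0 \<noteq> 0" using A0 by (simp add: D0_def)
  have D0_sqf: "squarefree D0" using D_squarefree by (rule squarefree_mono[rotated]) (simp add: D0_def)
  have D0_sq: "\<not> l * l dvd D0" if "prime l" for l
    using prime_square_not_dvd_D[OF that] unfolding D0_def by (meson dvd_trans gcd_dvd1)
  obtain D' where D': "D = D0 * D'" unfolding D0_def by (meson dvdE gcd_dvd1)
  have D0_lB: "l dvd B" if "prime l" "l dvd D0" for l
    using that prime_dvd_A_D[of l] by (simp add: D0_def)
  have D0_B: "D0 dvd B" using D0_sqf D0_lB by (rule squarefree_dvd_int)
  have D0_n: "D0 dvd n"
    using D0_sqf by (rule squarefree_dvd_int) (use D0_lB common_prime_dvd_n in \<open>auto simp: D0_def\<close>)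
  obtain n' where n': "n = D0 * n'" using D0_n by (elim dvdE)
  obtain B1 where B1: "B = D0 * B1" using D0_B by (elim dvdE)
  obtain A1 where A1: "A = D0 * A1" unfolding D0_def by (meson dvdE gcd_dvd2)
  have "D0 dvd A1"
    using D0_sqf
  proof (rule squarefree_dvd_int)
    fix l assume l: "prime l" "l dvd D0"
    then have lA: "l dvd A" "l dvd D" "l dvd B" using D0_lB by (auto simp: D0_def)
    have "l * l dvd A" using l(1) lA(1,3)
    proof (cases rule: common_prime_cases)
      case (dvd A' B')
      then show ?thesis by simp
    qed (use lA in simp)
    obtain D1 where D1: "D0 = l * D1" using l(2) by (elim dvdE)
    have "\<not> l dvd D1" using D0_sq[OF l(1)] unfolding D1 by simp
    moreover have "l dvd D1 * A1" using \<open>l * l dvd A\<close> l(1) unfolding A1 D1 by (auto simp: mult.assoc)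
    ultimately show "l dvd A1" using l(1) by (simp add: prime_dvd_mult_iff)
  qed
  then obtain A2 where A2: "A = D0 * D0 * A2" unfolding A1 by (auto elim: dvdE)
  define R where "R = B1 * C * D'"
  have BCD: "B * C * D = D0 * D0 * R" unfolding R_def B1 D' by (simp only: mult_ac)
  define h where "h = gcd A2 R"
  have h0: "h \<noteq> 0" using A0 unfolding h_def A2 by auto
  obtain P Q where P: "A2 = h * P" and Q: "R = h * Q" and cop: "coprime P Q"
    using gcd_coprime_exists[of A2 R] h0 unfolding h_def by (metis mult.commute)
  have P': "A = D0 * D0 * h * P" unfolding A2 P by (simp only: mult_ac)
  have Q': "B * C * D = D0 * D0 * h * Q" unfolding BCD Q by (simp only: mult_ac)
  have gcd_eq: "\<bar>D0 * D0 * h\<bar> = gcd A (B * C * D)"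
    unfolding h_def A2 BCD gcd_mult_left by (simp add: abs_mult)
  define W where "W = Q\<^sup>2 - P\<^sup>2 * (C\<^sup>2 * D)"
  \<comment> \<open>The norm of u sqrt(C^2 D) is -C^2 D n^3. Cancelling D0^2 h in both coordinates
    divides it by D0^4 h^2, and D n^3 = D0^4 D' n'^3.\<close>
  have hW: "h\<^sup>2 * W = C\<^sup>2 * D' * (- n') ^ 3"
  proof -
    have "D0 ^ 4 * (h\<^sup>2 * W) = (D0 * D0 * h * Q)\<^sup>2 - (D0 * D0 * h * P)\<^sup>2 * (C\<^sup>2 * D)"
      unfolding W_def by (simp add: power2_eq_square power4_eq_xxxx algebra_simps)
    also have "\<dots> = - (C\<^sup>2 * D * (A\<^sup>2 - B\<^sup>2 * D))"
      unfolding P'[symmetric] Q'[symmetric] by (simp add: power2_eq_square algebra_simps)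
    also have "\<dots> = D0 ^ 4 * (C\<^sup>2 * D' * (- n') ^ 3)"
      unfolding norm_cube unfolding n' D' by (simp add: power2_eq_square power3_eq_cube power4_eq_xxxx)
    finally have "D0 ^ 4 * (h\<^sup>2 * W) = D0 ^ 4 * (C\<^sup>2 * D' * (- n') ^ 3)" .
    moreover have "D0 ^ 4 \<noteq> 0" using D00 by simp
    ultimately show ?thesis using mult_left_cancel by blast
  qed
  have C_A: "l dvd A \<and> l dvd B \<and> \<not> l dvd D \<and> odd l" if "prime l" "l dvd C" for l
    using that prime_dvd_C_iff by blast
  \<comment> \<open>The dichotomy of the direct version, here also for the primes of C and D', which
    enter through w.\<close>
  have loc: "\<not> l dvd P \<and> l dvd Q \<and> \<not> l dvd X \<or> l = 2 \<and> odd P \<and> odd Q \<and> (even X \<longleftrightarrow> odd y)"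
    if l: "prime l" "l dvd h \<or> l dvd C \<or> l dvd D'" for l
  proof -
    have l0: "l \<noteq> 0" using l(1) by auto
    note pd = prime_dvd_mult_iff[OF l(1)]
    show ?thesis
    proof (cases "l dvd A \<and> l dvd B")
      case True
      with l(1) have "prime l" "l dvd A" "l dvd B" by auto
      then show ?thesis
      proof (cases rule: common_prime_beta_cases)
        case (odd e A' \<beta>' C')
        have "\<not> l dvd D0" using odd(2) by (auto simp: D0_def)
        have e: "A = l ^ e * (l * A')" "B * C * D = l ^ e * (l * (l * (C' * \<beta>' * C' * D)))"
          unfolding B_eq odd(3-5) by (simp_all only: mult_ac)
        obtain h' where h': "A' = h' * P" "l * (C' * \<beta>' * C' * D) = h' * Q"
        proof (rule gcd_quotients_common_factor[of "l ^ e * l" "A'" "D0 * D0 * h" P "l * (C' * \<beta>' * C' * D)" Q])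
          show "l ^ e * l * A' = D0 * D0 * h * P" using P' e(1) by (simp only: mult_ac)
          show "l ^ e * l * (l * (C' * \<beta>' * C' * D)) = D0 * D0 * h * Q" using Q' e(2) by (simp only: mult_ac)
          have "l ^ e * l dvd gcd A (B * C * D)" unfolding e by (rule gcd_greatest) (simp_all add: mult.assoc)
          then show "l ^ e * l dvd D0 * D0 * h" unfolding gcd_eq[symmetric] by (simp only: dvd_abs_iff)
        qed (use l0 in auto)
        have "\<not> l dvd h'" "\<not> l dvd P" using odd(6) unfolding h'(1) by auto
        moreover have "l dvd h' * Q" unfolding h'(2)[symmetric] by simp
        moreover have "\<not> l dvd X" using odd(5) by (intro X_not_dvd l(1)) simp
        ultimately show ?thesis using pd by auto
      next
        case (two e A' \<beta>')
        have e: "A = l ^ e * A'" "B * C * D = l ^ e * (C * \<beta>' * C * D)"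
          unfolding B_eq two(3,4) by (simp_all only: mult_ac)
        obtain h' where h': "A' = h' * P" "C * \<beta>' * C * D = h' * Q"
        proof (rule gcd_quotients_common_factor[of "l ^ e" "A'" "D0 * D0 * h" P "C * \<beta>' * C * D" Q])
          show "l ^ e * A' = D0 * D0 * h * P" using P' e(1) by (simp only: mult_ac)
          show "l ^ e * (C * \<beta>' * C * D) = D0 * D0 * h * Q" using Q' e(2) by (simp only: mult_ac)
          have "l ^ e dvd gcd A (B * C * D)" unfolding e by (rule gcd_greatest) (simp_all add: mult.assoc)
          then show "l ^ e dvd D0 * D0 * h" unfolding gcd_eq[symmetric] by (simp only: dvd_abs_iff)
        qed (use l0 in auto)
        have "\<not> l dvd C * \<beta>' * C * D" using two by (simp add: pd)
        then have "\<not> l dvd P" "\<not> l dvd Q" using two(5) unfolding h' by auto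
        then show ?thesis using even_X_iff True two(1,2) by auto
      next
        \<comment> \<open>This case is void. Here l divides D0, hence not D', so it divides h and
          B1, and B is divisible by l^2; but B = l C \<beta>' with neither C nor \<beta>' divisible
          by l.\<close>
        case (dvd A' \<beta>')
        have "l dvd D0" using dvd(1) True by (simp add: D0_def)
        then obtain D1 where D1: "D0 = l * D1" by (elim dvdE)
        have "\<not> l dvd D'" using prime_square_not_dvd_D[OF l(1)] unfolding D' D1 by (auto simp: mult.assoc)
        then have "l dvd h" using l(2) dvd(5) by blast
        then have "l dvd R" by (simp add: h_def)
        then have "l dvd B1" using dvd(5) \<open>\<not> l dvd D'\<close> pd by (auto simp: R_def)
        then have "l * l dvd B" unfolding B1 D1 by (auto elim!: dvdE)
        moreover have "B = l * (C * \<beta>')" unfolding B_eq dvd(3) by (simp only: mult_ac)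
        ultimately have "l dvd C * \<beta>'" using l0 by simp
        then show ?thesis using dvd(4,5) pd by auto
      qed
    next
      case False
      have "\<not> l dvd C" using C_A[OF l(1)] False by blast
      have D0': "\<not> l dvd D0" using False D0_lB[OF l(1)] by (auto simp: D0_def)
      have lD': "l dvd D'"
      proof (rule ccontr)
        assume "\<not> l dvd D'"
        with \<open>\<not> l dvd C\<close> l(2) have "l dvd A2" "l dvd R" by (auto simp: h_def)
        then have "l dvd A" "l dvd B1" using \<open>\<not> l dvd C\<close> \<open>\<not> l dvd D'\<close> pd by (auto simp: A2 R_def)
        then show False using False by (auto simp: B1)
      qed
      then have lD: "l dvd D" by (simp add: D')
      have "\<not> l dvd A" using D0' lD by (auto simp: D0_def)
      then have "\<not> l dvd h" "\<not> l dvd P" by (auto simp: P')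
      moreover have "l dvd h * Q" unfolding Q[symmetric] R_def using lD' by simp
      moreover have "\<not> l dvd X" using lD by (intro X_not_dvd l(1)) simp
      ultimately show ?thesis using pd by auto
    qed
  qed
  have "csym (eis_quad (P * X) (3 * Q * y)) (of_int M) = 1"
  proof (rule csym_quad_form_eq_1[OF M_eq M_coprime(1,4) y_nonzero cop _ W_def,
        where r = "h\<^sup>2" and w = "C\<^sup>2 * D'" and z = "- n'"])
    show "\<not> 3 dvd P" using assms by (auto simp: P')
    show "coprime M W"
    proof (rule int_coprimeI)
      fix l assume l: "prime l" "l dvd M" "l dvd W"
      have nD: "\<not> l dvd n" "\<not> l dvd D" using coprime_prime_not_dvd[OF _ l(1,2)] M_coprime(2,3) by auto
      have "l dvd C\<^sup>2 * D' * (- n') ^ 3" unfolding hW[symmetric] using l(3) by simp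
      then have "l dvd C \<or> l dvd D' \<or> l dvd n'"
        using l(1) by (auto simp: prime_dvd_mult_iff prime_dvd_power_iff)
      then have "l dvd C" using nD by (auto simp: n' D')
      then show False using C_A[OF l(1)] common_prime_dvd_n[OF l(1)] nD by blast
    qed
    show "h\<^sup>2 * W = C\<^sup>2 * D' * (- n') ^ 3" by (rule hW)
    show "h\<^sup>2 * (C\<^sup>2 * D') \<noteq> 0" using h0 C_nonzero D_nonzero by (simp add: D')
    have dvd3: "l dvd h \<or> l dvd C \<or> l dvd D'" if "prime l" "l dvd h\<^sup>2 * (C\<^sup>2 * D')" for l
      using that by (auto simp: prime_dvd_mult_iff prime_dvd_power_iff)
    show "\<not> l dvd P * X \<and> l dvd Q * y \<or> l dvd P * X \<and> \<not> l dvd Q * y"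
      if "prime l" "l dvd h\<^sup>2 * (C\<^sup>2 * D')" for l
      using loc[OF that(1) dvd3[OF that]] that(1) by (auto simp: prime_dvd_mult_iff)
    show "3 dvd Q" if "3 dvd h\<^sup>2 * (C\<^sup>2 * D')"
      using loc[of 3] dvd3[OF _ that] by simp
  qed
  moreover have "eis_quad (A * X) (3 * (B * C * D) * y) = of_int (D0 * D0 * h) * eis_quad (P * X) (3 * Q * y)"
    unfolding eis_quad_mult_of_int Q' unfolding P' by (simp only: mult_ac)
  moreover have "csym (of_int (D0 * D0 * h)) (of_int M) = 1"
  proof (rule M_coprime_common)
    fix l assume l: "prime l" "l dvd D0 * D0 * h" "l dvd M"
    have "l dvd A" using l(2) unfolding P' by (rule dvd_mult2)
    have "\<not> l dvd D" using coprime_prime_not_dvd[OF M_coprime(3) l(1,3)] .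
    have "l dvd B * C * D" using l(2) unfolding Q' by (rule dvd_mult2)
    then have "l dvd B" using \<open>\<not> l dvd D\<close> l(1) C_A[OF l(1)] by (auto simp: prime_dvd_mult_iff)
    with \<open>l dvd A\<close> show "l dvd A \<and> l dvd B" by simp
  qed
  moreover have "\<not> 3 dvd eis_norm (of_int M)" using M_coprime(1) unfolding not_3_dvd_eis_norm_of_int_iff .
  ultimately show ?thesis by (simp add: csym_mult_left del: of_int_mult)
qed

lemma csym_nu: "csym (eis_quad (\<beta> * X) (3 * A * y)) (of_int M) = 1"
proof (cases "3 dvd A \<or> \<not> 3 dvd \<beta>")
  case True
  then show ?thesis by (rule csym_nu_direct)
next
  case False
  let ?\<nu> = "eis_quad (\<beta> * X) (3 * A * y)" and ?\<nu>' = "eis_quad (A * X) (3 * (B * C * D) * y)"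
  have M3: "\<not> 3 dvd eis_norm (of_int M)" using M_coprime(1) unfolding not_3_dvd_eis_norm_of_int_iff .
  have M0: "M \<noteq> 0" using M_coprime(1) by auto
  have c3y: "csym (of_int (- 3 * y)) (of_int M) = 1"
  proof (intro csym_of_int_of_int M_coprime(1) coprime_imp_eis_coprime M0)
    show "coprime (- 3 * y) M"
      using M_coprime(1,4) prime_imp_coprime[of 3 M] by (simp add: coprime_commute)
  qed
  have cX: "csym (of_int X) (of_int M) = 1"
  proof (intro csym_of_int_of_int M_coprime(1) coprime_imp_eis_coprime M0 int_coprimeI)
    fix l assume l: "prime l" "l dvd X" "l dvd M"
    have "l dvd M - X\<^sup>2" using l(2,3) by (simp add: power2_eq_square)
    then have "l dvd 27 * (C\<^sup>2 * D) * y\<^sup>2" unfolding M_eq by simp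
    moreover have "\<not> l dvd 27"
    proof
      assume "l dvd 27"
      then have "l dvd 3" using prime_dvd_power[OF l(1), of 3 3] by simp
      then have "l = 3" using l(1) primes_dvd_imp_eq[of l 3] by simp
      then show False using l(3) M_coprime(1) by simp
    qed
    moreover have "\<not> l dvd D" "\<not> l dvd y"
      using coprime_prime_not_dvd[OF _ l(1,3)] M_coprime(3,4) by auto
    ultimately have "l dvd C" using l(1) by (auto simp: prime_dvd_mult_iff prime_dvd_power_iff)
    then show False using X_not_dvd l(1,2) by blast
  qed
  \<comment> \<open>Modulo M, X^2 is the square of -3 y sqrt(-3) C sqrt(D), so X divided by -3 y
    sqrt(-3) acts as C sqrt(D). This congruence is the multiplication by sqrt(D) carried out inside
    Z[\<omega>].\<close>
  have "of_int X * ?\<nu> - of_int (- 3 * y) * (eis_theta * ?\<nu>') = of_int (\<beta> * M)"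
    by (simp add: eis_eq_iff M_eq B_eq power2_eq_square algebra_simps)
  then have "of_int M dvd of_int X * ?\<nu> - of_int (- 3 * y) * (eis_theta * ?\<nu>')" by simp
  then have "csym (of_int X * ?\<nu>) (of_int M) = csym (of_int (- 3 * y) * (eis_theta * ?\<nu>')) (of_int M)"
    by (rule csym_cong[OF M3])
  moreover have "csym ?\<nu>' (of_int M) = 1" using False by (intro csym_nu_twisted) simp
  ultimately show ?thesis
    by (simp only: csym_mult_left[OF M3] c3y cX csym_theta[OF M_coprime(1)] mult_1_left mult_1_right)
qed

end

section \<open>From the symbol modulo M to those modulo a and f\<close>

theorem theorem2p4:
  fixes D A B C d a b c x y f :: int and u :: real
  assumes "D > 1" and "squarefree D"
    and "u = of_int A + of_int B * sqrt (of_int D)" and "u \<in> S_set D"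
    and "C = C_of D A B" and "d = - 27 * C\<^sup>2 * D"
    and "gcd a (gcd (2 * b) c) = 1" and "a > 0" and "b\<^sup>2 - a * c = d"
    and "f = a * x\<^sup>2 + 2 * b * x * y + c * y\<^sup>2"
    and "gcd (a * f) (3 * quad_norm D A B * D * y) = 1"
  shows "cubic_symbol
           (of_int (9 * A * y) + of_int ((B div C) * (a * x + b * y)) * (1 + 2 * eis_omega)) f
       = cubic_symbol
           (of_int (9 * A) - of_int ((B div C) * b) * (1 + 2 * eis_omega)) a"
proof (cases "y = 0")
  \<comment> \<open>The gcd condition becomes gcd(a f, 0) = 1, so the square a f = (a x)^2 is 1 and
    both symbols are empty products.\<close>
  case True
  with assms(11) have "a * f = 1 \<or> a * f = - 1" by auto
  moreover have "f = a * x\<^sup>2" using True assms(10) by simp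
  then have "a * f = (a * x)\<^sup>2" by (simp add: power2_eq_square)
  then have "a * f \<ge> 0" by simp
  ultimately have "a * f = 1" by simp
  then have "a = 1 \<and> f = 1" using assms(8) zmult_eq_1_iff by auto
  then show ?thesis by (simp add: cubic_symbol_eq_csym)
next
  case y0: False
  obtain A' B' n where AB': "u = of_int A' + of_int B' * sqrt (of_int D)" "quad_norm D A' B' = n ^ 3"
      "\<forall>p. prime p \<longrightarrow> \<not> p ^ 3 dvd gcd A' B'"
    using assms(4) by (auto simp: S_set_def)
  \<comment> \<open>Membership in the set provides some coordinates with the required properties;
    irrationality of sqrt(D) identifies them with A and B.\<close>
  have "A = A' \<and> B = B'"
    using assms(1,2) AB'(1) unfolding assms(3) by (rule quad_coordinates_unique)
  then have n: "A\<^sup>2 - B\<^sup>2 * D = n ^ 3" and cf: "\<And>p. prime p \<Longrightarrow> \<not> p ^ 3 dvd gcd A B"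
    using AB'(2,3) by (auto simp: quad_norm_def)
  have g0: "gcd A B \<noteq> 0" using cf[of 2] by auto
  have "C dvd B" unfolding assms(5) using C_of_dvd[OF g0, of D] by simp
  then obtain \<beta> where \<beta>: "B = C * \<beta>" by (elim dvdE)
  define X where "X = a * x + b * y"
  define M where "M = a * f"
  have M_eq: "M = X\<^sup>2 + 27 * (C\<^sup>2 * D) * y\<^sup>2"
  proof -
    have "M = X\<^sup>2 - (b\<^sup>2 - a * c) * y\<^sup>2"
      unfolding M_def X_def assms(10) by (simp add: power2_eq_square algebra_simps)
    then show ?thesis unfolding assms(6,9) by simp
  qed
  have cop: "coprime M (3 * n ^ 3 * D * y)"
    using assms(11) unfolding M_def quad_norm_def n by (simp only: coprime_iff_gcd_eq_1)
  then have M3: "\<not> 3 dvd M" using coprime_prime_not_dvd[of "3 * n ^ 3 * D * y" M 3] by (simp add: coprime_commute)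
  interpret cube_norm_form D A B n C \<beta> X y M
  proof
    show "squarefree D" "A\<^sup>2 - B\<^sup>2 * D = n ^ 3" "B = C * \<beta>" "M = X\<^sup>2 + 27 * (C\<^sup>2 * D) * y\<^sup>2"
      "\<not> 3 dvd M" "y \<noteq> 0" by fact+
    show False if "prime l" "l ^ 3 dvd A" "l ^ 3 dvd B" for l
      using cf[OF that(1)] that(2,3) by simp
    show "l dvd C \<longleftrightarrow> odd l \<and> l dvd A \<and> l dvd B \<and> \<not> l dvd D" if "prime l" for l
      unfolding assms(5) prime_dvd_C_of_iff[OF g0 that] by auto
    show "squarefree C" unfolding assms(5) by (rule squarefree_C_of[OF g0])
    show "coprime M n" "coprime M D" "coprime M y" using cop by (simp_all add: coprime_mult_right_iff)
  qed
  have BC: "B div C = \<beta>" using \<beta> C_nonzero by simp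
  have M0: "M > 0"
  proof -
    have "27 * (C\<^sup>2 * D) * y\<^sup>2 > 0" using C_nonzero y_nonzero assms(1) by simp
    then show ?thesis unfolding M_eq by (intro add_nonneg_pos) simp_all
  qed
  then have af: "a \<noteq> 0" "f \<noteq> 0" by (auto simp: M_def)
  have a3: "\<not> 3 dvd a" "\<not> 3 dvd f" using M3 by (auto simp: M_def)
  have a3': "\<not> 3 dvd eis_norm (of_int a)" "\<not> 3 dvd eis_norm (of_int f)"
    using a3 unfolding not_3_dvd_eis_norm_of_int_iff by auto
  have M3': "\<not> 3 dvd eis_norm (of_int M)" using M3 unfolding not_3_dvd_eis_norm_of_int_iff .
  define L where "L = of_int (9 * A * y) + of_int (\<beta> * X) * (1 + 2 * eis_omega)"
  define R where "R = of_int (9 * A) - of_int (\<beta> * b) * (1 + 2 * eis_omega)"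
  \<comment> \<open>The origin of the 9 in the numerator: sqrt(-3) times -3 A y sqrt(-3) is 9 A
    y.\<close>
  have "L = eis_theta * eis_quad (\<beta> * X) (3 * A * y)"
    by (simp add: L_def eis_eq_iff)
  then have "csym L (of_int M) = 1"
    using csym_nu csym_theta[OF M3] by (simp add: csym_mult_left[OF M3'])
  then have 1: "csym L (of_int a) * csym L (of_int f) = 1"
    using af by (simp add: M_def csym_mult_right)
  have "L - of_int y * eis_cnj R = of_int a * (of_int (\<beta> * x) * eis_theta)"
    by (simp add: L_def R_def X_def eis_eq_iff algebra_simps)
  then have "of_int a dvd L - of_int y * eis_cnj R" by simp
  then have "csym L (of_int a) = csym (of_int y) (of_int a) * csym (eis_cnj R) (of_int a)"
    by (simp only: csym_cong[OF a3'(1)] csym_mult_left[OF a3'(1)])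
  also have "csym (of_int y) (of_int a) = 1"
  proof (intro csym_of_int_of_int coprime_imp_eis_coprime a3(1) af(1))
    show "coprime y a" using M_coprime(4) by (simp add: M_def coprime_commute)
  qed
  also have "csym (eis_cnj R) (of_int a) = eis_cnj (csym R (of_int a))"
    using csym_cnj[OF a3'(1), of R] by simp
  finally have 2: "csym L (of_int a) = eis_cnj (csym R (of_int a))" by simp
  then have "csym R (of_int a) \<noteq> 0" using 1 by auto
  then have 3: "csym R (of_int a) * eis_cnj (csym R (of_int a)) = 1"
    using cubic_values_cnj(4)[OF csym_values[OF a3'(1)]] by blast
  have "csym L (of_int f) = csym R (of_int a) * (eis_cnj (csym R (of_int a)) * csym L (of_int f))"
    using 3 by (simp flip: mult.assoc)
  also have "\<dots> = csym R (of_int a)" using 1 unfolding 2 by simp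
  finally show ?thesis
    unfolding cubic_symbol_eq_csym BC L_def R_def X_def .
qed

end
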